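(* Let $(E,\mathcal F,\mu)$ be a probability space such that $L^2(\mu)$ is infinite-dimensional, and let $P$ be a symmetric Markov operator on $L^2(\mu)$. For $n\in\mathbb N$ let $$D_n=\{(A_1,\dots,A_n): A_1,\dots,A_n\in\mathcal F \text{ pairwise disjoint},\ \mu(A_k)>0,\ 1\le k\le n\},\qquad \kappa_n=\inf_{(A_1,\dots,A_n)\in D_n}\max_{1\le k\le n}\frac{\mu(1_{A_k}P1_{A_k^c})}{\mu(A_k)}.$$ Let $\lambda_{ess}(P)=\sup\sigma_{ess}(P)$, where $\sigma_{ess}(P)$ is the essential spectrum of $P$. Then $\lambda_{ess}(P)<1$ if and only if $\sup_{n\ge1}\kappa_n>0$. Consequently, if $P$ is ergodic (i.e. $1$ is a simple eigenvalue of $P$), then $P$ has a spectral gap (i.e. $1$ is an isolated point of the spectrum of $P$) if and only if $\kappa_2>0$, and also if and only if $\lim_{n\to\infty}\kappa_n>0$ (here $\kappa_n$ is non-decreasing in $n$, so $\kappa_2=\inf_{n\ge2}\kappa_n$ and $\lim_{n\to\infty}\kappa_n=\sup_{n\ge2}\kappa_n$).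
   Context: A Markov operator on $L^2(\mu)$ is a linear operator $P$ with $P1=1$ and $Pf\ge0$ whenever $f\ge0$; symmetric means $P$ is self-adjoint on $L^2(\mu)$. *)

theory Defs
  imports "HOL-Probability.Probability"
begin

text \<open>Real L2(mu): square-integrable measurable functions, elements identified up to
  mu-a.e. equality (relation aeq). Operators act on representatives and must respect aeq.\<close>

definition L2 :: "'a measure \<Rightarrow> ('a \<Rightarrow> real) set" where
  "L2 M = {f. f \<in> borel_measurable M \<and> integrable M (\<lambda>x. (f x)^2)}"

definition aeq :: "'a measure \<Rightarrow> ('a \<Rightarrow> real) \<Rightarrow> ('a \<Rightarrow> real) \<Rightarrow> bool" where
  "aeq M f g \<longleftrightarrow> (AE x in M. f x = g x)"

definition inf_dim_L2 :: "'a measure \<Rightarrow> bool" where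
  "inf_dim_L2 M \<longleftrightarrow> (\<forall>n. \<exists>fs :: nat \<Rightarrow> 'a \<Rightarrow> real. (\<forall>i<n. fs i \<in> L2 M) \<and>
      (\<forall>c. aeq M (\<lambda>x. \<Sum>i<n. c i * fs i x) (\<lambda>x. 0) \<longrightarrow> (\<forall>i<n. c i = 0)))"

definition L2_operator :: "'a measure \<Rightarrow> (('a \<Rightarrow> real) \<Rightarrow> 'a \<Rightarrow> real) \<Rightarrow> bool" where
  "L2_operator M P \<longleftrightarrow>
     (\<forall>f\<in>L2 M. P f \<in> L2 M) \<and>
     (\<forall>f\<in>L2 M. \<forall>g\<in>L2 M. aeq M f g \<longrightarrow> aeq M (P f) (P g)) \<and>
     (\<forall>f\<in>L2 M. \<forall>g\<in>L2 M. \<forall>a b. aeq M (P (\<lambda>y. a * f y + b * g y)) (\<lambda>x. a * P f x + b * P g x))"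

definition markov_operator :: "'a measure \<Rightarrow> (('a \<Rightarrow> real) \<Rightarrow> 'a \<Rightarrow> real) \<Rightarrow> bool" where
  "markov_operator M P \<longleftrightarrow> L2_operator M P \<and>
     aeq M (P (\<lambda>x. 1)) (\<lambda>x. 1) \<and>
     (\<forall>f\<in>L2 M. (AE x in M. f x \<ge> 0) \<longrightarrow> (AE x in M. P f x \<ge> 0))"

definition symmetric_op :: "'a measure \<Rightarrow> (('a \<Rightarrow> real) \<Rightarrow> 'a \<Rightarrow> real) \<Rightarrow> bool" where
  "symmetric_op M P \<longleftrightarrow>
     (\<forall>f\<in>L2 M. \<forall>g\<in>L2 M. integral\<^sup>L M (\<lambda>x. f x * P g x) = integral\<^sup>L M (\<lambda>x. P f x * g x))"

text \<open>Spectrum: l such that P - l I is not a bijection of L2(mu) (bounded inverse is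
  automatic by the open mapping theorem).\<close>
definition op_spectrum :: "'a measure \<Rightarrow> (('a \<Rightarrow> real) \<Rightarrow> 'a \<Rightarrow> real) \<Rightarrow> real set" where
  "op_spectrum M P = {l. \<not> ((\<forall>g\<in>L2 M. \<exists>f\<in>L2 M. aeq M (\<lambda>x. P f x - l * f x) g) \<and>
       (\<forall>f\<in>L2 M. aeq M (\<lambda>x. P f x - l * f x) (\<lambda>x. 0) \<longrightarrow> aeq M f (\<lambda>x. 0)))}"

definition eigenspace :: "'a measure \<Rightarrow> (('a \<Rightarrow> real) \<Rightarrow> 'a \<Rightarrow> real) \<Rightarrow> real \<Rightarrow> ('a \<Rightarrow> real) set" where
  "eigenspace M P l = {f\<in>L2 M. aeq M (\<lambda>x. P f x - l * f x) (\<lambda>x. 0)}"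

definition finite_dim_mod :: "'a measure \<Rightarrow> ('a \<Rightarrow> real) set \<Rightarrow> bool" where
  "finite_dim_mod M S \<longleftrightarrow> (\<exists>B. finite B \<and> B \<subseteq> L2 M \<and>
      (\<forall>f\<in>S. \<exists>c. aeq M f (\<lambda>x. \<Sum>b\<in>B. c b * b x)))"

definition discrete_spectrum :: "'a measure \<Rightarrow> (('a \<Rightarrow> real) \<Rightarrow> 'a \<Rightarrow> real) \<Rightarrow> real set" where
  "discrete_spectrum M P = {l \<in> op_spectrum M P.
      (\<exists>e>0. \<forall>m\<in>op_spectrum M P. m \<noteq> l \<longrightarrow> e \<le> \<bar>m - l\<bar>) \<and>
      (\<exists>f\<in>eigenspace M P l. \<not> aeq M f (\<lambda>x. 0)) \<and>
      finite_dim_mod M (eigenspace M P l)}"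

definition ess_spectrum :: "'a measure \<Rightarrow> (('a \<Rightarrow> real) \<Rightarrow> 'a \<Rightarrow> real) \<Rightarrow> real set" where
  "ess_spectrum M P = op_spectrum M P - discrete_spectrum M P"

definition lambda_ess :: "'a measure \<Rightarrow> (('a \<Rightarrow> real) \<Rightarrow> 'a \<Rightarrow> real) \<Rightarrow> real" where
  "lambda_ess M P = Sup (ess_spectrum M P)"

definition D :: "'a measure \<Rightarrow> nat \<Rightarrow> (nat \<Rightarrow> 'a set) set" where
  "D M n = {A. (\<forall>k\<in>{1..n}. A k \<in> sets M \<and> measure M (A k) > 0) \<and> disjoint_family_on A {1..n}}"

definition kappa :: "'a measure \<Rightarrow> (('a \<Rightarrow> real) \<Rightarrow> 'a \<Rightarrow> real) \<Rightarrow> nat \<Rightarrow> real" where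
  "kappa M P n = Inf ((\<lambda>A. Max ((\<lambda>k. integral\<^sup>L M (\<lambda>x. indicator (A k) x * P (indicator (space M - A k)) x)
                                      / measure M (A k)) ` {1..n})) ` D M n)"

definition ergodic_op :: "'a measure \<Rightarrow> (('a \<Rightarrow> real) \<Rightarrow> 'a \<Rightarrow> real) \<Rightarrow> bool" where
  "ergodic_op M P \<longleftrightarrow> (\<forall>f\<in>eigenspace M P 1. \<exists>c. aeq M f (\<lambda>x. c))"

definition spectral_gap :: "'a measure \<Rightarrow> (('a \<Rightarrow> real) \<Rightarrow> 'a \<Rightarrow> real) \<Rightarrow> bool" where
  "spectral_gap M P \<longleftrightarrow> 1 \<in> op_spectrum M P \<and>
     (\<exists>e>0. \<forall>m\<in>op_spectrum M P. m \<noteq> 1 \<longrightarrow> e \<le> \<bar>m - 1\<bar>)"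

end

theory Submission
  imports Defs "HOL-Library.Function_Algebras"
begin

text \<open>Write \<open>E f = \<langle>f, f\<rangle> - \<langle>P f, f\<rangle>\<close>. Both \<open>lambda_ess < 1\<close> and \<open>sup kappa\<^sub>n > 0\<close> are equivalent to
  coercivity of \<open>E\<close> off a finite set \<open>F\<close>, i.e. \<open>E f \<ge> \<delta> \<langle>f, f\<rangle>\<close> for all \<open>f\<close> orthogonal to \<open>F\<close>.

  If \<open>E\<close> is coercive off \<open>F\<close>, then among \<open>card F + 1\<close> disjoint sets a combination of indicators is
  orthogonal to \<open>F\<close>, so one of the sets has a large boundary; for an ergodic \<open>P\<close> with a gap one may
  take \<open>F = {1}\<close>, which gives \<open>kappa\<^sub>2 > 0\<close>. If \<open>E\<close> is coercive off no finite set, there are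
  \<open>N = 2 n\<close> orthonormal functions of arbitrarily small energy. Approximating them by simple functions
  gives a finite weighted graph on points of \<open>\<real>\<^sup>N\<close> with nearly isotropic mass \<open>|x|\<^sup>2\<close>; isotropy forces
  this mass to spread over \<open>n\<close> separated directions, homogeneous Lipschitz functions supported in
  disjoint cones around these directions have small Rayleigh quotients, and Cheeger's
  level set argument turns each of them into a set with small boundary, so \<open>kappa\<^sub>n = 0\<close>.

  On the spectral side, at an isolated point \<open>l\<close> of the spectrum the operator \<open>P - l\<close> is bounded below
  on the orthogonal complement of its kernel, and the infimum over finite \<open>F\<close> of the supremum of
  the Rayleigh quotient off \<open>F\<close> belongs to the essential spectrum, which is thus nonempty.\<close>

section \<open>Symmetric operators on semi-Hilbert spaces\<close>

text \<open>Two obstacles shape the development. Elements of \<open>L2 M\<close> are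
  representatives, so the inner product is only semidefinite and \<open>P\<close> is linear only up
  to null vectors; identities between vectors are therefore tested by pairing with all vectors, and
  symmetry moves the operator to the other side. Moreover, no spectral measure is used: the spectrum
  is explored through quadratic polynomials such as T^2 - s^2 = (T - s)(T + s) and through the
  Cauchy-Schwarz type bound \<open>nrm_sq_le_form\<close> for nonnegative forms. The passage to a
  finite graph works because on functions of one simple function \<open>F\<close> the form of
  \<open>P\<close> is the symmetric nonnegative matrix \<open>J F\<close>, whose row sums are the
  masses by P 1 = 1; the contraction property of \<open>P\<close> has the same source. The number 2
  n is a mass budget: a cap takes less than 3/2 of a total mass close to 2 n, so n caps can be
  chosen greedily. All bounds depend on n only, not on the size of the graph, hence survive any
  refinement of the approximation.\<close>

lemma homogeneous_system_nontrivial: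
  fixes a :: "'b \<Rightarrow> 'c \<Rightarrow> real"
  assumes "finite F" "finite I" "card F < card I"
  shows "\<exists>c. (\<exists>j\<in>I. c j \<noteq> 0) \<and> (\<forall>i\<in>F. (\<Sum>j\<in>I. a i j * c j) = 0)"
  using assms
proof (induction F arbitrary: I a rule: finite_induct)
  case empty
  then obtain j where "j \<in> I" by fastforce
  then show ?case by (intro exI[of _ "\<lambda>_. 1"]) auto
next
  case (insert g F)
  show ?case
  proof (cases "\<exists>p\<in>I. a g p \<noteq> 0")
    case False
    have "card F < card I" using insert by auto
    from insert.IH[OF \<open>finite I\<close> this, of a]
    obtain c where "\<exists>j\<in>I. c j \<noteq> 0" "\<forall>i\<in>F. (\<Sum>j\<in>I. a i j * c j) = 0" by blast
    then show ?thesis using False by (intro exI[of _ c]) auto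
  next
    case True
    then obtain p where p: "p \<in> I" "a g p \<noteq> 0" by blast
    define I' where "I' = I - {p}"
    have I': "finite I'" "I = insert p I'" "p \<notin> I'" using insert p by (auto simp: I'_def)
    have "card F < card I'" using insert I' by auto
    from insert.IH[OF \<open>finite I'\<close> this, of "\<lambda>i j. a i j - a i p * a g j / a g p"]
    obtain c where c: "\<exists>j\<in>I'. c j \<noteq> 0"
      "\<forall>i\<in>F. (\<Sum>j\<in>I'. (a i j - a i p * a g j / a g p) * c j) = 0" by blast
    define s where "s = (\<Sum>j\<in>I'. a g j * c j)"
    \<comment> \<open>Gaussian elimination with pivot \<open>a g p\<close>: this value at
      \<open>p\<close> solves equation \<open>g\<close>, and the induction hypothesis was applied to
      the other equations with \<open>p\<close> eliminated.\<close>
    define c' where "c' = c(p := - s / a g p)"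
    have expand: "(\<Sum>j\<in>I. a i j * c' j) = - a i p * s / a g p + (\<Sum>j\<in>I'. a i j * c j)" for i
    proof -
      have "(\<Sum>j\<in>I'. a i j * c' j) = (\<Sum>j\<in>I'. a i j * c j)"
        using I' by (intro sum.cong) (auto simp: c'_def)
      then show ?thesis using I' by (simp add: c'_def)
    qed
    have "(\<Sum>j\<in>I. a i j * c' j) = 0" if "i \<in> F" for i
    proof -
      have "0 = (\<Sum>j\<in>I'. (a i j - a i p * a g j / a g p) * c j)" using c that by simp
      also have "\<dots> = (\<Sum>j\<in>I'. a i j * c j) - a i p / a g p * s"
        by (simp add: s_def sum_distrib_left right_diff_distrib left_diff_distrib sum_subtractf divide_inverse mult_ac)
      finally show ?thesis by (simp add: expand)
    qed
    moreover have "(\<Sum>j\<in>I. a g j * c' j) = 0" using p by (simp add: expand s_def)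
    moreover have "\<exists>j\<in>I. c' j \<noteq> 0" using c I' by (auto simp: c'_def)
    ultimately show ?thesis by (intro exI[of _ c']) auto
  qed
qed

text \<open>Division by a coefficient of largest modulus. In \<open>card_spectrum_above_le\<close>
  the bound 1 on all coefficients controls the error terms, and the coefficient of modulus 1 keeps
  the main term away from zero.\<close>

lemma homogeneous_system_normalised:
  fixes a :: "'b \<Rightarrow> 'c \<Rightarrow> real"
  assumes "finite F" "finite I" "card F < card I"
  obtains c k where "k \<in> I" "\<bar>c k\<bar> = 1" "\<And>j. j \<in> I \<Longrightarrow> \<bar>c j\<bar> \<le> 1"
    "\<And>i. i \<in> F \<Longrightarrow> (\<Sum>j\<in>I. a i j * c j) = 0"
proof -
  obtain c where c: "\<exists>j\<in>I. c j \<noteq> 0" "\<forall>i\<in>F. (\<Sum>j\<in>I. a i j * c j) = 0"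
    using homogeneous_system_nontrivial[OF assms, of a] by blast
  have "Max ((\<lambda>j. \<bar>c j\<bar>) ` I) \<in> (\<lambda>j. \<bar>c j\<bar>) ` I" using assms(2) c(1) by (intro Max_in) auto
  then obtain k where k: "k \<in> I" "Max ((\<lambda>j. \<bar>c j\<bar>) ` I) = \<bar>c k\<bar>" by auto
  have le: "\<bar>c j\<bar> \<le> \<bar>c k\<bar>" if "j \<in> I" for j using Max_ge[of "(\<lambda>j. \<bar>c j\<bar>) ` I" "\<bar>c j\<bar>"] assms(2) k that by auto
  then have pos: "\<bar>c k\<bar> > 0" using c(1) by fastforce
  show ?thesis
  proof (rule that[of k "\<lambda>j. c j / \<bar>c k\<bar>"])
    show "(\<Sum>j\<in>I. a i j * (c j / \<bar>c k\<bar>)) = 0" if "i \<in> F" for i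
      using c(2) that by (simp flip: sum_divide_distrib)
  qed (use k le pos in \<open>auto simp: abs_divide\<close>)
qed

section \<open>Calculus modulo null vectors in a semi-inner product space\<close>

locale semi_inner =
  fixes S :: "'v::real_vector set" and ip :: "'v \<Rightarrow> 'v \<Rightarrow> real"
  assumes S_subspace: "subspace S"
    and ip_add_left: "\<lbrakk>f \<in> S; g \<in> S; h \<in> S\<rbrakk> \<Longrightarrow> ip (f + g) h = ip f h + ip g h"
    and ip_scale_left: "\<lbrakk>f \<in> S; h \<in> S\<rbrakk> \<Longrightarrow> ip (a *\<^sub>R f) h = a * ip f h"
    and ip_commute: "\<lbrakk>f \<in> S; g \<in> S\<rbrakk> \<Longrightarrow> ip f g = ip g f"
    and ip_nonneg: "f \<in> S \<Longrightarrow> 0 \<le> ip f f"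
begin

definition nrm :: "'v \<Rightarrow> real" where "nrm f = sqrt (ip f f)"

lemma S_0 [simp]: "0 \<in> S" and S_add [simp]: "\<lbrakk>f \<in> S; g \<in> S\<rbrakk> \<Longrightarrow> f + g \<in> S"
  and S_scale [simp]: "f \<in> S \<Longrightarrow> a *\<^sub>R f \<in> S"
  and S_diff [simp]: "\<lbrakk>f \<in> S; g \<in> S\<rbrakk> \<Longrightarrow> f - g \<in> S"
  and S_minus [simp]: "f \<in> S \<Longrightarrow> - f \<in> S"
  using S_subspace by (auto simp: subspace_0 subspace_add subspace_scale subspace_diff subspace_neg)

lemma S_sum [simp]: "(\<And>i. i \<in> I \<Longrightarrow> f i \<in> S) \<Longrightarrow> (\<Sum>i\<in>I. f i) \<in> S"
  using S_subspace by (auto intro: subspace_sum)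

lemma ip_minus_left: "\<lbrakk>f \<in> S; h \<in> S\<rbrakk> \<Longrightarrow> ip (- f) h = - ip f h"
  using ip_scale_left[of f h "-1"] by simp

lemma ip_diff_left: "\<lbrakk>f \<in> S; g \<in> S; h \<in> S\<rbrakk> \<Longrightarrow> ip (f - g) h = ip f h - ip g h"
  using ip_add_left[of f "- g" h] by (simp add: ip_minus_left)

lemma ip_add_right: "\<lbrakk>f \<in> S; g \<in> S; h \<in> S\<rbrakk> \<Longrightarrow> ip h (f + g) = ip h f + ip h g"
  by (simp add: ip_commute[of h] ip_add_left)

lemma ip_diff_right: "\<lbrakk>f \<in> S; g \<in> S; h \<in> S\<rbrakk> \<Longrightarrow> ip h (f - g) = ip h f - ip h g"
  by (simp add: ip_commute[of h] ip_diff_left)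

lemma ip_scale_right: "\<lbrakk>f \<in> S; h \<in> S\<rbrakk> \<Longrightarrow> ip h (a *\<^sub>R f) = a * ip h f"
  by (simp add: ip_commute[of h] ip_scale_left)

lemma ip_minus_right: "\<lbrakk>f \<in> S; h \<in> S\<rbrakk> \<Longrightarrow> ip h (- f) = - ip h f"
  by (simp add: ip_commute[of h] ip_minus_left)

lemma ip_0_left: "h \<in> S \<Longrightarrow> ip 0 h = 0" using ip_scale_left[of 0 h 0] by simp
lemma ip_0_right: "h \<in> S \<Longrightarrow> ip h 0 = 0" using ip_scale_right[of 0 h 0] by simp

lemmas ip_linear = ip_add_left ip_diff_left ip_scale_left ip_minus_left ip_add_right ip_diff_right
  ip_scale_right ip_minus_right ip_0_left ip_0_right

lemma ip_sum_left:
  assumes "\<And>i. i \<in> I \<Longrightarrow> f i \<in> S" "h \<in> S"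
  shows "ip (\<Sum>i\<in>I. f i) h = (\<Sum>i\<in>I. ip (f i) h)"
  using assms by (induction I rule: infinite_finite_induct) (auto simp: ip_linear)

lemma ip_sum_right:
  assumes "\<And>i. i \<in> I \<Longrightarrow> f i \<in> S" "h \<in> S"
  shows "ip h (\<Sum>i\<in>I. f i) = (\<Sum>i\<in>I. ip h (f i))"
  using ip_sum_left[OF assms] ip_commute[of h] assms by (simp cong: sum.cong)

lemma nrm_sq: "f \<in> S \<Longrightarrow> (nrm f)\<^sup>2 = ip f f" by (simp add: nrm_def ip_nonneg)
lemma nrm_nonneg [simp]: "f \<in> S \<Longrightarrow> 0 \<le> nrm f" by (simp add: nrm_def ip_nonneg)

lemma nrm_0 [simp]: "nrm 0 = 0" by (simp add: nrm_def ip_linear)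

lemma Cauchy_Schwarz: assumes "f \<in> S" "g \<in> S" shows "\<bar>ip f g\<bar> \<le> nrm f * nrm g"
proof -
  have q: "0 \<le> ip f f - 2 * t * ip f g + t\<^sup>2 * ip g g" for t
    using ip_nonneg[of "f - t *\<^sub>R g"] assms
    by (simp add: ip_linear ip_commute[of g f] power2_eq_square algebra_simps)
  have "(ip f g)\<^sup>2 \<le> ip f f * ip g g"
  proof (cases "ip g g = 0")
    case True
    have "ip f g = 0"
    proof (rule ccontr)
      assume "ip f g \<noteq> 0"
      \<comment> \<open>With \<open>ip g g = 0\<close> the quadratic in \<open>t\<close> degenerates
        to a linear function; this \<open>t\<close> gives it the value -1.\<close>
      then show False using q[of "(ip f f + 1) / (2 * ip f g)"] True by (simp add: field_simps)
    qed
    then show ?thesis using True by simp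
  next
    case False
    then have "ip g g > 0" using ip_nonneg[OF assms(2)] by simp
    then show ?thesis using q[of "ip f g / ip g g"] by (simp add: field_simps power2_eq_square)
  qed
  then have "sqrt ((ip f g)\<^sup>2) \<le> sqrt (ip f f * ip g g)" by (rule real_sqrt_le_mono)
  then show ?thesis by (simp add: nrm_def real_sqrt_mult)
qed

lemma nrm_triangle: assumes "f \<in> S" "g \<in> S" shows "nrm (f + g) \<le> nrm f + nrm g"
proof (rule power2_le_imp_le)
  show "(nrm (f + g))\<^sup>2 \<le> (nrm f + nrm g)\<^sup>2"
    using Cauchy_Schwarz[OF assms] assms
    by (simp add: nrm_sq ip_linear power2_sum ip_commute[of g f])
qed (use assms in simp)

lemma nrm_scale: "f \<in> S \<Longrightarrow> nrm (a *\<^sub>R f) = \<bar>a\<bar> * nrm f"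
  by (simp add: nrm_def ip_linear real_sqrt_mult[symmetric] flip: mult.assoc real_sqrt_abs)
     (simp add: real_sqrt_mult power2_eq_square)

lemma nrm_minus: "f \<in> S \<Longrightarrow> nrm (- f) = nrm f" by (simp add: nrm_def ip_linear)

lemma nrm_diff_commute: "\<lbrakk>f \<in> S; g \<in> S\<rbrakk> \<Longrightarrow> nrm (f - g) = nrm (g - f)"
  using nrm_minus[of "f - g"] by simp

lemma nrm_diff_triangle: "\<lbrakk>f \<in> S; g \<in> S; h \<in> S\<rbrakk> \<Longrightarrow> nrm (f - h) \<le> nrm (f - g) + nrm (g - h)"
  using nrm_triangle[of "f - g" "g - h"] by simp

lemma nrm_triangle_diff: "\<lbrakk>f \<in> S; g \<in> S\<rbrakk> \<Longrightarrow> nrm (f - g) \<le> nrm f + nrm g"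
  using nrm_triangle[of f "- g"] by (simp add: nrm_minus)

lemma nrm_le_diff: "\<lbrakk>f \<in> S; g \<in> S\<rbrakk> \<Longrightarrow> nrm f \<le> nrm (f - g) + nrm g"
  using nrm_triangle[of "f - g" "g"] by simp

lemma nrm_sum: "(\<And>i. i \<in> I \<Longrightarrow> f i \<in> S) \<Longrightarrow> nrm (\<Sum>i\<in>I. f i) \<le> (\<Sum>i\<in>I. nrm (f i))"
proof (induction I rule: infinite_finite_induct)
  case (insert x F)
  then show ?case using nrm_triangle[of "f x" "\<Sum>i\<in>F. f i"] by simp
qed auto

lemma ip_null: "\<lbrakk>f \<in> S; g \<in> S; nrm f = 0\<rbrakk> \<Longrightarrow> ip f g = 0"
  using Cauchy_Schwarz[of f g] by simp

lemma ip_eq_if_null_diff: "\<lbrakk>f \<in> S; g \<in> S; h \<in> S; nrm (f - g) = 0\<rbrakk> \<Longrightarrow> ip f h = ip g h"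
  using ip_null[of "f - g" h] by (simp add: ip_linear)

text \<open>The test vector \<open>f - g\<close> suffices. Together with \<open>nrm_cong\<close>
  this replaces equality of vectors: additivity and homogeneity of a symmetric operator hold only up
  to null vectors and are always used in this form.\<close>

lemma nrm_diff_eq_0I:
  assumes "f \<in> S" "g \<in> S" "\<And>h. h \<in> S \<Longrightarrow> ip f h = ip g h"
  shows "nrm (f - g) = 0"
  using assms(3)[of "f - g"] assms(1,2) by (simp add: nrm_def ip_diff_left)

lemma nrm_eq_if_null_diff:
  assumes "f \<in> S" "g \<in> S" "nrm (f - g) = 0" shows "nrm f = nrm g"
  using nrm_le_diff[of f g] nrm_le_diff[of g f] assms by (simp add: nrm_diff_commute[of g f])

lemma nrm_cong:
  assumes "f \<in> S" "g \<in> S" "\<And>h. h \<in> S \<Longrightarrow> ip f h = ip g h"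
  shows "nrm f = nrm g"
  using nrm_diff_eq_0I[OF assms] nrm_eq_if_null_diff assms by blast

lemma geometric_step_bound:
  assumes u: "\<And>n. u n \<in> S" and q: "0 \<le> q" "q < 1"
    and d: "\<And>n. nrm (u (Suc n) - u n) \<le> c * q ^ n"
  shows "nrm (u (n + k) - u n) \<le> c * q ^ n / (1 - q)"
proof -
  have c: "0 \<le> c" using order_trans[OF nrm_nonneg d[of 0]] u by simp
  \<comment> \<open>The exact partial geometric sum is carried along, since the bound without the
    factor \<open>1 - q ^ k\<close> is not inductive.\<close>
  have "nrm (u (n + k) - u n) \<le> c * q ^ n * (1 - q ^ k) / (1 - q)"
  proof (induction k)
    case (Suc k)
    have "nrm (u (n + Suc k) - u n) \<le> c * q ^ (n + k) + c * q ^ n * (1 - q ^ k) / (1 - q)"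
      using nrm_diff_triangle[of "u (n + Suc k)" "u (n + k)" "u n"] u d[of "n + k"] Suc by simp
    also have "\<dots> = c * q ^ n * (1 - q ^ Suc k) / (1 - q)"
      using q by (simp add: field_simps power_add)
    finally show ?case .
  qed (simp add: u)
  also have "\<dots> \<le> c * q ^ n * 1 / (1 - q)"
    using c q by (intro divide_right_mono mult_left_mono) auto
  finally show ?thesis by simp
qed

end

text \<open>Limits are demanded only for sequences with geometrically decreasing steps: the
  fixed-point iteration and the gliding hump below produce such sequences, and for
  \<open>L2 M\<close> this form follows from absolute convergence almost everywhere.\<close>

locale semi_hilbert = semi_inner S ip for S :: "'v::real_vector set" and ip +
  assumes S_complete: "\<lbrakk>\<And>n::nat. u n \<in> S; 0 \<le> q; q < 1; \<And>n. nrm (u (Suc n) - u n) \<le> c * q ^ n\<rbrakk> \<Longrightarrow>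
    \<exists>v\<in>S. (\<lambda>n. nrm (u n - v)) \<longlonglongrightarrow> 0"
begin

lemma geometric_limit:
  assumes u: "\<And>n. u n \<in> S" and q: "0 \<le> q" "q < 1"
    and d: "\<And>n. nrm (u (Suc n) - u n) \<le> c * q ^ n"
  shows "\<exists>v\<in>S. \<forall>n. nrm (u n - v) \<le> c * q ^ n / (1 - q)"
proof -
  note b = geometric_step_bound[of u, OF u q d]
  have "\<exists>v\<in>S. (\<lambda>n. nrm (u n - v)) \<longlonglongrightarrow> 0"
    by (rule S_complete[of u q c]) (use u q d in auto)
  then obtain v where v: "v \<in> S" "(\<lambda>n. nrm (u n - v)) \<longlonglongrightarrow> 0" by auto
  have "nrm (u n - v) \<le> c * q ^ n / (1 - q)" for n
  proof (rule tendsto_lowerbound)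
    show "(\<lambda>k. c * q ^ n / (1 - q) + nrm (u (n + k) - v)) \<longlonglongrightarrow> c * q ^ n / (1 - q)"
      using LIMSEQ_ignore_initial_segment[OF v(2), of n]
      by (auto intro!: tendsto_eq_intros simp: add.commute)
    show "\<forall>\<^sub>F k in sequentially. nrm (u n - v) \<le> c * q ^ n / (1 - q) + nrm (u (n + k) - v)"
    proof (rule always_eventually, intro allI)
      fix k show "nrm (u n - v) \<le> c * q ^ n / (1 - q) + nrm (u (n + k) - v)"
        using nrm_diff_triangle[of "u n" "u (n + k)" v] u v(1) b[of n k] nrm_diff_commute[of "u n" "u (n + k)"]
        by simp
    qed
  qed simp
  then show ?thesis using v by blast
qed

section \<open>Bounded symmetric operators: invertibility and bounds from below\<close>

definition bsym :: "real \<Rightarrow> ('v \<Rightarrow> 'v) \<Rightarrow> bool" where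
  "bsym K T \<longleftrightarrow> 0 < K \<and> (\<forall>f\<in>S. T f \<in> S) \<and> (\<forall>f\<in>S. \<forall>g\<in>S. ip (T f) g = ip f (T g)) \<and>
     (\<forall>f\<in>S. nrm (T f) \<le> K * nrm f)"

definition shift :: "('v \<Rightarrow> 'v) \<Rightarrow> real \<Rightarrow> 'v \<Rightarrow> 'v" where
  "shift T l f = T f - l *\<^sub>R f"

definition bounded_below :: "('v \<Rightarrow> 'v) \<Rightarrow> bool" where
  "bounded_below T \<longleftrightarrow> (\<exists>c>0. \<forall>f\<in>S. c * nrm f \<le> nrm (T f))"

definition regular :: "('v \<Rightarrow> 'v) \<Rightarrow> bool" where
  "regular T \<longleftrightarrow> (\<forall>g\<in>S. \<exists>f\<in>S. nrm (T f - g) = 0) \<and> (\<forall>f\<in>S. nrm (T f) = 0 \<longrightarrow> nrm f = 0)"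

lemma bsymD:
  assumes "bsym K T"
  shows "0 < K" "\<And>f. f \<in> S \<Longrightarrow> T f \<in> S" "\<And>f g. \<lbrakk>f \<in> S; g \<in> S\<rbrakk> \<Longrightarrow> ip (T f) g = ip f (T g)"
    "\<And>f. f \<in> S \<Longrightarrow> nrm (T f) \<le> K * nrm f"
  using assms by (auto simp: bsym_def)

lemma bsym_shift: assumes "bsym K T" shows "bsym (K + \<bar>l\<bar>) (shift T l)"
proof -
  note T = bsymD[OF assms]
  have "nrm (T f - l *\<^sub>R f) \<le> (K + \<bar>l\<bar>) * nrm f" if "f \<in> S" for f
    using nrm_triangle_diff[of "T f" "l *\<^sub>R f"] T(2)[OF that] T(4)[OF that] that
    by (simp add: nrm_scale algebra_simps)
  then show ?thesis using T by (auto simp: bsym_def shift_def ip_linear)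
qed

lemma bsym_square: assumes "bsym K T" shows "bsym (K * K) (\<lambda>f. T (T f))"
proof -
  note T = bsymD[OF assms]
  have "nrm (T (T f)) \<le> K * K * nrm f" if "f \<in> S" for f
    using T(4)[of "T f"] T(4)[of f] T(2)[OF that] T(1) that
    by (smt (verit, best) mult.assoc mult_left_mono)
  then show ?thesis using T by (auto simp: bsym_def)
qed

text \<open>Additivity up to null vectors is a consequence of symmetry:
  \<open>ip (T (f - g)) h = ip (f - g) (T h)\<close> for every \<open>h\<close>.\<close>

lemma bsym_diff_null:
  assumes "bsym K T" "f \<in> S" "g \<in> S"
  shows "nrm (T (f - g) - (T f - T g)) = 0"
  using bsymD[OF assms(1)] assms(2,3) by (intro nrm_diff_eq_0I) (auto simp: ip_linear)

lemma bsym_nrm_diff: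
  assumes "bsym K T" "f \<in> S" "g \<in> S"
  shows "nrm (T f - T g) \<le> K * nrm (f - g)"
  using bsymD(4)[OF assms(1), of "f - g"] bsymD(2)[OF assms(1)] assms
    nrm_eq_if_null_diff[OF _ _ bsym_diff_null[OF assms]] by simp

text \<open>The factorisation T^2 - a^2 = (T - a)(T + a), valid up to null vectors.\<close>

lemma bounded_below_square:
  assumes T: "bsym K T" and "bounded_below (shift T a)" "bounded_below (shift T (- a))"
  shows "bounded_below (shift (\<lambda>f. T (T f)) (a * a))"
proof -
  note T = bsymD[OF T]
  obtain c1 c2 where c: "c1 > 0" "\<And>f. f \<in> S \<Longrightarrow> c1 * nrm f \<le> nrm (shift T a f)"
     "c2 > 0" "\<And>f. f \<in> S \<Longrightarrow> c2 * nrm f \<le> nrm (shift T (- a) f)"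
    using assms(2,3) unfolding bounded_below_def by blast
  have "c1 * c2 * nrm f \<le> nrm (shift (\<lambda>f. T (T f)) (a * a) f)" if f: "f \<in> S" for f
  proof -
    define g where "g = shift T (- a) f"
    have g: "g \<in> S" using T f by (simp add: g_def shift_def)
    have "c1 * c2 * nrm f \<le> c1 * nrm g" using c(1) c(4)[OF f] by (simp add: g_def)
    also have "\<dots> \<le> nrm (shift T a g)" using c(2)[OF g] .
    also have "\<dots> = nrm (shift (\<lambda>f. T (T f)) (a * a) f)"
      using T f g by (intro nrm_cong) (simp_all add: shift_def g_def ip_linear algebra_simps)
    finally show ?thesis .
  qed
  then show ?thesis unfolding bounded_below_def using c by (intro exI[of _ "c1 * c2"]) auto
qed

text \<open>Only the values of the form on the two vectors \<open>f\<close> and \<open>G f\<close> enter, so positivity on a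
  (not necessarily invariant) subspace containing both suffices.\<close>

lemma nrm_sq_le_form:
  assumes G: "bsym K G" and f: "f \<in> S"
    and pos: "\<And>t. 0 \<le> ip (G (f - t *\<^sub>R G f)) (f - t *\<^sub>R G f)"
  shows "(nrm (G f))\<^sup>2 \<le> K * ip (G f) f"
proof -
  note G = bsymD[OF G]
  define g where "g = G f"
  have g: "g \<in> S" using G f by (simp add: g_def)
  have "ip (G g) g \<le> nrm (G g) * nrm g" using Cauchy_Schwarz[of "G g" g] G g by simp
  also have "\<dots> \<le> K * ip g g"
    using mult_right_mono[OF G(4)[OF g], of "nrm g"] g nrm_sq[OF g] by (simp add: power2_eq_square mult.assoc)
  finally have 1: "ip (G g) g \<le> K * ip g g" .
  \<comment> \<open>By the bound \<open>1\<close>, the form at \<open>f - t *\<^sub>R g\<close> is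
    at most \<open>ip (G f) f - (2 * t - K * t\<^sup>2) * ip g g\<close>; the choice t = 1/K
    minimises this.\<close>
  have "0 \<le> ip (G (f - (1/K) *\<^sub>R g)) (f - (1/K) *\<^sub>R g)" using pos g_def by simp
  also have "\<dots> = ip (G f) f - 2 / K * ip g g + (1 / K)\<^sup>2 * ip (G g) g"
    using G f g ip_commute[of f g] ip_commute[of "G g" f]
    by (simp add: ip_linear g_def[symmetric] algebra_simps power2_eq_square)
  also have "\<dots> \<le> ip (G f) f - 2 / K * ip g g + (1 / K)\<^sup>2 * (K * ip g g)"
    using 1 by (intro add_left_mono mult_left_mono) auto
  also have "\<dots> = ip (G f) f - ip g g / K" using G(1) by (simp add: power2_eq_square field_simps)
  finally show ?thesis using G(1) g by (simp add: nrm_sq field_simps g_def)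
qed

text \<open>The best lower bound \<open>s\<close> is approached at a spectral value: the form of G =
  T^2 - s^2 is nonnegative and arbitrarily small on unit vectors, so by
  \<open>nrm_sq_le_form\<close> the operator \<open>G\<close> is not bounded below. If s < d, both
  factors T - s and T + s are bounded below, which is a contradiction.\<close>

lemma bounded_below_gap:
  assumes T: "bsym K T" and d: "d > 0" and gap: "\<And>r. \<bar>r\<bar> < d \<Longrightarrow> bounded_below (shift T r)" and f: "f \<in> S"
  shows "d * nrm f \<le> nrm (T f)"
proof -
  note TD = bsymD[OF T]
  define X where "X = (\<lambda>f. nrm (T f)) ` {f\<in>S. nrm f = 1}"
  have normalise: "(1 / nrm f) *\<^sub>R f \<in> S \<and> nrm ((1 / nrm f) *\<^sub>R f) = 1 \<and> nrm (T ((1 / nrm f) *\<^sub>R f)) = nrm (T f) / nrm f"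
    if "f \<in> S" "nrm f \<noteq> 0" for f
  proof (intro conjI)
    have "nrm (T ((1 / nrm f) *\<^sub>R f)) = nrm ((1 / nrm f) *\<^sub>R T f)"
      using TD that by (intro nrm_cong) (auto simp: ip_linear)
    then show "nrm (T ((1 / nrm f) *\<^sub>R f)) = nrm (T f) / nrm f"
      using that TD by (simp add: nrm_scale)
  qed (use that in \<open>auto simp: nrm_scale\<close>)
  show ?thesis
  proof (cases "X = {}")
    case True
    then have "nrm f = 0" using normalise[OF f] by (auto simp: X_def)
    then show ?thesis using TD f by simp
  next
    case False
    have X0: "x \<ge> 0" if "x \<in> X" for x using that TD by (auto simp: X_def)
    then have bdd: "bdd_below X" by (rule bdd_belowI)
    define s where "s = Inf X"
    have s0: "s \<ge> 0" unfolding s_def using X0 False by (intro cInf_greatest) auto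
    have s: "s * nrm f \<le> nrm (T f)" if "f \<in> S" for f
    proof (cases "nrm f = 0")
      case False
      have "s \<le> nrm (T f) / nrm f" unfolding s_def
        using normalise[OF that False] by (intro cInf_lower[OF _ bdd]) (auto simp: X_def image_iff intro!: exI[of _ "(1 / nrm f) *\<^sub>R f"])
      then show ?thesis using False nrm_nonneg[OF that] by (simp add: field_simps)
    qed (use that TD in simp)
    have "d \<le> s"
    proof (rule ccontr)
      assume "\<not> d \<le> s"
      then have "bounded_below (shift T s)" "bounded_below (shift T (- s))" using s0 by (auto intro!: gap)
      define G where "G = shift (\<lambda>f. T (T f)) (s * s)"
      have "bounded_below G" unfolding G_def by (intro bounded_below_square[OF T]) fact+
      then obtain c where c: "c > 0" "\<And>f. f \<in> S \<Longrightarrow> c * nrm f \<le> nrm (G f)" unfolding bounded_below_def by blast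
      obtain K' where G: "bsym K' G" unfolding G_def using bsym_shift[OF bsym_square[OF T]] by blast
      have K': "K' > 0" using bsymD[OF G] by simp
      have form: "ip (G f) f = (nrm (T f))\<^sup>2 - s\<^sup>2 * (nrm f)\<^sup>2" if "f \<in> S" for f
        using that TD by (simp add: G_def shift_def ip_linear nrm_sq power2_eq_square[of s])
      have pos: "0 \<le> ip (G f) f" if "f \<in> S" for f
        using power_mono[OF s[OF that], of 2] s0 nrm_nonneg[OF that] by (simp add: form[OF that] power_mult_distrib)
      \<comment> \<open>On a unit vector within \<open>\<eta>\<close> of the infimum the form of
        \<open>G\<close> is at most \<open>\<eta> * (2 * s + 1)\<close>, and \<open>K'\<close> times
        this must stay below \<open>c\<^sup>2\<close>.\<close>
      define \<eta> where "\<eta> = min 1 (c\<^sup>2 / (2 * K' * (2 * s + 1)))"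
      have \<eta>: "\<eta> > 0" "\<eta> \<le> 1" "\<eta> \<le> c\<^sup>2 / (2 * K' * (2 * s + 1))" using c K' s0 by (auto simp: \<eta>_def)
      obtain x where "x \<in> X" "x < s + \<eta>" using cInf_lessD[OF False, of "s + \<eta>"] \<eta> s_def by auto
      then obtain f where f: "f \<in> S" "nrm f = 1" "nrm (T f) < s + \<eta>" by (auto simp: X_def)
      have "c\<^sup>2 \<le> (nrm (G f))\<^sup>2" using c(2)[OF f(1)] c(1) f by (intro power_mono) auto
      also have "\<dots> \<le> K' * ip (G f) f"
        by (rule nrm_sq_le_form[OF G f(1)], rule pos) (use f bsymD(2)[OF G] in simp)
      also have "ip (G f) f \<le> (s + \<eta>)\<^sup>2 - s\<^sup>2" using form[OF f(1)] f TD(2) by (simp add: power_mono)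
      also have "\<dots> \<le> \<eta> * (2 * s + 1)" using \<eta> s0 mult_left_mono[of \<eta> 1 \<eta>] by (simp add: power2_eq_square algebra_simps)
      also have "K' * (\<eta> * (2 * s + 1)) \<le> c\<^sup>2 / 2"
        using \<eta>(3) K' s0 pos_le_divide_eq[of "2 * K' * (2 * s + 1)" \<eta> "c\<^sup>2"] by (simp add: mult_ac)
      finally show False using c K' by (simp add: mult_left_mono)
    qed
    then show ?thesis using s[OF f] nrm_nonneg[OF f] by (meson mult_right_mono order_trans)
  qed
qed

text \<open>The iteration w - \<tau> (C (C w) - g) is a contraction on \<open>R\<close>, because C^2
  is a nonnegative operator that is bounded below there. As \<open>R\<close> need not be closed, the
  solution \<open>v\<close> lies only in \<open>S\<close>, and the approximating sequence in
  \<open>R\<close> is part of the conclusion.\<close>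

lemma contraction_solution:
  assumes C: "bsym K C" and R: "subspace R" "R \<subseteq> S" "\<And>f. f \<in> R \<Longrightarrow> C (C f) \<in> R"
    and e: "e > 0" "\<And>h. h \<in> R \<Longrightarrow> e * nrm h \<le> nrm (C h)" and g: "g \<in> R"
  shows "\<exists>u v. (\<forall>n. u n \<in> R) \<and> v \<in> S \<and> (\<lambda>n. nrm (u n - v)) \<longlonglongrightarrow> 0 \<and> nrm (C (C v) - g) = 0"
proof -
  note CD = bsymD[OF C]
  define B where "B = (\<lambda>f. C (C f))"
  have B: "bsym (K * K) B" unfolding B_def by (rule bsym_square[OF C])
  note BD = bsymD[OF B]
  \<comment> \<open>This step size makes the second order term
    \<open>\<tau>\<^sup>2 * (nrm (B d))\<^sup>2\<close> at most half of the first order gain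
    \<open>2 * \<tau> * (nrm (C d))\<^sup>2\<close>.\<close>
  define \<tau> where "\<tau> = 1 / (K * K)"
  have \<tau>: "\<tau> > 0" "\<tau> * (K * K) = 1" using CD(1) by (auto simp: \<tau>_def)
  \<comment> \<open>The \<open>max 0\<close> keeps the radicand nonnegative:
    \<open>\<tau> * e\<^sup>2\<close> can exceed 1 when all vectors of \<open>R\<close> are
    null.\<close>
  define q where "q = sqrt (max 0 (1 - \<tau> * e\<^sup>2))"
  have q: "0 \<le> q" "q < 1" using \<tau> e by (auto simp: q_def)
  define u where "u = rec_nat 0 (\<lambda>_ w. w - \<tau> *\<^sub>R (B w - g))"
  have u0: "u 0 = 0" and uS: "u (Suc n) = u n - \<tau> *\<^sub>R (B (u n) - g)" for n by (auto simp: u_def)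
  have uR: "u n \<in> R" for n
    by (induction n) (use R g in \<open>auto simp: u0 uS B_def subspace_0 subspace_diff subspace_scale\<close>)
  have RS [simp]: "f \<in> R \<Longrightarrow> f \<in> S" for f using R by auto
  have uS' [simp]: "u n \<in> S" for n using uR by simp
  have gS [simp]: "g \<in> S" using g by simp
  have contr: "nrm (d - \<tau> *\<^sub>R B d) \<le> q * nrm d" if d: "d \<in> R" for d
  proof (rule power2_le_imp_le)
    have dS: "d \<in> S" "C d \<in> S" "B d \<in> S" using d CD BD by auto
    have 1: "(nrm (B d))\<^sup>2 \<le> K * K * (nrm (C d))\<^sup>2"
      using power_mono[OF CD(4)[of "C d"], of 2] dS by (simp add: B_def power_mult_distrib power2_eq_square mult_ac)
    have 2: "e\<^sup>2 * (nrm d)\<^sup>2 \<le> (nrm (C d))\<^sup>2"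
      using power_mono[OF e(2)[OF d], of 2] e(1) dS by (simp add: power_mult_distrib)
    have "(nrm (d - \<tau> *\<^sub>R B d))\<^sup>2 = (nrm d)\<^sup>2 - 2 * \<tau> * (nrm (C d))\<^sup>2 + \<tau>\<^sup>2 * (nrm (B d))\<^sup>2"
      using dS CD by (simp add: nrm_sq ip_linear B_def) (simp add: power2_eq_square algebra_simps)
    also have "\<dots> \<le> (nrm d)\<^sup>2 - 2 * \<tau> * (nrm (C d))\<^sup>2 + \<tau>\<^sup>2 * (K * K * (nrm (C d))\<^sup>2)"
      using 1 by (intro add_left_mono mult_left_mono) auto
    also have "\<tau>\<^sup>2 * (K * K * (nrm (C d))\<^sup>2) = \<tau> * (nrm (C d))\<^sup>2" using \<tau>(2) by (simp add: power2_eq_square)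
    also have "(nrm d)\<^sup>2 - 2 * \<tau> * (nrm (C d))\<^sup>2 + \<tau> * (nrm (C d))\<^sup>2 = (nrm d)\<^sup>2 - \<tau> * (nrm (C d))\<^sup>2" by simp
    also have "\<dots> \<le> (nrm d)\<^sup>2 - \<tau> * (e\<^sup>2 * (nrm d)\<^sup>2)" using 2 \<tau> by simp
    also have "\<dots> = (1 - \<tau> * e\<^sup>2) * (nrm d)\<^sup>2" by (simp add: algebra_simps)
    also have "\<dots> \<le> max 0 (1 - \<tau> * e\<^sup>2) * (nrm d)\<^sup>2" by (intro mult_right_mono) auto
    finally show "(nrm (d - \<tau> *\<^sub>R B d))\<^sup>2 \<le> (q * nrm d)\<^sup>2" by (simp add: q_def power_mult_distrib)
    show "0 \<le> q * nrm d" using q dS by simp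
  qed
  define c where "c = nrm (u (Suc 0) - u 0)"
  have step: "nrm (u (Suc n) - u n) \<le> c * q ^ n" for n
  proof (induction n)
    case (Suc n)
    define d where "d = u (Suc n) - u n"
    have d: "d \<in> R" using uR R by (simp add: d_def subspace_diff)
    have "nrm (u (Suc (Suc n)) - u (Suc n)) = nrm (d - \<tau> *\<^sub>R B d)"
    proof (rule nrm_cong)
      fix h assume h: "h \<in> S"
      have "u (Suc (Suc n)) - u (Suc n) = d - \<tau> *\<^sub>R (B (u (Suc n)) - B (u n))"
        by (simp add: d_def uS[of "Suc n"] uS[of n] algebra_simps)
      then show "ip (u (Suc (Suc n)) - u (Suc n)) h = ip (d - \<tau> *\<^sub>R B d) h"
        using h d BD by (simp add: ip_linear d_def)
    qed (use d BD in simp_all)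
    also have "\<dots> \<le> q * nrm d" by (rule contr[OF d])
    also have "\<dots> \<le> q * (c * q ^ n)" using Suc q by (intro mult_left_mono) (auto simp: d_def)
    finally show ?case by (simp add: mult_ac)
  qed (simp add: c_def)
  obtain v where v: "v \<in> S" "\<And>n. nrm (u n - v) \<le> c * q ^ n / (1 - q)"
    using geometric_limit[OF uS' q step] by blast
  have pow: "(\<lambda>n. a * q ^ n) \<longlonglongrightarrow> 0" for a
    using tendsto_mult[OF tendsto_const[of a] LIMSEQ_power_zero[of q]] q by simp
  have lim: "(\<lambda>n. nrm (u n - v)) \<longlonglongrightarrow> 0"
  proof (rule tendsto_sandwich[of "\<lambda>_. 0" _ _ "\<lambda>n. c / (1 - q) * q ^ n"])
    show "(\<lambda>n. c / (1 - q) * q ^ n) \<longlonglongrightarrow> 0" by (rule pow)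
  qed (use v in auto)
  have "nrm (B v - g) \<le> K * K * nrm (u n - v) + c * q ^ n / \<tau>" for n
  proof -
    have "u (Suc n) - u n = (- \<tau>) *\<^sub>R (B (u n) - g)" by (simp add: uS)
    then have "nrm (u (Suc n) - u n) = \<tau> * nrm (B (u n) - g)" using \<tau> BD by (simp only:) (simp add: nrm_minus nrm_scale)
    then have "nrm (B (u n) - g) \<le> c * q ^ n / \<tau>" using step[of n] \<tau> by (simp add: field_simps)
    moreover have "nrm (B v - B (u n)) \<le> K * K * nrm (u n - v)"
      using bsym_nrm_diff[OF B v(1) uS'[of n]] v by (simp add: nrm_diff_commute)
    ultimately show ?thesis using nrm_diff_triangle[of "B v" "B (u n)" g] BD v by simp
  qed
  moreover have "(\<lambda>n. K * K * nrm (u n - v) + c * q ^ n / \<tau>) \<longlonglongrightarrow> 0"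
    using tendsto_add[OF tendsto_mult[OF tendsto_const[of "K * K"] lim] pow[of "c / \<tau>"]] by simp
  ultimately have "nrm (B v - g) \<le> 0" by (intro tendsto_lowerbound[of _ 0 sequentially "nrm (B v - g)"]) auto
  moreover have "nrm (B v - g) \<ge> 0" using BD v by simp
  ultimately have "nrm (B v - g) = 0" by linarith
  then show ?thesis using uR v lim unfolding B_def by blast
qed

text \<open>With \<open>R = S\<close> the iteration solves T (T v) = g, so T v is a preimage of
  g.\<close>

lemma bounded_below_imp_regular:
  assumes T: "bsym K T" and "bounded_below T" shows "regular T"
proof -
  note TD = bsymD[OF T]
  obtain c where c: "c > 0" "\<And>f. f \<in> S \<Longrightarrow> c * nrm f \<le> nrm (T f)" using assms(2) unfolding bounded_below_def by blast
  have "\<exists>f\<in>S. nrm (T f - g) = 0" if "g \<in> S" for g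
    using contraction_solution[OF T S_subspace _ _ c that] TD by blast
  moreover have "nrm f = 0" if "f \<in> S" "nrm (T f) = 0" for f
    using c(2)[OF that(1)] c(1) that nrm_nonneg[OF that(1)] by (simp add: mult_le_0_iff)
  ultimately show ?thesis unfolding regular_def by blast
qed

text \<open>A gliding hump: a vector \<open>g\<close> built from almost-null vectors of \<open>T\<close> cannot lie in the range.\<close>

lemma regular_imp_bounded_below:
  assumes T: "bsym K T" and reg: "regular T" shows "bounded_below T"
proof (rule ccontr)
  assume "\<not> bounded_below T"
  note TD = bsymD[OF T]
  have ex: "\<exists>f\<in>S. nrm f = 1 \<and> nrm (T f) < c" if c: "c > 0" for c
  proof -
    obtain f where f: "f \<in> S" "nrm (T f) < c * nrm f"
      using \<open>\<not> bounded_below T\<close> c unfolding bounded_below_def by (meson not_le)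
    have "nrm f \<noteq> 0" using f nrm_nonneg[OF TD(2)[OF f(1)]] by auto
    then have n: "nrm f > 0" using nrm_nonneg[OF f(1)] by simp
    have "nrm (T ((1 / nrm f) *\<^sub>R f)) = nrm ((1 / nrm f) *\<^sub>R T f)"
      using TD f by (intro nrm_cong) (auto simp: ip_linear)
    also have "\<dots> < c" using f n TD by (simp add: nrm_scale field_simps)
    finally show ?thesis using f n by (intro bexI[of _ "(1 / nrm f) *\<^sub>R f"]) (auto simp: nrm_scale)
  qed
  \<comment> \<open>The rate 1/9 has to beat the weights 1/3 below: a preimage \<open>f\<close> of
    the limit would give 3^(-n) / 2 \<le> |f| 9^(-n) for all n.\<close>
  have "\<forall>n::nat. \<exists>f\<in>S. nrm f = 1 \<and> nrm (T f) < (1/9) ^ n" using ex by simp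
  then obtain F where F: "\<And>n. F n \<in> S" "\<And>n. nrm (F n) = 1" "\<And>n::nat. nrm (T (F n)) < (1/9) ^ n" by metis
  \<comment> \<open>The sign prevents cancellation, so the pairing of \<open>u (Suc n)\<close> with
    \<open>F n\<close> has modulus at least 3^(-n). All later terms together have norm at most half
    of this, so half survives in the limit.\<close>
  define u where "u = rec_nat 0 (\<lambda>n w. w + ((if ip w (F n) \<ge> 0 then 1 else -1) * (1/3) ^ n) *\<^sub>R F n)"
  have u0: "u 0 = 0"
    and uS: "u (Suc n) = u n + ((if ip (u n) (F n) \<ge> 0 then 1 else -1) * (1/3) ^ n) *\<^sub>R F n" for n
    by (simp_all add: u_def)
  have u [simp]: "u n \<in> S" for n by (induction n) (auto simp: u0 uS F)
  have "nrm (u (Suc n) - u n) \<le> 1 * (1/3) ^ n" for n by (simp add: uS nrm_scale F abs_mult nrm_minus)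
  from geometric_limit[OF u _ _ this] obtain g where g: "g \<in> S" "\<And>n. nrm (u n - g) \<le> (1/3) ^ n * (3/2)" by auto
  have low: "(1/3) ^ n / 2 \<le> \<bar>ip g (F n)\<bar>" for n
  proof -
    have "ip (F n) (F n) = 1" using nrm_sq[OF F(1)[of n]] F(2)[of n] by simp
    then have "\<bar>ip (u (Suc n)) (F n)\<bar> \<ge> (1/3) ^ n"
      by (auto simp: uS ip_linear F)
    moreover have "\<bar>ip (u (Suc n) - g) (F n)\<bar> \<le> (1/3) ^ Suc n * (3/2)"
      using Cauchy_Schwarz[of "u (Suc n) - g" "F n"] g(2)[of "Suc n"] F g(1) by simp
    moreover have "ip (u (Suc n) - g) (F n) = ip (u (Suc n)) (F n) - ip g (F n)" using F g by (intro ip_diff_left) auto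
    moreover have "(1/3::real) ^ Suc n * (3/2) = (1/3) ^ n / 2" by simp
    ultimately show ?thesis by linarith
  qed
  obtain f where f: "f \<in> S" "nrm (T f - g) = 0" using reg g(1) unfolding regular_def by blast
  have "(1/3) ^ n / 2 \<le> nrm f * (1/9) ^ n" for n
  proof -
    have "ip g (F n) = ip (T f) (F n)" using f g F TD by (intro ip_eq_if_null_diff[symmetric]) auto
    also have "\<dots> = ip f (T (F n))" using TD f F by simp
    finally have "\<bar>ip g (F n)\<bar> \<le> nrm f * nrm (T (F n))" using Cauchy_Schwarz[of f "T (F n)"] f F TD by simp
    also have "\<dots> \<le> nrm f * (1/9) ^ n" using F(3)[of n] f by (intro mult_left_mono) auto
    finally show ?thesis using low[of n] by linarith
  qed
  then have b: "3 ^ n \<le> 2 * nrm f" for n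
  proof -
    have "(9::real) ^ n = 3 ^ n * 3 ^ n" by (simp flip: power_mult_distrib)
    then show ?thesis using \<open>(1/3) ^ n / 2 \<le> nrm f * (1/9) ^ n\<close> by (simp add: power_divide field_simps)
  qed
  obtain n where "2 * nrm f < 3 ^ n" using real_arch_pow[of 3 "2 * nrm f"] by auto
  then show False using b[of n] by simp
qed

lemma regular_iff_bounded_below: "bsym K T \<Longrightarrow> regular T \<longleftrightarrow> bounded_below T"
  using regular_imp_bounded_below bounded_below_imp_regular by blast

text \<open>The spectrum of C^2 avoids the open interval from 0 to e^2, so
  \<open>bounded_below_gap\<close> applies to \<open>Q\<close>, that is C^2 recentred at its
  midpoint. Expanding the square of the resulting bound |Q f| \<ge> (e^2 / 2) |f|, the terms with
  |f| cancel and |C^2 f| \<ge> e |C f| remains.\<close>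

lemma isolated_imp_gap_on_range:
  assumes C: "bsym K C" and e: "e > 0"
    and gap: "\<And>r. r \<noteq> 0 \<Longrightarrow> \<bar>r\<bar> < e \<Longrightarrow> bounded_below (shift C r)" and f: "f \<in> S"
  shows "e * nrm (C f) \<le> nrm (C (C f))"
proof -
  note CD = bsymD[OF C]
  define B where "B = (\<lambda>f. C (C f))"
  have B: "bsym (K * K) B" unfolding B_def by (rule bsym_square[OF C])
  note BD = bsymD[OF B]
  define Q where "Q = shift B (e\<^sup>2 / 2)"
  have Q: "bsym (K * K + \<bar>e\<^sup>2 / 2\<bar>) Q" unfolding Q_def by (rule bsym_shift[OF B])
  have "bounded_below (shift Q r)" if r: "\<bar>r\<bar> < e\<^sup>2 / 2" for r
  proof -
    \<comment> \<open>Since e^2 / 2 + r lies strictly between 0 and e^2, both a and -a are nonzero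
      points of the gap of \<open>C\<close>.\<close>
    define a where "a = sqrt (e\<^sup>2 / 2 + r)"
    have a: "a > 0" "a * a = e\<^sup>2 / 2 + r" using r by (auto simp: a_def)
    have "a < e" unfolding a_def using r e by (intro real_less_lsqrt) auto
    then have "bounded_below (shift C a)" "bounded_below (shift C (- a))" using a by (auto intro!: gap)
    from bounded_below_square[OF C this] have "bounded_below (shift B (a * a))" by (simp add: B_def)
    moreover have "shift B (a * a) = shift Q r" by (auto simp: shift_def Q_def a algebra_simps)
    ultimately show ?thesis by simp
  qed
  from bounded_below_gap[OF Q _ this f, of "e\<^sup>2 / 2"] have "e\<^sup>2 / 2 * nrm f \<le> nrm (Q f)" using e by simp
  then have "(e\<^sup>2 / 2 * nrm f)\<^sup>2 \<le> (nrm (Q f))\<^sup>2" using f by (intro power_mono) auto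
  also have "(nrm (Q f))\<^sup>2 = (nrm (B f))\<^sup>2 - e\<^sup>2 * (nrm (C f))\<^sup>2 + (e\<^sup>2 / 2)\<^sup>2 * (nrm f)\<^sup>2"
    using f CD BD by (simp add: nrm_sq Q_def shift_def ip_linear B_def) (simp add: power2_eq_square field_simps)
  finally have "(e * nrm (C f))\<^sup>2 \<le> (nrm (B f))\<^sup>2" by (simp add: power_mult_distrib power_divide)
  then show ?thesis unfolding B_def by (rule power2_le_imp_le) (use f CD in simp)
qed

text \<open>The bound on the range is extended to its closure. Solving C^2 v = C^2 f from within the
  range gives \<open>k = f - v\<close> in the kernel of \<open>C\<close>; this \<open>k\<close> is
  orthogonal to \<open>f\<close> and to the range, hence null, so \<open>f\<close> is a limit of
  vectors from the range.\<close>

lemma isolated_imp_bounded_below_off_kernel: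
  assumes C: "bsym K C" and e: "e > 0"
    and gap: "\<And>r. r \<noteq> 0 \<Longrightarrow> \<bar>r\<bar> < e \<Longrightarrow> bounded_below (shift C r)" and f: "f \<in> S"
    and orth: "\<And>k. k \<in> S \<Longrightarrow> nrm (C k) = 0 \<Longrightarrow> ip f k = 0"
  shows "e * nrm f \<le> nrm (C f)"
proof -
  note CD = bsymD[OF C]
  \<comment> \<open>The range of \<open>C\<close>, saturated under null differences: the range
    itself need not be a subspace, as \<open>C\<close> is linear only up to null vectors.\<close>
  define R where "R = {h\<in>S. \<exists>g\<in>S. \<forall>k\<in>S. ip h k = ip (C g) k}"
  have CR: "C g \<in> R" if "g \<in> S" for g using that CD by (auto simp: R_def)
  have R: "subspace R" unfolding subspace_def
  proof (intro conjI ballI allI)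
    show "0 \<in> R" unfolding R_def using CD by (auto simp: ip_linear intro!: bexI[of _ 0])
    fix x y a assume "x \<in> R" "y \<in> R"
    then obtain g g' where g: "x \<in> S" "y \<in> S" "g \<in> S" "g' \<in> S" "\<And>k. k \<in> S \<Longrightarrow> ip x k = ip (C g) k" "\<And>k. k \<in> S \<Longrightarrow> ip y k = ip (C g') k"
      by (auto simp: R_def)
    show "x + y \<in> R" unfolding R_def using g CD by (auto simp: ip_linear intro!: bexI[of _ "g + g'"])
    show "a *\<^sub>R x \<in> R" unfolding R_def using g CD by (auto simp: ip_linear intro!: bexI[of _ "a *\<^sub>R g"])
  qed
  have RS: "R \<subseteq> S" by (auto simp: R_def)
  have bb: "e * nrm h \<le> nrm (C h)" if "h \<in> R" for h
  proof -
    obtain g where g: "h \<in> S" "g \<in> S" "\<And>k. k \<in> S \<Longrightarrow> ip h k = ip (C g) k"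
      using \<open>h \<in> R\<close> unfolding R_def by blast
    have "nrm h = nrm (C g)" using g CD by (intro nrm_cong) auto
    moreover have "nrm (C h) = nrm (C (C g))" using g CD by (intro nrm_cong) auto
    ultimately show ?thesis using isolated_imp_gap_on_range[OF C e gap g(2)] by simp
  qed
  have "C (C f) \<in> R" using CR CD f by auto
  from contraction_solution[OF C R RS _ e bb this] CR CD RS
  obtain u v where u: "\<And>n. u n \<in> R" and v: "v \<in> S" and lim: "(\<lambda>n. nrm (u n - v)) \<longlonglongrightarrow> 0"
    and eq: "nrm (C (C v) - C (C f)) = 0" by (smt (verit) subsetD)
  have uS: "u n \<in> S" for n using u RS by auto
  define k where "k = f - v"
  have k: "k \<in> S" using f v by (simp add: k_def)
  have "nrm (C (C k)) = nrm (C (C v) - C (C f))"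
  proof -
    have "nrm (C (C k)) = nrm (C (C f) - C (C v))"
      using CD f v by (intro nrm_cong) (auto simp: k_def ip_linear)
    then show ?thesis using CD f v by (simp add: nrm_diff_commute)
  qed
  then have "ip (C (C k)) k = 0" using eq k CD by (intro ip_null) auto
  then have kC: "nrm (C k) = 0" using k CD by (simp add: nrm_def)
  have fk: "ip f k = 0" using orth k kC by simp
  have uk: "ip (u n) k = 0" for n
  proof -
    obtain g where "g \<in> S" "ip (u n) k = ip (C g) k" using u[of n] k by (auto simp: R_def)
    then show ?thesis using CD k kC ip_null[of "C k" g] ip_commute[of g "C k"] by simp
  qed
  \<comment> \<open>Both \<open>f\<close> and \<open>u n\<close> are orthogonal to \<open>k\<close>,
    the former by \<open>orth\<close>, the latter because it comes from the range of
    \<open>C\<close> and \<open>C k\<close> is null. Only the distance from \<open>u n\<close> to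
    \<open>v\<close> is left.\<close>
  have "ip k k \<le> nrm (u n - v) * nrm k" for n
  proof -
    have "ip k k = ip (u n - v) k" using fk uk[of n] f v k uS by (simp add: k_def ip_linear)
    then show ?thesis using Cauchy_Schwarz[of "u n - v" k] uS v k by auto
  qed
  moreover have "(\<lambda>n. nrm (u n - v) * nrm k) \<longlonglongrightarrow> 0 * nrm k" by (intro tendsto_mult lim tendsto_const)
  ultimately have "ip k k \<le> 0" by (intro tendsto_lowerbound[of _ 0 sequentially "ip k k"]) auto
  then have k0: "nrm k = 0" using ip_nonneg[OF k] by (simp add: nrm_def)
  have fv: "nrm (u n - f) \<le> nrm (u n - v)" for n
    using nrm_diff_triangle[of "u n" v f] uS[of n] v f k0 nrm_diff_commute[of f v] by (simp add: k_def)
  have "e * nrm f \<le> nrm (C f) + (K + e) * nrm (u n - v)" for n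
  proof -
    have "e * nrm f \<le> e * (nrm (u n) + nrm (u n - f))"
      using nrm_le_diff[of f "u n"] uS f e nrm_diff_commute[of f "u n"] by (intro mult_left_mono) auto
    also have "\<dots> \<le> nrm (C (u n)) + e * nrm (u n - v)"
      using bb[OF u[of n]] mult_left_mono[OF fv[of n], of e] e unfolding distrib_left by linarith
    also have "nrm (C (u n)) \<le> nrm (C f) + K * nrm (u n - v)"
      using nrm_le_diff[OF CD(2)[OF uS[of n]] CD(2)[OF f]] bsym_nrm_diff[OF C uS[of n] f]
        mult_left_mono[OF fv[of n] less_imp_le[OF CD(1)]] by linarith
    finally show ?thesis by (simp add: algebra_simps)
  qed
  moreover have "(\<lambda>n. nrm (C f) + (K + e) * nrm (u n - v)) \<longlonglongrightarrow> nrm (C f) + (K + e) * 0"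
    by (intro tendsto_add tendsto_mult lim tendsto_const)
  ultimately show ?thesis by (intro tendsto_lowerbound[of _ "nrm (C f)" sequentially "e * nrm f"]) auto
qed

text \<open>The witness is the infimum over finite \<open>F\<close> of the supremum of the Rayleigh quotient on the
  orthogonal complement of \<open>F\<close>, that is, the top of the essential spectrum.\<close>

lemma exists_singular_value:
  assumes T: "bsym K T"
    and inf: "\<And>F. finite F \<Longrightarrow> F \<subseteq> S \<Longrightarrow> \<exists>f\<in>S. nrm f > 0 \<and> (\<forall>g\<in>F. ip f g = 0)"
  shows "\<exists>l. \<forall>F c. finite F \<longrightarrow> F \<subseteq> S \<longrightarrow> c > 0 \<longrightarrow>
    (\<exists>f\<in>S. nrm f > 0 \<and> (\<forall>g\<in>F. ip f g = 0) \<and> nrm (shift T l f) < c * nrm f)"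
proof -
  note TD = bsymD[OF T]
  define X where "X = {t. \<exists>F. finite F \<and> F \<subseteq> S \<and> (\<forall>f\<in>S. (\<forall>g\<in>F. ip f g = 0) \<longrightarrow> ip (T f) f \<le> t * ip f f)}"
  have form: "\<bar>ip (T f) f\<bar> \<le> K * ip f f" if "f \<in> S" for f
    using Cauchy_Schwarz[of "T f" f] TD(2)[OF that] mult_right_mono[OF TD(4)[OF that], of "nrm f"] that nrm_sq[OF that]
    by (simp add: power2_eq_square mult.assoc)
  have KX: "K \<in> X" unfolding X_def using form by (auto intro!: exI[of _ "{}"] dest: abs_le_D1)
  have bdd: "bdd_below X"
  proof (rule bdd_belowI[of _ "- K"])
    fix t assume "t \<in> X"
    then obtain F where F: "finite F" "F \<subseteq> S" "\<And>f. f \<in> S \<Longrightarrow> (\<forall>g\<in>F. ip f g = 0) \<Longrightarrow> ip (T f) f \<le> t * ip f f"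
      by (auto simp: X_def)
    obtain f where f: "f \<in> S" "nrm f > 0" "\<forall>g\<in>F. ip f g = 0" using inf F by blast
    have "- K * ip f f \<le> t * ip f f" using F(3)[OF f(1,3)] form[OF f(1)] by auto
    moreover have "ip f f > 0" using f by (simp add: nrm_def)
    ultimately show "- K \<le> t" by (metis mult_le_cancel_right_pos)
  qed
  define l where "l = Inf X"
  have "\<exists>f\<in>S. nrm f > 0 \<and> (\<forall>g\<in>F0. ip f g = 0) \<and> nrm (shift T l f) < c * nrm f"
    if F0: "finite F0" "F0 \<subseteq> S" and c: "c > 0" for F0 c
  proof -
    define K1 where "K1 = K + \<bar>l\<bar> + 1"
    have K1: "K1 > 0" using TD(1) by (simp add: K1_def)
    \<comment> \<open>The entries serve, in this order,
      \<open>\<bar>l + \<eta>\<bar> \<le> \<bar>l\<bar> + 1\<close>, the summand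
      \<open>\<eta> * nrm f\<close>, and the bound \<open>c / 2 * nrm f\<close> on the norm of
      \<open>G f\<close>.\<close>
    define \<eta> where "\<eta> = min 1 (min (c / 4) (c\<^sup>2 / (16 * K1)))"
    have \<eta>: "\<eta> > 0" "\<eta> \<le> 1" "\<eta> \<le> c / 4" "\<eta> \<le> c\<^sup>2 / (16 * K1)" using c K1 by (auto simp: \<eta>_def)
    obtain t where t: "t \<in> X" "t < l + \<eta>" using cInf_lessD[of X "l + \<eta>"] KX \<eta> by (auto simp: l_def)
    then obtain F where F: "finite F" "F \<subseteq> S" "\<And>f. f \<in> S \<Longrightarrow> (\<forall>g\<in>F. ip f g = 0) \<Longrightarrow> ip (T f) f \<le> t * ip f f"
      by (auto simp: X_def)
    have "l - \<eta> \<notin> X" using cInf_lower[OF _ bdd, of "l - \<eta>"] \<eta> by (auto simp: l_def)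
    moreover have "finite (F \<union> T ` F \<union> F0)" "F \<union> T ` F \<union> F0 \<subseteq> S" using F F0 TD by auto
    ultimately obtain f where f: "f \<in> S" "\<forall>g\<in>F \<union> T ` F \<union> F0. ip f g = 0" "ip (T f) f > (l - \<eta>) * ip f f"
      unfolding X_def by (smt (verit) mem_Collect_eq)
    have f0: "nrm f > 0"
    proof (rule ccontr)
      assume "\<not> nrm f > 0"
      then have "nrm f = 0" using nrm_nonneg[OF f(1)] by linarith
      then have "ip f f = 0" "ip (T f) f = 0" using f TD ip_null[of f "T f"] ip_null[of f f] ip_commute[of "T f" f] by auto
      then show False using f(3) by simp
    qed
    define G where "G = (\<lambda>f. - shift T (l + \<eta>) f)"
    have G: "bsym (K + \<bar>l + \<eta>\<bar>) G" using bsym_shift[OF T, of "l + \<eta>"]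
      by (auto simp: bsym_def G_def nrm_minus ip_linear)
    have GK: "K + \<bar>l + \<eta>\<bar> \<le> K1" using \<eta> by (auto simp: K1_def)
    note GD = bsymD[OF G]
    have Gip: "ip (G h) h = (l + \<eta>) * ip h h - ip (T h) h" if "h \<in> S" for h
      using that TD by (simp add: G_def shift_def ip_linear)
    have "(nrm (G f))\<^sup>2 \<le> (K + \<bar>l + \<eta>\<bar>) * ip (G f) f"
    proof (rule nrm_sq_le_form[OF G f(1)])
      fix s
      define h where "h = f - s *\<^sub>R G f"
      have h: "h \<in> S" using f GD by (simp add: h_def)
      have "ip h g = 0" if "g \<in> F" for g
      proof -
        have gS: "g \<in> S" using F that by auto
        then have "ip (G f) g = 0" using f TD that by (simp add: G_def shift_def ip_linear)
        then show ?thesis using f GD gS that by (simp add: h_def ip_linear)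
      qed
      then have "ip (T h) h \<le> t * ip h h" using F(3)[OF h] by blast
      also have "\<dots> \<le> (l + \<eta>) * ip h h" using t(2) ip_nonneg[OF h] by (intro mult_right_mono) auto
      finally show "0 \<le> ip (G (f - s *\<^sub>R G f)) (f - s *\<^sub>R G f)" using Gip[OF h] h_def by simp
    qed
    also have "ip (G f) f \<le> 2 * \<eta> * ip f f" using f(3) by (simp add: Gip[OF f(1)] algebra_simps)
    also have "(K + \<bar>l + \<eta>\<bar>) * (2 * \<eta> * ip f f) \<le> K1 * (2 * \<eta> * ip f f)"
      using GK \<eta> ip_nonneg[OF f(1)] by (intro mult_right_mono) auto
    also have "\<dots> \<le> c\<^sup>2 / 8 * ip f f"
      using \<eta>(4) K1 ip_nonneg[OF f(1)] mult_right_mono[of "K1 * 2 * \<eta>" "c\<^sup>2 / 8" "ip f f"] by (simp add: field_simps)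
    also have "\<dots> \<le> (c / 2 * nrm f)\<^sup>2" using ip_nonneg[OF f(1)] by (simp add: power_mult_distrib power_divide nrm_sq f)
    finally have "(nrm (G f))\<^sup>2 \<le> (c / 2 * nrm f)\<^sup>2" using GD(1) by (simp add: mult_left_mono)
    then have 1: "nrm (G f) \<le> c / 2 * nrm f" by (rule power2_le_imp_le) (use c f in simp)
    have "shift T l f = \<eta> *\<^sub>R f - G f" by (simp add: shift_def G_def algebra_simps)
    then have "nrm (shift T l f) \<le> \<eta> * nrm f + nrm (G f)"
      using nrm_triangle_diff[of "\<eta> *\<^sub>R f" "G f"] f GD \<eta> by (simp add: nrm_scale)
    also have "\<dots> \<le> c / 4 * nrm f + c / 2 * nrm f" using 1 \<eta> f0 by (intro add_mono mult_right_mono) auto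
    also have "\<dots> < c * nrm f" using c f0 by simp
    finally show ?thesis using f f0 by (intro bexI[of _ f]) auto
  qed
  then show ?thesis by blast
qed

text \<open>Approximate eigenvectors for distinct values are almost orthogonal, so the form of T - t
  is nearly diagonal on their span, with diagonal entries at least \<open>d\<close>. If there were
  more of them than vectors in \<open>F\<close>, a combination orthogonal to \<open>F\<close> would
  make this form positive, against \<open>top\<close>.\<close>

lemma card_spectrum_above_le:
  assumes T: "bsym K T" and F: "finite F" "F \<subseteq> S"
    and top: "\<And>f. f \<in> S \<Longrightarrow> (\<forall>g\<in>F. ip f g = 0) \<Longrightarrow> ip (T f) f \<le> t * ip f f"
    and L: "finite L" "\<And>l. l \<in> L \<Longrightarrow> t < l" "\<And>l. l \<in> L \<Longrightarrow> \<not> bounded_below (shift T l)"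
  shows "card L \<le> card F"
proof (rule ccontr)
  assume "\<not> card L \<le> card F"
  then have card: "card F < card L" by simp
  then have "L \<noteq> {}" by auto
  note TD = bsymD[OF T]
  define d where "d = Min ((\<lambda>l. l - t) ` L)"
  have d: "d > 0" "\<And>l. l \<in> L \<Longrightarrow> d \<le> l - t" using L \<open>L \<noteq> {}\<close> by (auto simp: d_def)
  define D where "D = Max ((\<lambda>l. l - t) ` L)"
  have D: "\<And>l. l \<in> L \<Longrightarrow> l - t \<le> D" using L \<open>L \<noteq> {}\<close> by (auto simp: D_def)
  have D0: "D > 0" using d D \<open>L \<noteq> {}\<close> by fastforce
  \<comment> \<open>Inserting 1 covers the case of a single element, where there are no differences
    to minimise over.\<close>
  define \<gamma> where "\<gamma> = Min (insert 1 ((\<lambda>(l, l'). \<bar>l - l'\<bar>) ` {p\<in>L \<times> L. fst p \<noteq> snd p}))"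
  have fin: "finite (insert 1 ((\<lambda>(l, l'). \<bar>l - l'\<bar>) ` {p\<in>L \<times> L. fst p \<noteq> snd p}))" using L by auto
  have \<gamma>0: "\<gamma> > 0" unfolding \<gamma>_def using fin by (subst Min_gr_iff) auto
  have \<gamma>: "\<gamma> \<le> \<bar>l - l'\<bar>" if "l \<in> L" "l' \<in> L" "l \<noteq> l'" for l l'
    unfolding \<gamma>_def using that by (intro Min_le[OF fin]) force
  \<comment> \<open>There are \<open>card L * card L\<close> entries, each with an error of at most
    \<open>\<eta> * (1 + 2 * D / \<gamma>)\<close>; \<open>M\<close> adds these factors up, so that
    the total error stays below \<open>d\<close>.\<close>
  define M where "M = 1 + real (card L * card L) * (1 + 2 * D / \<gamma>)"
  have M: "M > 0" using D0 \<gamma>0 by (simp add: M_def add_pos_nonneg)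
  define \<eta> where "\<eta> = d / (2 * M)"
  have \<eta>: "\<eta> > 0" "\<eta> * M < d" using d M by (auto simp: \<eta>_def)
  have "\<exists>f\<in>S. nrm f = 1 \<and> nrm (shift T l f) \<le> \<eta>" if "l \<in> L" for l
  proof -
    note SD = bsymD[OF bsym_shift[OF T, of l]]
    obtain f where f: "f \<in> S" "nrm (shift T l f) < \<eta> * nrm f"
      using L(3)[OF \<open>l \<in> L\<close>] \<eta>(1) unfolding bounded_below_def by (meson not_le)
    have "nrm f \<noteq> 0" using f nrm_nonneg[OF SD(2)[OF f(1)]] by auto
    then have n: "nrm f > 0" using nrm_nonneg[OF f(1)] by simp
    have "nrm (shift T l ((1 / nrm f) *\<^sub>R f)) = nrm ((1 / nrm f) *\<^sub>R shift T l f)"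
      using SD f by (intro nrm_cong) (auto simp: ip_linear)
    also have "\<dots> \<le> \<eta>" using f n SD by (simp add: nrm_scale field_simps)
    finally show ?thesis using f n by (intro bexI[of _ "(1 / nrm f) *\<^sub>R f"]) (auto simp: nrm_scale)
  qed
  then obtain v where v: "\<And>l. l \<in> L \<Longrightarrow> v l \<in> S" "\<And>l. l \<in> L \<Longrightarrow> nrm (v l) = 1"
      "\<And>l. l \<in> L \<Longrightarrow> nrm (shift T l (v l)) \<le> \<eta>" by metis
  have err: "\<bar>ip (T (v l)) h - l * ip (v l) h\<bar> \<le> \<eta>" if "l \<in> L" "h \<in> S" "nrm h = 1" for l h
  proof -
    have "ip (T (v l)) h - l * ip (v l) h = ip (shift T l (v l)) h"
      using v TD that by (simp add: shift_def ip_linear)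
    also have "\<bar>\<dots>\<bar> \<le> nrm (shift T l (v l)) * nrm h"
      using v TD that by (intro Cauchy_Schwarz) (auto simp: shift_def)
    finally show ?thesis using v(3)[OF that(1)] that by simp
  qed
  have offdiag: "\<bar>ip (v l) (v l')\<bar> \<le> 2 * \<eta> / \<gamma>" if "l \<in> L" "l' \<in> L" "l \<noteq> l'" for l l'
  proof -
    \<comment> \<open>By symmetry \<open>l * ip (v l) (v l')\<close> and
      \<open>l' * ip (v l) (v l')\<close> are both within \<open>\<eta>\<close> of the same
      number.\<close>
    have "ip (T (v l)) (v l') = ip (T (v l')) (v l)" using v TD that by (simp add: ip_commute)
    then have "\<bar>(l - l') * ip (v l) (v l')\<bar> \<le> 2 * \<eta>"
      using err[of l "v l'"] err[of l' "v l"] v that ip_commute[of "v l" "v l'"] by (simp add: algebra_simps)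
    then have "\<bar>l - l'\<bar> * \<bar>ip (v l) (v l')\<bar> \<le> 2 * \<eta>" by (simp add: abs_mult)
    then have "\<gamma> * \<bar>ip (v l) (v l')\<bar> \<le> 2 * \<eta>" using mult_right_mono[OF \<gamma>[OF that], of "\<bar>ip (v l) (v l')\<bar>"] by simp
    then show ?thesis using \<gamma>0 by (simp add: field_simps)
  qed
  obtain c k where c: "k \<in> L" "\<bar>c k\<bar> = 1" "\<And>j. j \<in> L \<Longrightarrow> \<bar>c j\<bar> \<le> 1"
    "\<And>g. g \<in> F \<Longrightarrow> (\<Sum>l\<in>L. ip (v l) g * c l) = 0"
    using homogeneous_system_normalised[OF F(1) L(1) card, of "\<lambda>g l. ip (v l) g"] by metis
  define f where "f = (\<Sum>l\<in>L. c l *\<^sub>R v l)"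
  have f: "f \<in> S" using v by (simp add: f_def)
  have "ip f g = 0" if "g \<in> F" for g
    using c(4)[OF that] v F that by (simp add: f_def ip_sum_left subsetD ip_linear mult_ac)
  then have le: "ip (T f) f \<le> t * ip f f" using top[OF f] by blast
  have Tf: "ip (T f) h = (\<Sum>l\<in>L. c l * ip (T (v l)) h)" if "h \<in> S" for h
  proof -
    have "ip (T f) h = ip f (T h)" using TD f that by simp
    also have "\<dots> = (\<Sum>l\<in>L. c l * ip (v l) (T h))" using v TD that by (simp add: f_def ip_sum_left ip_linear)
    finally show ?thesis using v TD that by (simp cong: sum.cong)
  qed
  define E where "E = (\<lambda>l l'. ip (T (v l)) (v l') - t * ip (v l) (v l'))"
  have "ip (T f) f - t * ip f f = (\<Sum>l\<in>L. \<Sum>l'\<in>L. c l * c l' * E l l')"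
  proof -
    have "ip (T f) f = (\<Sum>l\<in>L. c l * (\<Sum>l'\<in>L. c l' * ip (T (v l)) (v l')))"
      using v TD by (simp add: Tf[OF f]) (simp add: f_def ip_sum_right ip_linear cong: sum.cong)
    moreover have "ip f f = (\<Sum>l\<in>L. c l * (\<Sum>l'\<in>L. c l' * ip (v l) (v l')))"
    proof -
      have "ip f f = (\<Sum>l\<in>L. c l * ip (v l) f)" using v f by (subst f_def) (simp add: ip_sum_left ip_linear)
      then show ?thesis using v by (simp add: f_def ip_sum_right ip_linear cong: sum.cong)
    qed
    ultimately show ?thesis
      by (simp add: E_def sum_distrib_left sum_subtractf algebra_simps)
  qed
  also have "\<dots> \<ge> (\<Sum>l\<in>L. \<Sum>l'\<in>L. (if l = l' then (c l)\<^sup>2 * d else 0) - \<eta> * (1 + 2 * D / \<gamma>))"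
  proof (intro sum_mono)
    fix l l' assume l: "l \<in> L" "l' \<in> L"
    have E: "\<bar>E l l' - (l - t) * ip (v l) (v l')\<bar> \<le> \<eta>"
      using err[of l "v l'"] v l by (simp add: E_def algebra_simps)
    show "(if l = l' then (c l)\<^sup>2 * d else 0) - \<eta> * (1 + 2 * D / \<gamma>) \<le> c l * c l' * E l l'"
    proof (cases "l = l'")
      case True
      have "ip (v l) (v l) = 1" using nrm_sq[of "v l"] v l by simp
      then have "E l l \<ge> d - \<eta>" using E True d(2)[OF l(1)] by simp
      then have "(c l)\<^sup>2 * (d - \<eta>) \<le> (c l)\<^sup>2 * E l l" by (intro mult_left_mono) auto
      moreover have "(c l)\<^sup>2 * \<eta> \<le> 1 * \<eta>" using c(3)[OF l(1)] \<eta>(1) by (intro mult_right_mono) (auto simp: abs_square_le_1)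
      moreover have "0 \<le> \<eta> * (2 * D / \<gamma>)" using \<eta> D0 \<gamma>0 by simp
      ultimately show ?thesis using True by (simp add: power2_eq_square algebra_simps)
    next
      case False
      have "\<bar>(l - t) * ip (v l) (v l')\<bar> \<le> D * (2 * \<eta> / \<gamma>)"
        unfolding abs_mult using offdiag[OF l False] D[OF l(1)] d(1) d(2)[OF l(1)] by (intro mult_mono) auto
      then have b: "\<bar>E l l'\<bar> \<le> \<eta> * (1 + 2 * D / \<gamma>)" using E by (simp add: algebra_simps)
      have "\<bar>c l * c l' * E l l'\<bar> \<le> 1 * 1 * (\<eta> * (1 + 2 * D / \<gamma>))"
        unfolding abs_mult using c(3)[OF l(1)] c(3)[OF l(2)] b by (intro mult_mono) auto
      then show ?thesis using False by simp
    qed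
  qed
  also have "(\<Sum>l\<in>L. \<Sum>l'\<in>L. (if l = l' then (c l)\<^sup>2 * d else 0) - \<eta> * (1 + 2 * D / \<gamma>))
     = (\<Sum>l\<in>L. (c l)\<^sup>2 * d) - \<eta> * (M - 1)"
    using L(1) by (simp add: sum_subtractf M_def)
  finally have ge: "(\<Sum>l\<in>L. (c l)\<^sup>2 * d) - \<eta> * (M - 1) \<le> ip (T f) f - t * ip f f" .
  have "(c k)\<^sup>2 * d \<le> (\<Sum>l\<in>L. (c l)\<^sup>2 * d)" using L c(1) d by (intro member_le_sum) auto
  moreover have "(c k)\<^sup>2 = 1" using c(2) by (metis abs_1 abs_eq_iff power2_eq_iff one_power2)
  ultimately show False using ge le \<eta> by (simp add: algebra_simps)
qed

text \<open>Pairing with one vector of \<open>F\<close> cuts \<open>V\<close> down by at most one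
  dimension, and after all of \<open>F\<close> only null vectors are left.\<close>

lemma finite_dim_if_orthogonal_null:
  assumes "finite F" "F \<subseteq> S" "subspace V" "V \<subseteq> S"
    and "\<And>f. f \<in> V \<Longrightarrow> (\<forall>g\<in>F. ip f g = 0) \<Longrightarrow> nrm f = 0"
  shows "\<exists>B. finite B \<and> B \<subseteq> V \<and> (\<forall>f\<in>V. \<exists>c. nrm (f - (\<Sum>b\<in>B. c b *\<^sub>R b)) = 0)"
  using assms
proof (induction F arbitrary: V rule: finite_induct)
  case empty
  then show ?case by (intro exI[of _ "{}"]) auto
next
  case (insert g F)
  define V' where "V' = {f\<in>V. ip f g = 0}"
  have gS: "g \<in> S" using insert by auto
  have V': "subspace V'" "V' \<subseteq> S"
    using insert.prems gS by (auto simp: V'_def subspace_def ip_linear subset_iff)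
  obtain B where B: "finite B" "B \<subseteq> V'" "\<And>f. f \<in> V' \<Longrightarrow> \<exists>c. nrm (f - (\<Sum>b\<in>B. c b *\<^sub>R b)) = 0"
    using insert.IH[OF _ V'] insert.prems by (auto simp: V'_def)
  show ?case
  proof (cases "V' = V")
    case True then show ?thesis using B by blast
  next
    case False
    then obtain s where s: "s \<in> V" "ip s g \<noteq> 0" by (auto simp: V'_def)
    have "s \<notin> B" using B s by (auto simp: V'_def)
    have "\<exists>c. nrm (f - (\<Sum>b\<in>insert s B. c b *\<^sub>R b)) = 0" if f: "f \<in> V" for f
    proof -
      define a where "a = ip f g / ip s g"
      have "f - a *\<^sub>R s \<in> V'" using f s insert.prems gS
        by (auto simp: V'_def subspace_diff subspace_scale subset_iff ip_linear a_def)
      then obtain c where c: "nrm (f - a *\<^sub>R s - (\<Sum>b\<in>B. c b *\<^sub>R b)) = 0" using B by blast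
      have "(\<Sum>b\<in>insert s B. (c(s := a)) b *\<^sub>R b) = a *\<^sub>R s + (\<Sum>b\<in>B. c b *\<^sub>R b)"
        using \<open>s \<notin> B\<close> B(1) by (simp, intro sum.cong) auto
      then show ?thesis using c by (intro exI[of _ "c(s := a)"]) (simp only: diff_diff_eq)
    qed
    then show ?thesis using B s by (intro exI[of _ "insert s B"]) (auto simp: V'_def)
  qed
qed

end

section \<open>Disjoint sets with small boundary in a weighted graph\<close>

text \<open>A layer-cake argument: subtracting the least positive value \<open>a\<close> truncated
  at 0 removes one layer of height \<open>a\<close> over the set where \<open>h\<close> is positive.
  Both sides split additively along it, and fewer positive values remain.\<close>

lemma coarea_inequality:
  fixes h :: "'b \<Rightarrow> real" and J :: "'b \<Rightarrow> 'b \<Rightarrow> real"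
  assumes "finite V" and "\<And>x. x \<in> V \<Longrightarrow> 0 \<le> h x"
    and "\<And>t. 0 \<le> t \<Longrightarrow> (\<Sum>x\<in>V. m x * of_bool (t < h x)) \<le>
       (\<Sum>x\<in>V. \<Sum>y\<in>V. J x y * \<bar>of_bool (t < h x) - of_bool (t < h y)\<bar>)"
  shows "(\<Sum>x\<in>V. m x * h x) \<le> (\<Sum>x\<in>V. \<Sum>y\<in>V. J x y * \<bar>h x - h y\<bar>)"
  using assms(2,3)
proof (induction "card {x\<in>V. 0 < h x}" arbitrary: h rule: less_induct)
  case less
  show ?case
  proof (cases "{x\<in>V. 0 < h x} = {}")
    case True
    then have "h x = 0" if "x \<in> V" for x using less.prems(1)[OF that] that by force
    then show ?thesis by simp
  next
    case False
    define a where "a = Min (h ` {x\<in>V. 0 < h x})"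
    have fin: "finite (h ` {x\<in>V. 0 < h x})" using assms(1) by auto
    have "a \<in> h ` {x\<in>V. 0 < h x}" unfolding a_def using fin False by (intro Min_in) auto
    then obtain z where z: "z \<in> V" "0 < h z" "h z = a" by auto
    have a: "a > 0" using z by simp
    have ale: "a \<le> h x" if "x \<in> V" "0 < h x" for x unfolding a_def using fin that by auto
    define h' where "h' = (\<lambda>x. max 0 (h x - a))"
    have dec: "h x = h' x + a * of_bool (0 < h x)" if "x \<in> V" for x
      using ale[OF that] less.prems(1)[OF that] a by (auto simp: h'_def)
    have dec2: "\<bar>h x - h y\<bar> = \<bar>h' x - h' y\<bar> + a * \<bar>of_bool (0 < h x) - of_bool (0 < h y)\<bar>"
      if "x \<in> V" "y \<in> V" for x y
      using ale[OF that(1)] ale[OF that(2)] less.prems(1)[OF that(1)] less.prems(1)[OF that(2)] a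
      by (auto simp: h'_def)
    have "{x\<in>V. 0 < h' x} \<subset> {x\<in>V. 0 < h x}"
    proof
      show "{x\<in>V. 0 < h' x} \<noteq> {x\<in>V. 0 < h x}" using z by (force simp: h'_def)
    qed (use a in \<open>auto simp: h'_def\<close>)
    then have "card {x\<in>V. 0 < h' x} < card {x\<in>V. 0 < h x}"
      using assms(1) by (intro psubset_card_mono) auto
    then have IH: "(\<Sum>x\<in>V. m x * h' x) \<le> (\<Sum>x\<in>V. \<Sum>y\<in>V. J x y * \<bar>h' x - h' y\<bar>)"
    proof (rule less.hyps)
      fix t :: real assume t: "0 \<le> t"
      have "t < h' x \<longleftrightarrow> t + a < h x" for x using t by (auto simp: h'_def)
      then show "(\<Sum>x\<in>V. m x * of_bool (t < h' x)) \<le>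
         (\<Sum>x\<in>V. \<Sum>y\<in>V. J x y * \<bar>of_bool (t < h' x) - of_bool (t < h' y)\<bar>)"
        using less.prems(2)[of "t + a"] t a by simp
    qed (auto simp: h'_def)
    have "(\<Sum>x\<in>V. m x * h x) = (\<Sum>x\<in>V. m x * h' x + a * (m x * of_bool (0 < h x)))"
      by (rule sum.cong[OF refl], subst dec) (auto simp: algebra_simps)
    also have "\<dots> = (\<Sum>x\<in>V. m x * h' x) + a * (\<Sum>x\<in>V. m x * of_bool (0 < h x))"
      by (simp add: sum.distrib sum_distrib_left)
    also have "\<dots> \<le> (\<Sum>x\<in>V. \<Sum>y\<in>V. J x y * \<bar>h' x - h' y\<bar>) +
       a * (\<Sum>x\<in>V. \<Sum>y\<in>V. J x y * \<bar>of_bool (0 < h x) - of_bool (0 < h y)\<bar>)"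
      using less.prems(2)[of 0] a IH by (intro add_mono mult_left_mono) auto
    also have "\<dots> = (\<Sum>x\<in>V. \<Sum>y\<in>V. J x y * \<bar>h' x - h' y\<bar> + a * (J x y * \<bar>of_bool (0 < h x) - of_bool (0 < h y)\<bar>))"
      by (simp add: sum.distrib sum_distrib_left)
    also have "\<dots> = (\<Sum>x\<in>V. \<Sum>y\<in>V. J x y * \<bar>h x - h y\<bar>)"
      by (intro sum.cong refl, subst dec2) (auto simp: algebra_simps)
    finally show ?thesis .
  qed
qed

text \<open>If every level set of g^2 had a boundary larger than \<open>4 * \<epsilon>\<close> times
  its mass, the coarea inequality would bound \<open>4 * \<epsilon> * G\<close> by the total
  variation of g^2, which is at most \<open>2 * \<epsilon> * G\<close>.\<close>

lemma Cheeger_level_set: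
  fixes g :: "'b \<Rightarrow> real" and J :: "'b \<Rightarrow> 'b \<Rightarrow> real"
  assumes V: "finite V" and J: "\<And>x y. x \<in> V \<Longrightarrow> y \<in> V \<Longrightarrow> 0 \<le> J x y" "\<And>x y. x \<in> V \<Longrightarrow> y \<in> V \<Longrightarrow> J x y = J y x"
    and m: "\<And>x. x \<in> V \<Longrightarrow> m x = (\<Sum>y\<in>V. J x y)"
    and e: "\<epsilon> > 0" and G: "0 < (\<Sum>x\<in>V. m x * (g x)\<^sup>2)"
    and energy: "(\<Sum>x\<in>V. \<Sum>y\<in>V. J x y * (g x - g y)\<^sup>2) \<le> \<epsilon>\<^sup>2 * (\<Sum>x\<in>V. m x * (g x)\<^sup>2)"
  shows "\<exists>t\<ge>0. 0 < (\<Sum>x\<in>V. m x * of_bool (t < (g x)\<^sup>2)) \<and>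
     (\<Sum>x\<in>V. \<Sum>y\<in>V. J x y * \<bar>of_bool (t < (g x)\<^sup>2) - of_bool (t < (g y)\<^sup>2)\<bar>)
       \<le> 4 * \<epsilon> * (\<Sum>x\<in>V. m x * of_bool (t < (g x)\<^sup>2))"
proof (rule ccontr)
  assume neg: "\<not> ?thesis"
  define G where "G = (\<Sum>x\<in>V. m x * (g x)\<^sup>2)"
  have m0: "0 \<le> m x" if "x \<in> V" for x using J m that by (auto intro: sum_nonneg)
  have "(\<Sum>x\<in>V. (4 * \<epsilon> * m x) * (g x)\<^sup>2) \<le> (\<Sum>x\<in>V. \<Sum>y\<in>V. J x y * \<bar>(g x)\<^sup>2 - (g y)\<^sup>2\<bar>)"
  proof (rule coarea_inequality[OF V])
    fix t :: real assume t: "0 \<le> t"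
    let ?c = "\<Sum>x\<in>V. \<Sum>y\<in>V. J x y * \<bar>of_bool (t < (g x)\<^sup>2) - of_bool (t < (g y)\<^sup>2)\<bar>"
    let ?m = "\<Sum>x\<in>V. m x * of_bool (t < (g x)\<^sup>2)"
    have "0 \<le> ?m" "0 \<le> ?c" using m0 J by (auto intro!: sum_nonneg mult_nonneg_nonneg)
    then have "4 * \<epsilon> * ?m \<le> ?c" using neg t by (cases "?m = 0") force+
    then show "(\<Sum>x\<in>V. 4 * \<epsilon> * m x * of_bool (t < (g x)\<^sup>2)) \<le> ?c"
      by (simp add: sum_distrib_left mult_ac)
  qed simp
  \<comment> \<open>Weighted arithmetic-geometric mean for |g x - g y| |g x + g y|. The weight
    \<open>\<epsilon>\<close> balances the two parts: the energy part and the mass part contribute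
    \<open>\<epsilon> * G\<close> each.\<close>
  also have "\<dots> \<le> (\<Sum>x\<in>V. \<Sum>y\<in>V. J x y * ((g x - g y)\<^sup>2 / \<epsilon> + \<epsilon> / 2 * ((g x)\<^sup>2 + (g y)\<^sup>2)))"
  proof (intro sum_mono mult_left_mono)
    fix x y
    have "\<bar>(g x)\<^sup>2 - (g y)\<^sup>2\<bar> = \<bar>g x - g y\<bar> * \<bar>g x + g y\<bar>" by (simp add: power2_eq_square square_diff_square_factored abs_mult)
    moreover have "0 \<le> (\<bar>g x - g y\<bar> - \<epsilon> / 2 * \<bar>g x + g y\<bar>)\<^sup>2" by simp
    then have "\<epsilon> * (\<bar>g x - g y\<bar> * \<bar>g x + g y\<bar>) \<le> (g x - g y)\<^sup>2 + \<epsilon>\<^sup>2 / 4 * (g x + g y)\<^sup>2"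
      by (simp add: power2_diff power_mult_distrib power_divide mult_ac)
    moreover have "(g x + g y)\<^sup>2 \<le> 2 * ((g x)\<^sup>2 + (g y)\<^sup>2)"
      using sum_squares_bound[of "g x" "g y"] by (simp add: power2_sum)
    then have "\<epsilon>\<^sup>2 / 4 * (g x + g y)\<^sup>2 \<le> \<epsilon>\<^sup>2 / 4 * (2 * ((g x)\<^sup>2 + (g y)\<^sup>2))" by (intro mult_left_mono) auto
    ultimately have "\<epsilon> * \<bar>(g x)\<^sup>2 - (g y)\<^sup>2\<bar> \<le> (g x - g y)\<^sup>2 + \<epsilon>\<^sup>2 / 2 * ((g x)\<^sup>2 + (g y)\<^sup>2)" by (simp add: algebra_simps)
    also have "\<dots> = \<epsilon> * ((g x - g y)\<^sup>2 / \<epsilon> + \<epsilon> / 2 * ((g x)\<^sup>2 + (g y)\<^sup>2))"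
      using e by (simp add: field_simps power2_eq_square)
    finally show "\<bar>(g x)\<^sup>2 - (g y)\<^sup>2\<bar> \<le> (g x - g y)\<^sup>2 / \<epsilon> + \<epsilon> / 2 * ((g x)\<^sup>2 + (g y)\<^sup>2)"
      using e by simp
  qed (use J in auto)
  also have "\<dots> = (\<Sum>x\<in>V. \<Sum>y\<in>V. J x y * (g x - g y)\<^sup>2) / \<epsilon> +
      \<epsilon> / 2 * ((\<Sum>x\<in>V. \<Sum>y\<in>V. J x y * (g x)\<^sup>2) + (\<Sum>x\<in>V. \<Sum>y\<in>V. J x y * (g y)\<^sup>2))"
    by (simp add: sum.distrib sum_distrib_left sum_divide_distrib algebra_simps)
  also have "(\<Sum>x\<in>V. \<Sum>y\<in>V. J x y * (g x)\<^sup>2) = G"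
    by (simp add: G_def m sum_distrib_right)
  also have "(\<Sum>x\<in>V. \<Sum>y\<in>V. J x y * (g y)\<^sup>2) = G"
    by (subst sum.swap) (auto simp: G_def m J(2) sum_distrib_right intro!: sum.cong)
  also have "(\<Sum>x\<in>V. \<Sum>y\<in>V. J x y * (g x - g y)\<^sup>2) / \<epsilon> \<le> \<epsilon> * G"
    using energy e by (simp add: G_def field_simps power2_eq_square)
  finally have "4 * \<epsilon> * G \<le> 2 * \<epsilon> * G" by (simp add: G_def sum_distrib_left mult_ac)
  moreover have "G > 0" using G by (simp add: G_def)
  ultimately show False using e by (simp add: mult_le_cancel_right)
qed

section \<open>Separated directions and cone functions in Euclidean space\<close>

definition dot :: "nat \<Rightarrow> (nat \<Rightarrow> real) \<Rightarrow> (nat \<Rightarrow> real) \<Rightarrow> real" where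
  "dot N x y = (\<Sum>i<N. x i * y i)"

text \<open>Points of R^N are functions on \<open>nat\<close> of which only the coordinates below
  \<open>N\<close> count, so that the dimension may depend on the number of sets.\<close>

definition enorm :: "nat \<Rightarrow> (nat \<Rightarrow> real) \<Rightarrow> real" where
  "enorm N x = L2_set x {..<N}"

lemma enorm_nonneg [simp]: "0 \<le> enorm N x" by (simp add: enorm_def L2_set_nonneg)

lemma enorm_sq: "(enorm N x)\<^sup>2 = dot N x x"
  by (simp add: enorm_def L2_set_def dot_def sum_nonneg power2_eq_square)

lemma dot_commute: "dot N x y = dot N y x" by (simp add: dot_def mult.commute)

lemma dot_scale_left: "dot N (\<lambda>i. x i / a) y = dot N x y / a"
  by (simp add: dot_def sum_divide_distrib)

lemma dot_scale_right: "dot N y (\<lambda>i. x i / a) = dot N y x / a"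
  by (simp add: dot_def sum_divide_distrib)

lemma dot_diff_left: "dot N (\<lambda>i. x i - y i) z = dot N x z - dot N y z"
  by (simp add: dot_def sum_subtractf left_diff_distrib)

lemma dot_diff_self: "dot N (\<lambda>i. x i - y i) (\<lambda>i. x i - y i) = dot N x x - 2 * dot N x y + dot N y y"
  by (simp add: dot_def sum_subtractf sum.distrib algebra_simps sum_distrib_left)

lemma abs_dot_le: "\<bar>dot N x y\<bar> \<le> enorm N x * enorm N y"
  using L2_set_mult_ineq[of x y "{..<N}"] sum_abs[of "\<lambda>i. x i * y i" "{..<N}"]
  by (simp add: dot_def enorm_def abs_mult)

lemma enorm_diff: "\<bar>enorm N x - enorm N y\<bar> \<le> enorm N (\<lambda>i. x i - y i)"
proof -
  have "enorm N a \<le> enorm N (\<lambda>i. a i - b i) + enorm N b" for a b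
    using L2_set_triangle_ineq[of "\<lambda>i. a i - b i" b "{..<N}"] by (simp add: enorm_def)
  from this[of x y] this[of y x] show ?thesis
    by (simp add: enorm_def L2_set_def power2_commute)
qed

text \<open>Homogeneous of degree one and supported in the cone around \<open>v\<close> where the
  cosine exceeds 31/32. Homogeneity makes it comparable with |x| on a narrower cone, so no radial
  cut-off is needed.\<close>

definition bump :: "nat \<Rightarrow> (nat \<Rightarrow> real) \<Rightarrow> (nat \<Rightarrow> real) \<Rightarrow> real" where
  "bump N v x = max 0 (dot N x v - 31 / 32 * enorm N x)"

lemma bump_Lipschitz:
  assumes "dot N v v = 1"
  shows "\<bar>bump N v x - bump N v y\<bar> \<le> 2 * enorm N (\<lambda>i. x i - y i)"
proof -
  have "enorm N v = 1" using enorm_sq[of N v] assms by (simp add: power2_eq_1_iff) (use enorm_nonneg[of N v] in linarith)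
  then have "\<bar>dot N x v - dot N y v\<bar> \<le> enorm N (\<lambda>i. x i - y i)"
    using abs_dot_le[of N "\<lambda>i. x i - y i" v] by (simp add: dot_diff_left)
  then show ?thesis using enorm_diff[of N x y] by (auto simp: bump_def max_def abs_if split: if_splits)
qed

lemma bump_disjoint:
  assumes v: "dot N v v = 1" "dot N w w = 1" "dot N v w < 7 / 8"
    and "bump N v x > 0" "bump N w x > 0"
  shows False
proof -
  have *: "dot N x v > 31 / 32 * enorm N x" "dot N x w > 31 / 32 * enorm N x"
    using assms(4,5) by (auto simp: bump_def max_def split: if_splits)
  have "enorm N x \<noteq> 0" using * abs_dot_le[of N x v] by auto
  then have n: "enorm N x > 0" using enorm_nonneg[of N x] by linarith
  define y where "y = (\<lambda>i. x i / enorm N x)"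
  have y: "dot N y v > 31 / 32" "dot N y w > 31 / 32" using * n by (auto simp: y_def dot_scale_left field_simps)
  have yy: "dot N y y = 1"
    using n by (simp add: y_def dot_scale_left dot_scale_right enorm_sq[symmetric] power2_eq_square)
  \<comment> \<open>The square of |2 y - v - w| equals 6 - 4 <y,v> - 4 <y,w> + 2 <v,w>. With both
    pairings above 31/32 this forces <v,w> > 7/8, which fixes the relation of the two
    constants.\<close>
  have "0 \<le> dot N (\<lambda>i. (2 * y i - v i) - w i) (\<lambda>i. (2 * y i - v i) - w i)"
    by (auto simp: dot_def intro!: sum_nonneg)
  also have "\<dots> = 4 * dot N y y + dot N v v + dot N w w - 4 * dot N y v - 4 * dot N y w + 2 * dot N v w"
    by (simp add: dot_def sum_subtractf sum.distrib algebra_simps sum_distrib_left)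
  finally show False using y yy v by simp
qed

text \<open>The number of cells of a grid of mesh 1 / (6 N) meeting the cube [-1, 1]^N: each floor
  takes one of the 12 N + 1 integers between -6 N and 6 N.\<close>

definition cell_bound :: "nat \<Rightarrow> real" where "cell_bound N = (12 * real N + 1) ^ N"

lemma exists_heavy_cell:
  fixes f :: "'b \<Rightarrow> 'c" and w :: "'b \<Rightarrow> real"
  assumes "finite W" "finite C" "\<And>x. x \<in> W \<Longrightarrow> f x \<in> C" "1 \<le> sum w W"
  shows "\<exists>c\<in>C. 1 / card C \<le> (\<Sum>x\<in>{x\<in>W. f x = c}. w x)"
proof (rule ccontr)
  assume neg: "\<not> ?thesis"
  have "C \<noteq> {}" using assms(3,4) by (cases "W = {}") auto
  have "sum w W = (\<Sum>c\<in>C. \<Sum>x\<in>{x\<in>W. f x = c}. w x)"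
    using assms by (intro sum.group[symmetric]) auto
  also have "\<dots> < (\<Sum>c\<in>C. 1 / card C)"
    using neg \<open>C \<noteq> {}\<close> assms(2) by (intro sum_strict_mono) auto
  also have "\<dots> = 1" using \<open>C \<noteq> {}\<close> assms(2) by simp
  finally show False using assms(4) by simp
qed

text \<open>By \<open>iso\<close> a cap around a unit vector carries mass at most \<open>(64 / 49) * (9 / 8) < 3 / 2\<close>, so
  after removing the caps around fewer than \<open>n\<close> directions some mass is left, and a cell of a
  fine grid on the sphere carries a fixed proportion of it.\<close>

lemma exists_next_direction:
  fixes V :: "(nat \<Rightarrow> real) set" and m :: "(nat \<Rightarrow> real) \<Rightarrow> real"
  assumes V: "finite V" and m: "\<And>x. x \<in> V \<Longrightarrow> 0 \<le> m x" and N: "N = 2 * n" "k < n"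
    and iso: "\<And>a. dot N a a = 1 \<Longrightarrow> (\<Sum>x\<in>V. m x * (dot N x a)\<^sup>2) \<le> 9 / 8"
    and tot: "real N - 1 \<le> (\<Sum>x\<in>V. m x * dot N x x)"
    and v: "\<And>i. i < k \<Longrightarrow> dot N (v i) (v i) = 1"
  shows "\<exists>u. dot N u u = 1 \<and> (\<forall>i<k. dot N u (v i) < 7 / 8) \<and>
    1 / cell_bound N \<le> (\<Sum>x\<in>V. m x * dot N x x * of_bool (63 / 64 * enorm N x \<le> dot N x u))"
proof -
  define R where "R = {x\<in>V. \<exists>i<k. 7 / 8 * enorm N x \<le> dot N x (v i)}"
  define W where "W = V - R"
  have dd: "0 \<le> dot N x x" for x by (auto simp: dot_def intro!: sum_nonneg)
  have "(\<Sum>x\<in>R. m x * dot N x x) \<le> (\<Sum>x\<in>V. \<Sum>i<k. 64 / 49 * (m x * (dot N x (v i))\<^sup>2))"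
  proof -
    have "(\<Sum>x\<in>R. m x * dot N x x) \<le> (\<Sum>x\<in>R. \<Sum>i<k. 64 / 49 * (m x * (dot N x (v i))\<^sup>2))"
    proof (rule sum_mono)
      fix x assume x: "x \<in> R"
      then obtain i where i: "i < k" "7 / 8 * enorm N x \<le> dot N x (v i)" "x \<in> V" by (auto simp: R_def)
      have "(7 / 8 * enorm N x)\<^sup>2 \<le> (dot N x (v i))\<^sup>2" using i by (intro power_mono) auto
      then have "dot N x x \<le> 64 / 49 * (dot N x (v i))\<^sup>2" by (simp add: power_mult_distrib enorm_sq power_divide)
      then have "m x * dot N x x \<le> m x * (64 / 49 * (dot N x (v i))\<^sup>2)" using m[OF i(3)] by (intro mult_left_mono) auto
      also have "\<dots> = 64 / 49 * (m x * (dot N x (v i))\<^sup>2)" by simp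
      also have "\<dots> \<le> (\<Sum>i<k. 64 / 49 * (m x * (dot N x (v i))\<^sup>2))"
        using i m[OF i(3)] by (intro member_le_sum) auto
      finally show "m x * dot N x x \<le> (\<Sum>i<k. 64 / 49 * (m x * (dot N x (v i))\<^sup>2))" .
    qed
    also have "\<dots> \<le> (\<Sum>x\<in>V. \<Sum>i<k. 64 / 49 * (m x * (dot N x (v i))\<^sup>2))"
      using V m by (intro sum_mono2) (auto simp: R_def intro!: sum_nonneg)
    finally show ?thesis .
  qed
  also have "\<dots> = (\<Sum>i<k. 64 / 49 * (\<Sum>x\<in>V. m x * (dot N x (v i))\<^sup>2))"
    by (subst sum.swap) (simp add: sum_distrib_left)
  also have "\<dots> \<le> (\<Sum>i<k. 64 / 49 * (9 / 8))" using iso v by (intro sum_mono mult_left_mono) auto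
  also have "\<dots> \<le> 3 / 2 * real k" by simp
  also have "\<dots> \<le> 3 / 2 * (real n - 1)" using N(2) by simp
  finally have R: "(\<Sum>x\<in>R. m x * dot N x x) \<le> 3 / 2 * (real n - 1)" .
  have "(\<Sum>x\<in>W. m x * dot N x x) = (\<Sum>x\<in>V. m x * dot N x x) - (\<Sum>x\<in>R. m x * dot N x x)"
    unfolding W_def using V by (intro sum_diff) (auto simp: R_def)
  \<comment> \<open>The remaining mass is at least (2 n - 1) - 3/2 (n - 1) = (n + 1) / 2.\<close>
  then have W1: "1 \<le> (\<Sum>x\<in>W. m x * dot N x x)" using R tot N by simp
  define cell where "cell = (\<lambda>x. \<lambda>i\<in>{..<N}. \<lfloor>real (6 * N) * (x i / enorm N x)\<rfloor>)"
  define C where "C = PiE {..<N} (\<lambda>_. {- int (6 * N) .. int (6 * N)})"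
  have "card {- int (6 * N) .. int (6 * N)} = 12 * N + 1" by simp
  then have cardC: "real (card C) = cell_bound N" by (simp add: C_def card_PiE cell_bound_def add.commute)
  have finC: "finite C" by (auto simp: C_def intro: finite_PiE)
  have N0: "N > 0" using N by simp
  have cellC: "cell x \<in> C" for x
  proof -
    have "\<lfloor>real (6 * N) * (x i / enorm N x)\<rfloor> \<in> {- int (6 * N) .. int (6 * N)}" if "i < N" for i
    proof -
      have "\<bar>x i\<bar> \<le> enorm N x"
        using member_le_L2_set[of "{..<N}" i "\<lambda>i. \<bar>x i\<bar>"] that by (simp add: enorm_def L2_set_def)
      then have "\<bar>x i / enorm N x\<bar> \<le> 1" by (auto simp: abs_divide divide_le_eq_1)
      then have "\<bar>real (6 * N) * (x i / enorm N x)\<bar> \<le> real (6 * N) * 1"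
        unfolding abs_mult by (intro mult_mono) auto
      then have "- real (6 * N) \<le> real (6 * N) * (x i / enorm N x) \<and> real (6 * N) * (x i / enorm N x) \<le> real (6 * N)"
        unfolding abs_le_iff minus_le_iff[of "real (6 * N)"] by (simp only: mult_1_right minus_le_iff)
      then show ?thesis unfolding atLeastAtMost_iff le_floor_iff floor_le_iff by simp
    qed
    then show ?thesis by (auto simp: cell_def C_def)
  qed
  obtain c where c: "c \<in> C" "1 / card C \<le> (\<Sum>x\<in>{x\<in>W. cell x = c}. m x * dot N x x)"
    using exists_heavy_cell[of W C cell "\<lambda>x. m x * dot N x x"] V finC cellC W1 by (auto simp: W_def)
  define A where "A = {x\<in>W. cell x = c}"
  have "1 / card C > 0" by (simp add: cardC cell_bound_def)
  then have "(\<Sum>x\<in>A. m x * dot N x x) \<noteq> 0" using less_le_trans[OF _ c(2)] unfolding A_def by force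
  \<comment> \<open>A cell of positive mass contains a point of nonzero norm. Its direction serves
    as \<open>u\<close>; as \<open>z\<close> survived the removal of the caps, \<open>u\<close> is
    separated from all earlier directions.\<close>
  then obtain z where z: "z \<in> A" "m z * dot N z z \<noteq> 0" by (meson sum.neutral)
  then have "enorm N z \<noteq> 0" using enorm_sq[of N z] by auto
  then have z0: "enorm N z > 0" by (simp add: less_le)
  define u where "u = (\<lambda>i. z i / enorm N z)"
  have hat1: "dot N (\<lambda>i. x i / enorm N x) (\<lambda>i. x i / enorm N x) = 1" if "enorm N x > 0" for x
    using that by (simp add: dot_scale_left dot_scale_right enorm_sq[symmetric] power2_eq_square)
  have u1: "dot N u u = 1" using hat1[OF z0] by (simp add: u_def)
  have usep: "dot N u (v i) < 7 / 8" if "i < k" for i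
  proof -
    have "dot N z (v i) < 7 / 8 * enorm N z" using z that by (auto simp: A_def W_def R_def not_le)
    then show ?thesis using z0 by (simp add: u_def dot_scale_left field_simps)
  qed
  have near: "63 / 64 * enorm N x \<le> dot N x u" if x: "x \<in> A" for x
  proof (cases "enorm N x = 0")
    case True
    then show ?thesis using abs_dot_le[of N x u] by simp
  next
    case False
    then have x0: "enorm N x > 0" using enorm_nonneg[of N x] by linarith
    define y where "y = (\<lambda>i. x i / enorm N x)"
    have "(y i - u i) * (y i - u i) \<le> 1 / (6 * N)\<^sup>2" if i: "i < N" for i
    proof -
      have "cell x i = cell z i" using x z by (simp add: A_def)
      then have "\<lfloor>real (6 * N) * y i\<rfloor> = \<lfloor>real (6 * N) * u i\<rfloor>"
        using i by (simp add: cell_def y_def u_def)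
      then have "\<bar>real (6 * N) * y i - real (6 * N) * u i\<bar> \<le> 1" by linarith
      then have "\<bar>real (6 * N) * (y i - u i)\<bar> \<le> 1" by (simp only: right_diff_distrib)
      then have "(real (6 * N) * (y i - u i))\<^sup>2 \<le> 1" by (simp add: abs_square_le_1)
      then show ?thesis using N0 by (simp add: power_mult_distrib field_simps power2_eq_square)
    qed
    then have "dot N (\<lambda>i. y i - u i) (\<lambda>i. y i - u i) \<le> (\<Sum>i<N. 1 / (6 * N)\<^sup>2)"
      unfolding dot_def by (intro sum_mono) auto
    \<comment> \<open>For unit vectors the pairing is 1 - |y - u|^2 / 2, hence at least 1 - 1/72,
      which exceeds 63/64.\<close>
    also have "\<dots> \<le> 1 / 36" using N0 by (simp add: power2_eq_square field_simps)
    finally have "dot N y u \<ge> 63 / 64" using hat1[OF x0] u1 by (simp add: dot_diff_self y_def)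
    then show ?thesis using x0 by (simp add: y_def dot_scale_left field_simps)
  qed
  have "1 / card C \<le> (\<Sum>x\<in>A. m x * dot N x x * of_bool (63 / 64 * enorm N x \<le> dot N x u))"
    using c near by (simp add: A_def)
  also have "\<dots> \<le> (\<Sum>x\<in>V. m x * dot N x x * of_bool (63 / 64 * enorm N x \<le> dot N x u))"
    using V m dd by (intro sum_mono2) (auto simp: A_def W_def)
  finally show ?thesis using u1 usep by (intro exI[of _ u]) (simp add: cardC)
qed

lemma exists_directions:
  fixes V :: "(nat \<Rightarrow> real) set" and m :: "(nat \<Rightarrow> real) \<Rightarrow> real"
  assumes V: "finite V" and m: "\<And>x. x \<in> V \<Longrightarrow> 0 \<le> m x" and N: "N = 2 * n" "k \<le> n"
    and iso: "\<And>a. dot N a a = 1 \<Longrightarrow> (\<Sum>x\<in>V. m x * (dot N x a)\<^sup>2) \<le> 9 / 8"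
    and tot: "real N - 1 \<le> (\<Sum>x\<in>V. m x * dot N x x)"
  shows "\<exists>v. (\<forall>i<k. dot N (v i) (v i) = 1) \<and> (\<forall>i<k. \<forall>j<k. i \<noteq> j \<longrightarrow> dot N (v i) (v j) < 7 / 8) \<and>
    (\<forall>i<k. 1 / cell_bound N \<le> (\<Sum>x\<in>V. m x * dot N x x * of_bool (63 / 64 * enorm N x \<le> dot N x (v i))))"
  using N(2)
proof (induction k)
  case (Suc k)
  obtain v where v: "\<forall>i<k. dot N (v i) (v i) = 1" "\<forall>i<k. \<forall>j<k. i \<noteq> j \<longrightarrow> dot N (v i) (v j) < 7 / 8"
    "\<forall>i<k. 1 / cell_bound N \<le> (\<Sum>x\<in>V. m x * dot N x x * of_bool (63 / 64 * enorm N x \<le> dot N x (v i)))"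
    using Suc.IH[OF Suc_leD[OF Suc.prems]] by (elim exE conjE) (rule that)
  have "\<exists>u. dot N u u = 1 \<and> (\<forall>i<k. dot N u (v i) < 7 / 8) \<and>
    1 / cell_bound N \<le> (\<Sum>x\<in>V. m x * dot N x x * of_bool (63 / 64 * enorm N x \<le> dot N x u))"
  proof (rule exists_next_direction)
    show "k < n" using Suc.prems by simp
    show "N = 2 * n" by (rule N)
    show "dot N (v i) (v i) = 1" if "i < k" for i using v(1) that by blast
  qed (fact V m iso tot)+
  then obtain u where u: "dot N u u = 1" "\<forall>i<k. dot N u (v i) < 7 / 8"
    "1 / cell_bound N \<le> (\<Sum>x\<in>V. m x * dot N x x * of_bool (63 / 64 * enorm N x \<le> dot N x u))"
    by (elim exE conjE) (rule that)
  have u': "\<forall>i<k. dot N (v i) u < 7 / 8" using u(2) by (simp add: dot_commute[of N u])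
  show ?case
    by (rule exI[of _ "v(k := u)"]) (use v u u' in \<open>auto simp: less_Suc_eq\<close>)
qed simp

text \<open>Each bump is at least |x| / 64 on its narrow cone, as 63/64 - 31/32 = 1/64, so its
  square carries at least 1/4096 of the mass there. Its Lipschitz constant 2 multiplies the energy
  by 4, whence 16384 = 4 * 4096. Level sets of the squared bumps are disjoint because the bumps have
  disjoint supports.\<close>

lemma exists_disjoint_sets_small_boundary:
  fixes V :: "(nat \<Rightarrow> real) set" and J :: "(nat \<Rightarrow> real) \<Rightarrow> (nat \<Rightarrow> real) \<Rightarrow> real"
  assumes V: "finite V" and J: "\<And>x y. x \<in> V \<Longrightarrow> y \<in> V \<Longrightarrow> 0 \<le> J x y" "\<And>x y. x \<in> V \<Longrightarrow> y \<in> V \<Longrightarrow> J x y = J y x"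
    and m: "\<And>x. x \<in> V \<Longrightarrow> m x = (\<Sum>y\<in>V. J x y)"
    and N: "N = 2 * n"
    and iso: "\<And>a. dot N a a = 1 \<Longrightarrow> (\<Sum>x\<in>V. m x * (dot N x a)\<^sup>2) \<le> 9 / 8"
    and tot: "real N - 1 \<le> (\<Sum>x\<in>V. m x * dot N x x)"
    and e: "\<epsilon> > 0"
    and energy: "(\<Sum>x\<in>V. \<Sum>y\<in>V. J x y * dot N (\<lambda>i. x i - y i) (\<lambda>i. x i - y i))
       \<le> \<epsilon>\<^sup>2 / (16384 * cell_bound N)"
  shows "\<exists>A. (\<forall>i<n. A i \<subseteq> V \<and> 0 < (\<Sum>x\<in>V. m x * of_bool (x \<in> A i)) \<and>
        (\<Sum>x\<in>V. \<Sum>y\<in>V. J x y * \<bar>of_bool (x \<in> A i) - of_bool (y \<in> A i)\<bar>) \<le> 4 * \<epsilon> * (\<Sum>x\<in>V. m x * of_bool (x \<in> A i))) \<and>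
      (\<forall>i<n. \<forall>j<n. i \<noteq> j \<longrightarrow> A i \<inter> A j = {})"
proof -
  define c :: real where "c = 1 / cell_bound N"
  have c: "c > 0" by (simp add: c_def cell_bound_def)
  have m0: "0 \<le> m x" if "x \<in> V" for x using J m that by (auto intro: sum_nonneg)
  obtain v where v: "\<And>i. i < n \<Longrightarrow> dot N (v i) (v i) = 1" "\<And>i j. i < n \<Longrightarrow> j < n \<Longrightarrow> i \<noteq> j \<Longrightarrow> dot N (v i) (v j) < 7 / 8"
    "\<And>i. i < n \<Longrightarrow> c \<le> (\<Sum>x\<in>V. m x * dot N x x * of_bool (63 / 64 * enorm N x \<le> dot N x (v i)))"
    using exists_directions[OF V m0 N order_refl iso tot] unfolding c_def by blast
  define g where "g = (\<lambda>i x. bump N (v i) x)"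
  define Q where "Q = (\<lambda>i t. 0 \<le> t \<and> 0 < (\<Sum>x\<in>V. m x * of_bool (t < (g i x)\<^sup>2)) \<and>
     (\<Sum>x\<in>V. \<Sum>y\<in>V. J x y * \<bar>of_bool (t < (g i x)\<^sup>2) - of_bool (t < (g i y)\<^sup>2)\<bar>)
       \<le> 4 * \<epsilon> * (\<Sum>x\<in>V. m x * of_bool (t < (g i x)\<^sup>2)))"
  have "\<exists>t. Q i t" if i: "i < n" for i
    unfolding Q_def
  proof (rule Cheeger_level_set[OF V J m e])
    have "c / 4096 \<le> (\<Sum>x\<in>V. m x * dot N x x * of_bool (63 / 64 * enorm N x \<le> dot N x (v i))) / 4096"
      using v(3)[OF i] by simp
    also have "\<dots> \<le> (\<Sum>x\<in>V. m x * (g i x)\<^sup>2)" unfolding sum_divide_distrib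
    proof (rule sum_mono)
      fix x assume x: "x \<in> V"
      have "dot N x x * of_bool (63 / 64 * enorm N x \<le> dot N x (v i)) / 4096 \<le> (g i x)\<^sup>2"
      proof (cases "63 / 64 * enorm N x \<le> dot N x (v i)")
        case True
        then have "enorm N x / 64 \<le> g i x" unfolding g_def bump_def by linarith
        then have "(enorm N x / 64)\<^sup>2 \<le> (g i x)\<^sup>2" by (intro power_mono) auto
        then show ?thesis using True by (simp add: power_divide enorm_sq)
      qed simp
      then show "m x * dot N x x * of_bool (63 / 64 * enorm N x \<le> dot N x (v i)) / 4096 \<le> m x * (g i x)\<^sup>2"
        using m0[OF x] mult_left_mono[of "dot N x x * of_bool (63 / 64 * enorm N x \<le> dot N x (v i)) / 4096" "(g i x)\<^sup>2" "m x"]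
        by (simp add: mult.assoc)
    qed
    finally have mass: "c / 4096 \<le> (\<Sum>x\<in>V. m x * (g i x)\<^sup>2)" .
    then show "0 < (\<Sum>x\<in>V. m x * (g i x)\<^sup>2)" using c by simp
    have "(\<Sum>x\<in>V. \<Sum>y\<in>V. J x y * (g i x - g i y)\<^sup>2)
      \<le> (\<Sum>x\<in>V. \<Sum>y\<in>V. J x y * (4 * dot N (\<lambda>i. x i - y i) (\<lambda>i. x i - y i)))"
    proof (intro sum_mono mult_left_mono)
      fix x y
      have "\<bar>g i x - g i y\<bar>\<^sup>2 \<le> (2 * enorm N (\<lambda>i. x i - y i))\<^sup>2"
        unfolding g_def using bump_Lipschitz[OF v(1)[OF i]] by (intro power_mono) auto
      then show "(g i x - g i y)\<^sup>2 \<le> 4 * dot N (\<lambda>i. x i - y i) (\<lambda>i. x i - y i)"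
        by (simp add: power_mult_distrib enorm_sq)
    qed (use J in auto)
    also have "\<dots> = 4 * (\<Sum>x\<in>V. \<Sum>y\<in>V. J x y * dot N (\<lambda>i. x i - y i) (\<lambda>i. x i - y i))"
      by (simp add: sum_distrib_left mult_ac)
    also have "\<dots> \<le> 4 * (\<epsilon>\<^sup>2 * c / 16384)" using energy by (simp add: c_def field_simps)
    also have "\<dots> = \<epsilon>\<^sup>2 * (c / 4096)" by simp
    also have "\<dots> \<le> \<epsilon>\<^sup>2 * (\<Sum>x\<in>V. m x * (g i x)\<^sup>2)" using mass by (intro mult_left_mono) auto
    finally show "(\<Sum>x\<in>V. \<Sum>y\<in>V. J x y * (g i x - g i y)\<^sup>2) \<le> \<epsilon>\<^sup>2 * (\<Sum>x\<in>V. m x * (g i x)\<^sup>2)" .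
  qed auto
  then obtain t where Q: "\<And>i. i < n \<Longrightarrow> Q i (t i)" by metis
  note t = Q[unfolded Q_def, THEN conjunct1] Q[unfolded Q_def, THEN conjunct2, THEN conjunct1]
    Q[unfolded Q_def, THEN conjunct2, THEN conjunct2]
  define A where "A = (\<lambda>i. {x\<in>V. t i < (g i x)\<^sup>2})"
  have mem: "x \<in> A i \<longleftrightarrow> t i < (g i x)\<^sup>2" if "x \<in> V" for x i using that by (simp add: A_def)
  have pos: "bump N (v i) x > 0" if "x \<in> A i" "i < n" for x i
  proof -
    have "(g i x)\<^sup>2 > 0" using that t(1)[OF that(2)] by (auto simp: A_def)
    then show ?thesis by (simp add: g_def bump_def)
  qed
  have "A i \<inter> A j = {}" if ij: "i < n" "j < n" "i \<noteq> j" for i j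
    using bump_disjoint[OF v(1)[OF ij(1)] v(1)[OF ij(2)] v(2)[OF ij]] pos ij by blast
  moreover have "A i \<subseteq> V" for i by (auto simp: A_def)
  ultimately show ?thesis using t by (intro exI[of _ A]) (simp add: mem cong: sum.cong)
qed

section \<open>The space of square-integrable functions\<close>

instantiation "fun" :: (type, real_vector) real_vector
begin

definition scaleR_fun :: "real \<Rightarrow> ('a \<Rightarrow> 'b) \<Rightarrow> 'a \<Rightarrow> 'b" where
  "scaleR_fun r f = (\<lambda>x. r *\<^sub>R f x)"

instance
  by standard (auto simp: scaleR_fun_def fun_eq_iff scaleR_add_right scaleR_add_left)

end

lemma scaleR_fun_apply [simp]: "(r *\<^sub>R f) x = r *\<^sub>R f x" for f :: "'a \<Rightarrow> 'b::real_vector"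
  by (simp add: scaleR_fun_def)

lemma sum_fun_apply: "(\<Sum>i\<in>I. f i) x = (\<Sum>i\<in>I. f i x)" for f :: "'i \<Rightarrow> 'a \<Rightarrow> 'b::comm_monoid_add"
  by (induction I rule: infinite_finite_induct) auto

lemma borel_measurable_fun_ops:
  fixes f g :: "'a \<Rightarrow> real"
  shows "\<lbrakk>f \<in> borel_measurable M; g \<in> borel_measurable M\<rbrakk> \<Longrightarrow> f + g \<in> borel_measurable M"
    "\<lbrakk>f \<in> borel_measurable M; g \<in> borel_measurable M\<rbrakk> \<Longrightarrow> f - g \<in> borel_measurable M"
    "f \<in> borel_measurable M \<Longrightarrow> a *\<^sub>R f \<in> borel_measurable M"
  by (auto simp: plus_fun_def fun_diff_def scaleR_fun_def)

definition lip :: "'a measure \<Rightarrow> ('a \<Rightarrow> real) \<Rightarrow> ('a \<Rightarrow> real) \<Rightarrow> real" where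
  "lip M f g = (\<integral>x. f x * g x \<partial>M)"

lemma L2_D: "f \<in> L2 M \<Longrightarrow> f \<in> borel_measurable M" "f \<in> L2 M \<Longrightarrow> integrable M (\<lambda>x. (f x)\<^sup>2)"
  by (auto simp: L2_def)

lemma L2_mult_integrable:
  assumes "f \<in> L2 M" "g \<in> L2 M" shows "integrable M (\<lambda>x. f x * g x)"
proof (rule Bochner_Integration.integrable_bound[of M "\<lambda>x. (f x)\<^sup>2 + (g x)\<^sup>2"])
  show "integrable M (\<lambda>x. (f x)\<^sup>2 + (g x)\<^sup>2)" using assms by (auto simp: L2_def)
  show "(\<lambda>x. f x * g x) \<in> borel_measurable M" using assms by (auto simp: L2_def)
  have "\<bar>a * b\<bar> \<le> a\<^sup>2 + b\<^sup>2" for a b :: real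
    using sum_squares_bound[of "\<bar>a\<bar>" "\<bar>b\<bar>"] by (simp add: abs_mult) (use mult_nonneg_nonneg[of "\<bar>a\<bar>" "\<bar>b\<bar>"] in linarith)
  then show "AE x in M. norm (f x * g x) \<le> norm ((f x)\<^sup>2 + (g x)\<^sup>2)" by auto
qed

lemma L2_add: assumes "f \<in> L2 M" "g \<in> L2 M" shows "f + g \<in> L2 M"
proof -
  have "integrable M (\<lambda>x. (f x)\<^sup>2 + 2 * (f x * g x) + (g x)\<^sup>2)"
    using assms L2_mult_integrable[OF assms] by (auto simp: L2_def)
  then show ?thesis using assms borel_measurable_fun_ops(1)[of f M g] by (auto simp: L2_def power2_sum algebra_simps)
qed

lemma L2_scale: "f \<in> L2 M \<Longrightarrow> a *\<^sub>R f \<in> L2 M"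
  using borel_measurable_fun_ops(3)[of f M a] by (auto simp: L2_def power_mult_distrib)

lemma L2_subspace: "subspace (L2 M)"
  unfolding subspace_def by (auto simp: L2_add L2_scale) (auto simp: L2_def zero_fun_def)

lemma L2_bounded:
  assumes "finite_measure M" "f \<in> borel_measurable M" "\<And>x. x \<in> space M \<Longrightarrow> \<bar>f x\<bar> \<le> B"
  shows "f \<in> L2 M"
proof -
  interpret finite_measure M by fact
  have "integrable M (\<lambda>x. (f x)\<^sup>2)"
  proof (rule integrable_const_bound[of _ "B\<^sup>2"])
    have "(f x)\<^sup>2 \<le> B\<^sup>2" if "x \<in> space M" for x using power_mono[OF assms(3)[OF that], of 2] by simp
    then show "AE x in M. norm ((f x)\<^sup>2) \<le> B\<^sup>2" by auto
  qed (use assms in auto)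
  then show ?thesis using assms by (auto simp: L2_def)
qed

lemma L2_semi_inner: "semi_inner (L2 M) (lip M)"
proof
  fix f g h :: "'a \<Rightarrow> real" and a :: real
  assume "f \<in> L2 M" "g \<in> L2 M" "h \<in> L2 M"
  then show "lip M (f + g) h = lip M f h + lip M g h"
    by (simp add: lip_def distrib_right L2_mult_integrable)
qed (auto simp: L2_subspace lip_def mult.commute mult.left_commute)

text \<open>The steps are summable in L1, so the sequence converges almost everywhere; the Fatou
  lemma turns the geometric bounds on \<open>u (n + k) - u n\<close> into bounds on the distance to
  the pointwise limit.\<close>

lemma L2_complete:
  fixes u :: "nat \<Rightarrow> 'a \<Rightarrow> real"
  assumes "prob_space M" and u: "\<And>n. u n \<in> L2 M" and q: "0 \<le> q" "q < 1"
    and d': "\<And>n. semi_inner.nrm (lip M) (u (Suc n) - u n) \<le> c * q ^ n"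
  shows "\<exists>v\<in>L2 M. (\<lambda>n. semi_inner.nrm (lip M) (u n - v)) \<longlonglongrightarrow> 0"
proof -
  interpret prob_space M by fact
  interpret L: semi_inner "L2 M" "lip M" by (rule L2_semi_inner)
  note d = d'[unfolded L.nrm_def]
  have uD: "u m - u n \<in> L2 M" for m n using subspace_diff[OF L2_subspace] u by blast
  have [measurable]: "u n \<in> borel_measurable M" for n using u by (auto simp: L2_def)
  have sq: "integrable M (\<lambda>x. (u m x - u n x)\<^sup>2)" for m n using uD[of m n] by (auto simp: L2_def)
  have lipd: "lip M (u m - u n) (u m - u n) = (\<integral>x. (u m x - u n x)\<^sup>2 \<partial>M)" for m n
    by (simp add: lip_def power2_eq_square)
  have c: "0 \<le> c" using order_trans[OF _ d[of 0]] by (simp add: lip_def)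
  have L1: "integrable M (\<lambda>x. \<bar>u m x - u n x\<bar>)" for m n
    using square_integrable_imp_integrable[of "\<lambda>x. u m x - u n x"] sq by auto
  have "(\<integral>\<^sup>+x. ennreal \<bar>u (Suc n) x - u n x\<bar> \<partial>M) \<le> ennreal (c * q ^ n)" for n
  proof -
    \<comment> \<open>On a probability space the L1 norm is at most the L2 norm; here this is the
      nonnegativity of a variance.\<close>
    have "(\<integral>x. \<bar>u (Suc n) x - u n x\<bar> \<partial>M)\<^sup>2 \<le> (\<integral>x. \<bar>u (Suc n) x - u n x\<bar>\<^sup>2 \<partial>M)"
      using variance_positive[of "\<lambda>x. \<bar>u (Suc n) x - u n x\<bar>"] variance_eq[of "\<lambda>x. \<bar>u (Suc n) x - u n x\<bar>"] L1 sq by simp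
    also have "\<dots> \<le> (c * q ^ n)\<^sup>2"
      using power_mono[OF d[of n], of 2] by (simp add: lipd real_sqrt_ge_0_iff integral_nonneg_AE)
    finally have "(\<integral>x. \<bar>u (Suc n) x - u n x\<bar> \<partial>M) \<le> c * q ^ n"
      by (rule power2_le_imp_le) (use c q in simp)
    then show ?thesis using L1[of "Suc n" n] by (subst nn_integral_eq_integral) (auto intro: ennreal_leI)
  qed
  then have "(\<integral>\<^sup>+x. (\<Sum>n. ennreal \<bar>u (Suc n) x - u n x\<bar>) \<partial>M) \<le> (\<Sum>n. ennreal (c * q ^ n))"
    by (subst nn_integral_suminf) (auto intro: suminf_le)
  also have "\<dots> = ennreal (\<Sum>n. c * q ^ n)"
    using c q by (intro suminf_ennreal2 summable_mult summable_geometric) auto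
  finally have "(\<integral>\<^sup>+x. (\<Sum>n. ennreal \<bar>u (Suc n) x - u n x\<bar>) \<partial>M) \<noteq> \<infinity>" by (auto simp: top_unique)
  then have "AE x in M. (\<Sum>n. ennreal \<bar>u (Suc n) x - u n x\<bar>) \<noteq> \<infinity>" by (intro nn_integral_PInf_AE) auto
  then have conv: "AE x in M. convergent (\<lambda>n. u n x)"
  proof eventually_elim
    case (elim x)
    then have "summable (\<lambda>n. \<bar>u (Suc n) x - u n x\<bar>)" by (intro summable_suminf_not_top) auto
    then have "summable (\<lambda>n. u (Suc n) x - u n x)" by (rule summable_rabs_cancel)
    then have "convergent (\<lambda>n. u n x - u 0 x)"
      by (simp add: summable_iff_convergent sum_lessThan_telescope[of "\<lambda>n. u n x"])
    from convergent_add[OF this convergent_const[of "u 0 x"]] show ?case by simp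
  qed
  define l where "l = (\<lambda>x. lim (\<lambda>n. u n x))"
  have lm [measurable]: "l \<in> borel_measurable M" unfolding l_def by measurable
  have lim: "AE x in M. (\<lambda>n. u n x) \<longlonglongrightarrow> l x"
    using conv by eventually_elim (simp add: l_def convergent_LIMSEQ_iff)
  define b where "b = (\<lambda>n. c * q ^ n / (1 - q))"
  have b0: "b n \<ge> 0" for n using c q by (simp add: b_def)
  have tel: "sqrt (lip M (u (n + k) - u n) (u (n + k) - u n)) \<le> b n" for n k
    using L.geometric_step_bound[of u, OF u q d'] by (simp add: L.nrm_def b_def)
  have fatou: "(\<integral>\<^sup>+x. ennreal ((u n x - l x)\<^sup>2) \<partial>M) \<le> ennreal ((b n)\<^sup>2)" for n
  proof -
    have "(\<integral>\<^sup>+x. ennreal ((u n x - l x)\<^sup>2) \<partial>M) = (\<integral>\<^sup>+x. liminf (\<lambda>k. ennreal ((u (n + k) x - u n x)\<^sup>2)) \<partial>M)"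
    proof (rule nn_integral_cong_AE)
      show "AE x in M. ennreal ((u n x - l x)\<^sup>2) = liminf (\<lambda>k. ennreal ((u (n + k) x - u n x)\<^sup>2))"
        using lim
      proof eventually_elim
        case (elim x)
        have "(\<lambda>k. u (n + k) x) \<longlonglongrightarrow> l x" using LIMSEQ_ignore_initial_segment[OF elim, of n] by (simp add: add.commute)
        then have "(\<lambda>k. ennreal ((u (n + k) x - u n x)\<^sup>2)) \<longlonglongrightarrow> ennreal ((l x - u n x)\<^sup>2)"
          by (intro tendsto_intros)
        then have "liminf (\<lambda>k. ennreal ((u (n + k) x - u n x)\<^sup>2)) = ennreal ((l x - u n x)\<^sup>2)"
          by (intro lim_imp_Liminf) auto
        then show ?case by (simp only: power2_commute[of "u n x" "l x"])
      qed
    qed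
    also have "\<dots> \<le> liminf (\<lambda>k. \<integral>\<^sup>+x. ennreal ((u (n + k) x - u n x)\<^sup>2) \<partial>M)"
      by (rule nn_integral_liminf) auto
    also have "\<dots> \<le> liminf (\<lambda>k. ennreal ((b n)\<^sup>2))"
    proof (rule Liminf_mono, rule always_eventually, rule allI)
      fix k
      have "(\<integral>x. (u (n + k) x - u n x)\<^sup>2 \<partial>M) \<le> (b n)\<^sup>2"
        using power_mono[OF tel[of n k], of 2] by (simp add: lipd real_sqrt_ge_0_iff integral_nonneg_AE)
      then show "(\<integral>\<^sup>+x. ennreal ((u (n + k) x - u n x)\<^sup>2) \<partial>M) \<le> ennreal ((b n)\<^sup>2)"
        using sq[of "n + k" n] by (subst nn_integral_eq_integral) (auto intro: ennreal_leI)
    qed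
    finally show ?thesis by (simp add: Liminf_const)
  qed
  have int: "integrable M (\<lambda>x. (u n x - l x)\<^sup>2)" for n
    using fatou[of n] by (intro integrableI_bounded) (auto simp: le_less_trans)
  then have ul: "u n - l \<in> L2 M" for n using borel_measurable_fun_ops(2)[of "u n" M l] by (auto simp: L2_def)
  have "l = u 0 - (u 0 - l)" by simp
  then have l: "l \<in> L2 M" using subspace_diff[OF L2_subspace u[of 0] ul[of 0]] by simp
  have le: "sqrt (lip M (u n - l) (u n - l)) \<le> b n" for n
  proof (rule real_le_lsqrt)
    have "ennreal (\<integral>x. (u n x - l x)\<^sup>2 \<partial>M) \<le> ennreal ((b n)\<^sup>2)"
      using fatou[of n] int[of n] by (subst (asm) nn_integral_eq_integral) auto
    then show "lip M (u n - l) (u n - l) \<le> (b n)\<^sup>2" by (simp add: lip_def power2_eq_square)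
  qed (use b0 in \<open>auto simp: lip_def\<close>)
  have "b \<longlonglongrightarrow> 0"
    using tendsto_divide[OF tendsto_mult[OF tendsto_const[of c] LIMSEQ_power_zero[of q]] tendsto_const[of "1 - q"]] q
    by (simp add: b_def)
  then have "(\<lambda>n. sqrt (lip M (u n - l) (u n - l))) \<longlonglongrightarrow> 0"
    by (rule tendsto_sandwich[OF _ _ tendsto_const, rotated 2]) (use le in \<open>auto simp: lip_def\<close>)
  then show ?thesis using l unfolding L.nrm_def by blast
qed

lemma (in prob_space) L2_semi_hilbert: "semi_hilbert (L2 M) (lip M)"
proof -
  interpret semi_inner "L2 M" "lip M" by (rule L2_semi_inner)
  show ?thesis by unfold_locales (rule L2_complete[OF prob_space_axioms])
qed

section \<open>Symmetric Markov operators: finite graphs from simple functions, and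
  contractivity\<close>

locale symmetric_markov = prob_space M for M :: "'a measure" +
  fixes P :: "('a \<Rightarrow> real) \<Rightarrow> 'a \<Rightarrow> real"
  assumes markov: "markov_operator M P" and symmetric: "symmetric_op M P"
begin

sublocale semi_hilbert "L2 M" "lip M" by (rule L2_semi_hilbert)

lemma aeq_iff_nrm: assumes "f \<in> L2 M" "g \<in> L2 M" shows "aeq M f g \<longleftrightarrow> nrm (f - g) = 0"
proof -
  have "f - g \<in> L2 M" using assms by simp
  then have "integrable M (\<lambda>x. (f x - g x)\<^sup>2)" using L2_D(2)[of "f - g" M] by simp
  then have "(\<integral>x. (f x - g x)\<^sup>2 \<partial>M) = 0 \<longleftrightarrow> (AE x in M. (f x - g x)\<^sup>2 = 0)"
    by (intro integral_nonneg_eq_0_iff_AE) auto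
  then show ?thesis by (simp add: aeq_def nrm_def lip_def power2_eq_square)
qed

lemma aeq_0_iff_nrm: "f \<in> L2 M \<Longrightarrow> aeq M f (\<lambda>x. 0) \<longleftrightarrow> nrm f = 0"
  using aeq_iff_nrm[of f 0] by (simp add: zero_fun_def[symmetric])

lemma lip_aeq_cong: "\<lbrakk>f \<in> L2 M; g \<in> L2 M; h \<in> L2 M; aeq M f g\<rbrakk> \<Longrightarrow> lip M f h = lip M g h"
  using ip_eq_if_null_diff aeq_iff_nrm by blast

lemma P_L2 [simp]: "f \<in> L2 M \<Longrightarrow> P f \<in> L2 M"
  using markov by (auto simp: markov_operator_def L2_operator_def)

lemma P_sym: "\<lbrakk>f \<in> L2 M; g \<in> L2 M\<rbrakk> \<Longrightarrow> lip M (P f) g = lip M f (P g)"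
  using symmetric by (simp add: symmetric_op_def lip_def)

lemma indicator_L2 [simp]: "A \<in> sets M \<Longrightarrow> indicator A \<in> L2 M"
  by (rule L2_bounded[OF finite_measure_axioms, of _ 1]) (auto simp: indicator_def)

lemma const_L2 [simp]: "(\<lambda>x. c) \<in> L2 M"
  by (rule L2_bounded[OF finite_measure_axioms, of _ "\<bar>c\<bar>"]) auto

lemma lip_P_const_1: "f \<in> L2 M \<Longrightarrow> lip M f (P (\<lambda>x. 1)) = (\<integral>x. f x \<partial>M)"
proof -
  assume f: "f \<in> L2 M"
  have "lip M (P (\<lambda>x. 1)) f = lip M (\<lambda>x. 1) f"
    using f markov by (intro lip_aeq_cong) (auto simp: markov_operator_def)
  then show ?thesis using f ip_commute[of f "P (\<lambda>x. 1)"] by (simp add: lip_def)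
qed

lemma lip_cong_space:
  assumes "\<And>x. x \<in> space M \<Longrightarrow> f x = f' x" "\<And>x. x \<in> space M \<Longrightarrow> g x = g' x"
  shows "lip M f g = lip M f' g'"
  unfolding lip_def using assms by (intro Bochner_Integration.integral_cong) auto

lemma lip_indicator: "A \<in> sets M \<Longrightarrow> lip M (indicator A) (indicator B) = measure M (A \<inter> B \<inter> space M)"
  by (simp add: lip_def indicator_inter_arith[symmetric] Int_commute Int_left_commute)

text \<open>The edge weights of the finite graph on the values of \<open>F\<close>: the mass that
  \<open>P\<close> moves in one step between two level sets.\<close>

definition J :: "('a \<Rightarrow> 'b) \<Rightarrow> 'b \<Rightarrow> 'b \<Rightarrow> real" where
  "J F v w = lip M (indicator (F -` {v} \<inter> space M)) (P (indicator (F -` {w} \<inter> space M)))"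

lemma J_nonneg:
  assumes F: "simple_function M F" shows "0 \<le> J F v w"
proof -
  let ?B = "\<lambda>v. F -` {v} \<inter> space M"
  have B: "?B v \<in> sets M" for v by (rule simple_functionD(2)[OF F])
  have "AE x in M. P (indicator (?B w)) x \<ge> 0"
    using markov B[of w] by (auto simp: markov_operator_def)
  then show ?thesis unfolding J_def lip_def by (intro integral_nonneg_AE) (auto simp: indicator_def)
qed

lemma J_commute:
  assumes F: "simple_function M F" shows "J F v w = J F w v"
  unfolding J_def using simple_functionD(2)[OF F]
  by (subst ip_commute) (auto simp: P_sym)

lemma simple_comp_L2 [simp]:
  assumes F: "simple_function M F" shows "(\<lambda>x. \<phi> (F x)) \<in> L2 M"
proof -
  have s: "simple_function M (\<lambda>x. \<phi> (F x))" using simple_function_compose[OF F, of \<phi>] by (simp add: comp_def)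
  have "finite (\<phi> ` F ` space M)" using simple_functionD(1)[OF F] by auto
  then have "\<bar>\<phi> (F x)\<bar> \<le> Max (abs ` \<phi> ` F ` space M)" if "x \<in> space M" for x
    using that by (intro Max_ge) auto
  then show ?thesis using borel_measurable_simple_function[OF s] by (intro L2_bounded[OF finite_measure_axioms]) auto
qed

lemma simple_comp_eq:
  assumes F: "simple_function M F" and x: "x \<in> space M"
  shows "\<phi> (F x) = (\<Sum>v\<in>F ` space M. \<phi> v *\<^sub>R (indicator (F -` {v} \<inter> space M) :: _ \<Rightarrow> real)) x"
proof -
  have "(\<Sum>v\<in>F ` space M. \<phi> v *\<^sub>R (indicator (F -` {v} \<inter> space M) :: _ \<Rightarrow> real)) x
     = (\<Sum>v\<in>F ` space M. if v = F x then \<phi> v else 0)"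
    using x by (auto simp: sum_fun_apply indicator_def intro!: sum.cong)
  also have "\<dots> = \<phi> (F x)" using x simple_functionD(1)[OF F] by (simp add: sum.delta)
  finally show ?thesis by simp
qed

lemma lip_P_simple:
  assumes F: "simple_function M F"
  shows "lip M (\<lambda>x. \<phi> (F x)) (P (\<lambda>x. \<psi> (F x))) = (\<Sum>v\<in>F ` space M. \<Sum>w\<in>F ` space M. \<phi> v * \<psi> w * J F v w)"
proof -
  let ?V = "F ` space M" and ?I = "\<lambda>v. indicator (F -` {v} \<inter> space M) :: 'a \<Rightarrow> real"
  have I: "?I v \<in> L2 M" for v using simple_functionD(2)[OF F] by simp
  have 1: "lip M (\<lambda>x. \<phi> (F x)) h = (\<Sum>v\<in>?V. \<phi> v * lip M (?I v) h)" if "h \<in> L2 M" for \<phi> h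
  proof -
    have "lip M (\<lambda>x. \<phi> (F x)) h = lip M (\<Sum>v\<in>?V. \<phi> v *\<^sub>R ?I v) h"
      by (intro lip_cong_space simple_comp_eq[OF F]) auto
    then show ?thesis using I that by (simp add: ip_sum_left ip_linear)
  qed
  have 2: "lip M (?I v) (P (\<lambda>x. \<psi> (F x))) = (\<Sum>w\<in>?V. \<psi> w * J F v w)" for v
  proof -
    have "lip M (?I v) (P (\<lambda>x. \<psi> (F x))) = lip M (\<lambda>x. \<psi> (F x)) (P (?I v))"
      using P_sym[of "?I v" "\<lambda>x. \<psi> (F x)"] ip_commute[of "P (?I v)" "\<lambda>x. \<psi> (F x)"] I F by simp
    also have "\<dots> = (\<Sum>w\<in>?V. \<psi> w * J F w v)" using I by (simp add: 1 J_def)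
    finally show ?thesis by (simp add: J_commute[OF F, of _ v])
  qed
  show ?thesis using F by (simp add: 1 2 sum_distrib_left mult.assoc)
qed

text \<open>Because P 1 = 1, integration is pairing with P 1, so the row sums of \<open>J F\<close>
  are the measures of the level sets.\<close>

lemma lip_simple:
  assumes F: "simple_function M F"
  shows "lip M (\<lambda>x. \<phi> (F x)) (\<lambda>x. \<psi> (F x)) = (\<Sum>v\<in>F ` space M. \<phi> v * \<psi> v * (\<Sum>w\<in>F ` space M. J F v w))"
proof -
  have "lip M (\<lambda>x. \<phi> (F x)) (\<lambda>x. \<psi> (F x)) = (\<integral>x. \<phi> (F x) * \<psi> (F x) \<partial>M)" by (simp add: lip_def)
  also have "\<dots> = lip M (\<lambda>x. \<phi> (F x) * \<psi> (F x)) (P (\<lambda>x. 1))"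
    using simple_comp_L2[OF F, of "\<lambda>v. \<phi> v * \<psi> v"] by (simp add: lip_P_const_1)
  also have "\<dots> = (\<Sum>v\<in>F ` space M. \<Sum>w\<in>F ` space M. (\<phi> v * \<psi> v) * 1 * J F v w)"
    by (rule lip_P_simple[OF F, of "\<lambda>v. \<phi> v * \<psi> v" "\<lambda>_. 1"])
  finally show ?thesis by (simp add: sum_distrib_left)
qed

lemma simple_approx:
  assumes f: "f \<in> L2 M" and e: "\<eta> > 0"
  obtains s where "simple_function M s" "s \<in> L2 M" "nrm (s - f) \<le> \<eta>"
proof -
  have fm: "f \<in> borel_measurable M" using f by (rule L2_D)
  obtain s where s: "\<And>i. simple_function M (s i)" "\<And>x. x \<in> space M \<Longrightarrow> (\<lambda>i. s i x) \<longlonglongrightarrow> f x"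
     "\<And>i x. x \<in> space M \<Longrightarrow> dist (s i x) 0 \<le> 2 * dist (f x) 0"
    using borel_measurable_implies_sequence_metric[OF fm, of 0] by blast
  have sL: "s i \<in> L2 M" for i using simple_comp_L2[OF s(1)[of i], of "\<lambda>x. x"] by simp
  have bound: "(s i x - f x)\<^sup>2 \<le> 9 * (f x)\<^sup>2" if "x \<in> space M" for i x
  proof -
    have "\<bar>s i x - f x\<bar> \<le> 3 * \<bar>f x\<bar>" using s(3)[OF that, of i] by (simp add: dist_norm)
    from power_mono[OF this, of 2] show ?thesis by (simp add: power_mult_distrib)
  qed
  have "(\<lambda>i. \<integral>x. (s i x - f x)\<^sup>2 \<partial>M) \<longlonglongrightarrow> (\<integral>x. 0 \<partial>M)"
  proof (rule integral_dominated_convergence[where w = "\<lambda>x. 9 * (f x)\<^sup>2"])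
    show "AE x in M. (\<lambda>i. (s i x - f x)\<^sup>2) \<longlonglongrightarrow> 0"
    proof (rule AE_I2)
      fix x assume "x \<in> space M"
      from tendsto_power[OF tendsto_diff[OF s(2)[OF this] tendsto_const[of "f x"]], of 2]
      show "(\<lambda>i. (s i x - f x)\<^sup>2) \<longlonglongrightarrow> 0" by simp
    qed
  qed (use bound f fm L2_D(1)[OF sL] L2_D(2)[OF f] in auto)
  then have "(\<lambda>i. sqrt (\<integral>x. (s i x - f x)\<^sup>2 \<partial>M)) \<longlonglongrightarrow> sqrt 0" by (intro tendsto_real_sqrt) simp
  then have "\<forall>\<^sub>F i in sequentially. sqrt (\<integral>x. (s i x - f x)\<^sup>2 \<partial>M) < \<eta>"
    using e by (intro order_tendstoD) auto
  then obtain i where "sqrt (\<integral>x. (s i x - f x)\<^sup>2 \<partial>M) < \<eta>" by (auto simp: eventually_sequentially)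
  then show ?thesis using s(1)[of i] sL[of i] by (intro that[of "s i"]) (auto simp: nrm_def lip_def power2_eq_square)
qed

text \<open>The pair of \<open>f\<close> and \<open>h\<close> makes both functions of one simple
  function, so 2 a b \<le> a^2 + b^2 can be applied edge by edge and the row and column sums of
  \<open>J\<close> are masses. Normalising \<open>f\<close> and \<open>h\<close> turns the resulting
  additive bound into the product of the norms.\<close>

lemma lip_P_simple_le:
  assumes "simple_function M f" "simple_function M h"
  shows "lip M f (P h) \<le> nrm f * nrm h"
proof -
  have half: "lip M f (P h) \<le> (lip M f f + lip M h h) / 2"
    if f: "simple_function M f" and h: "simple_function M h" for f h :: "'a \<Rightarrow> real"
  proof -
    let ?F = "\<lambda>x. (f x, h x)"
    let ?V = "?F ` space M"
    have F: "simple_function M ?F" using f h by (rule simple_function_Pair)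
    have swap: "(\<Sum>v\<in>?V. \<Sum>w\<in>?V. snd w * snd w * J ?F v w) = (\<Sum>v\<in>?V. \<Sum>w\<in>?V. snd v * snd v * J ?F v w)"
      by (subst sum.swap) (simp add: J_commute[OF F] cong: sum.cong)
    have "lip M f (P h) = (\<Sum>v\<in>?V. \<Sum>w\<in>?V. fst v * snd w * J ?F v w)"
      using lip_P_simple[OF F, of fst snd] by simp
    also have "\<dots> \<le> (\<Sum>v\<in>?V. \<Sum>w\<in>?V. (fst v * fst v * J ?F v w + snd w * snd w * J ?F v w) / 2)"
    proof (intro sum_mono)
      fix v w :: "real \<times> real"
      have "fst v * snd w \<le> (fst v * fst v + snd w * snd w) / 2"
        using sum_squares_bound[of "fst v" "snd w"] by (simp add: power2_eq_square)
      from mult_right_mono[OF this J_nonneg[OF F, of v w]]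
      show "fst v * snd w * J ?F v w \<le> (fst v * fst v * J ?F v w + snd w * snd w * J ?F v w) / 2"
        by (simp add: algebra_simps)
    qed
    also have "\<dots> = ((\<Sum>v\<in>?V. \<Sum>w\<in>?V. fst v * fst v * J ?F v w) + (\<Sum>v\<in>?V. \<Sum>w\<in>?V. snd v * snd v * J ?F v w)) / 2"
      by (simp only: sum_divide_distrib[symmetric] sum.distrib swap)
    also have "\<dots> = (lip M f f + lip M h h) / 2"
      using lip_simple[OF F, of fst fst] lip_simple[OF F, of snd snd] by (simp add: sum_distrib_left)
    finally show ?thesis .
  qed
  have L: "f \<in> L2 M" "h \<in> L2 M" using simple_comp_L2[OF assms(1), of "\<lambda>x. x"] simple_comp_L2[OF assms(2), of "\<lambda>x. x"] by auto
  have scaled: "a * b * lip M f (P h) \<le> (a\<^sup>2 * (nrm f)\<^sup>2 + b\<^sup>2 * (nrm h)\<^sup>2) / 2" for a b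
  proof -
    have "simple_function M (a *\<^sub>R f)" "simple_function M (b *\<^sub>R h)"
      using simple_function_compose[OF assms(1), of "\<lambda>x. a * x"] simple_function_compose[OF assms(2), of "\<lambda>x. b * x"]
      by (simp_all add: comp_def scaleR_fun_def)
    note half = half[OF this]
    have eq: "lip M (a *\<^sub>R f) (P (b *\<^sub>R h)) = a * b * lip M f (P h)"
      using L P_sym[of f "b *\<^sub>R h"] P_sym[of f h] by (simp add: ip_linear)
    show ?thesis using half[unfolded eq] L unfolding nrm_sq[OF L(1)] nrm_sq[OF L(2)]
      by (simp add: ip_linear power2_eq_square mult.assoc)
  qed
  show ?thesis
  proof (cases "nrm f = 0 \<or> nrm h = 0")
    case True
    then show ?thesis using ip_null[of f "P h"] ip_null[of h "P f"] L P_sym[of h f] P_sym[of f h] ip_commute[of f "P h"] ip_commute[of "P f" h] by auto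
  next
    case False
    then have n: "nrm f > 0" "nrm h > 0" using nrm_nonneg L by (auto simp: less_le)
    have "(1 / nrm f)\<^sup>2 * (nrm f)\<^sup>2 = 1" "(1 / nrm h)\<^sup>2 * (nrm h)\<^sup>2 = 1" using n by (simp_all add: power_divide)
    then have "1 / nrm f * (1 / nrm h) * lip M f (P h) \<le> 1" using scaled[of "1 / nrm f" "1 / nrm h"] by simp
    then show ?thesis using n by (simp add: field_simps)
  qed
qed

lemma nrm_le_if_simple_dual:
  assumes w: "w \<in> L2 M" and b: "\<And>s. simple_function M s \<Longrightarrow> s \<in> L2 M \<Longrightarrow> lip M s w \<le> nrm s * K" and K: "K \<ge> 0"
  shows "nrm w \<le> K"
proof -
  have *: "nrm w * nrm w \<le> nrm w * K + \<eta> * (K + nrm w)" if \<eta>: "\<eta> > 0" for \<eta>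
  proof -
    obtain s where s: "simple_function M s" "s \<in> L2 M" "nrm (s - w) \<le> \<eta>" using simple_approx[OF w \<eta>] .
    have "nrm w * nrm w = lip M s w - lip M (s - w) w" using s w nrm_sq[OF w] by (simp add: ip_linear power2_eq_square)
    also have "\<dots> \<le> nrm s * K + nrm (s - w) * nrm w"
      using b[OF s(1,2)] Cauchy_Schwarz[of "s - w" w] s w by auto
    also have "nrm s * K \<le> (nrm w + \<eta>) * K" using nrm_le_diff[of s w] s w K by (intro mult_right_mono) auto
    also have "nrm (s - w) * nrm w \<le> \<eta> * nrm w" using s w by (intro mult_right_mono) auto
    finally show ?thesis by (simp add: algebra_simps)
  qed
  have "nrm w * nrm w \<le> nrm w * K"
  proof (rule field_le_epsilon)
    fix e :: real assume e: "e > 0"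
    have p: "K + nrm w + 1 > 0" using K nrm_nonneg[OF w] by linarith
    have "e / (K + nrm w + 1) * (K + nrm w) \<le> e" using e p by (simp add: field_simps)
    then show "nrm w * nrm w \<le> nrm w * K + e" using *[of "e / (K + nrm w + 1)"] e p by simp
  qed
  then show ?thesis using K nrm_nonneg[OF w] by (cases "nrm w = 0") (auto simp: mult_le_cancel_left)
qed

text \<open>Continuity comes from positivity, symmetry and P 1 = 1. Duality against simple functions
  is used twice: for simple \<open>s\<close> by \<open>lip_P_simple_le\<close>, then for general
  \<open>f\<close> by moving \<open>P\<close> onto the simple test function.\<close>

lemma P_contraction: assumes f: "f \<in> L2 M" shows "nrm (P f) \<le> nrm f"
proof -
  have simple: "nrm (P s) \<le> nrm s" if s: "simple_function M s" "s \<in> L2 M" for s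
    using s lip_P_simple_le by (intro nrm_le_if_simple_dual) auto
  show ?thesis
  proof (rule nrm_le_if_simple_dual)
    fix s assume s: "simple_function M s" "s \<in> L2 M"
    have "lip M s (P f) = lip M (P s) f" using s f by (simp add: P_sym)
    also have "\<dots> \<le> nrm (P s) * nrm f" using Cauchy_Schwarz[of "P s" f] s f by simp
    also have "\<dots> \<le> nrm s * nrm f" using simple[OF s] f by (intro mult_right_mono) auto
    finally show "lip M s (P f) \<le> nrm s * nrm f" .
  qed (use f in auto)
qed

lemma P_bsym: "bsym 1 P" by (simp add: bsym_def P_sym P_contraction)

section \<open>Essential spectrum and coercivity\<close>

definition energy :: "('a \<Rightarrow> real) \<Rightarrow> real" where
  "energy f = lip M f f - lip M (P f) f"

text \<open>For a symmetric operator bijectivity up to null vectors amounts to a bound from below,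
  the form in which the spectrum is used from here on.\<close>

lemma mem_op_spectrum_iff: "l \<in> op_spectrum M P \<longleftrightarrow> \<not> bounded_below (shift P l)"
proof -
  have sh: "(\<lambda>x. P f x - l * f x) = shift P l f" for f by (auto simp: shift_def)
  have sL: "shift P l f \<in> L2 M" if "f \<in> L2 M" for f using that by (simp add: shift_def)
  have "l \<in> op_spectrum M P \<longleftrightarrow> \<not> regular (shift P l)"
    unfolding op_spectrum_def mem_Collect_eq regular_def sh using sL aeq_iff_nrm aeq_0_iff_nrm by (metis (no_types, lifting))
  then show ?thesis using regular_iff_bounded_below[OF bsym_shift[OF P_bsym, of l]] by simp
qed

lemma mem_eigenspace_iff: "f \<in> eigenspace M P l \<longleftrightarrow> f \<in> L2 M \<and> nrm (shift P l f) = 0"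
proof -
  have sh: "(\<lambda>x. P f x - l * f x) = shift P l f" for f by (auto simp: shift_def)
  have sL: "shift P l f \<in> L2 M" if "f \<in> L2 M" for f using that by (simp add: shift_def)
  show ?thesis unfolding eigenspace_def sh using sL aeq_0_iff_nrm by auto
qed

lemma one_in_spectrum: "1 \<in> op_spectrum M P"
proof -
  have "aeq M (P (\<lambda>x. 1)) (\<lambda>x. 1)" using markov by (simp add: markov_operator_def)
  then have "nrm (shift P 1 (\<lambda>x. 1)) = 0" by (simp add: shift_def aeq_iff_nrm)
  moreover have "nrm (\<lambda>x. 1) = 1" by (simp add: nrm_def lip_def prob_space)
  ultimately show ?thesis unfolding mem_op_spectrum_iff bounded_below_def by (metis const_L2 mult.right_neutral not_le)
qed

lemma spectrum_le_1: assumes "l \<in> op_spectrum M P" shows "l \<le> 1"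
proof (rule ccontr)
  assume l: "\<not> l \<le> 1"
  have "(l - 1) * nrm f \<le> nrm (shift P l f)" if f: "f \<in> L2 M" for f
  proof -
    have "l * nrm f = nrm (l *\<^sub>R f)" using f l by (simp add: nrm_scale)
    also have "\<dots> \<le> nrm (shift P l f) + nrm (P f)"
      using nrm_triangle_diff[of "P f" "shift P l f"] f by (simp add: shift_def)
    also have "nrm (P f) \<le> nrm f" using P_contraction[OF f] .
    finally show ?thesis by (simp add: algebra_simps)
  qed
  then have "bounded_below (shift P l)" unfolding bounded_below_def using l by (intro exI[of _ "l - 1"]) auto
  then show False using assms mem_op_spectrum_iff by blast
qed

lemma bounded_below_off_eigenspace:
  assumes e: "e > 0" "\<forall>m\<in>op_spectrum M P. m \<noteq> l \<longrightarrow> e \<le> \<bar>m - l\<bar>"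
    and f: "f \<in> L2 M" "\<And>k. k \<in> eigenspace M P l \<Longrightarrow> lip M f k = 0"
  shows "e * nrm f \<le> nrm (shift P l f)"
proof (rule isolated_imp_bounded_below_off_kernel[OF bsym_shift[OF P_bsym] e(1) _ f(1)])
  fix r :: real assume r: "r \<noteq> 0" "\<bar>r\<bar> < e"
  then have "l + r \<notin> op_spectrum M P" using e(2) by fastforce
  moreover have "shift (shift P l) r = shift P (l + r)" by (auto simp: shift_def algebra_simps)
  ultimately show "bounded_below (shift (shift P l) r)" using mem_op_spectrum_iff by simp
qed (use f in \<open>auto simp: mem_eigenspace_iff\<close>)

lemma eigenspace_orthogonal:
  assumes B: "finite B" "B \<subseteq> L2 M" "\<forall>f\<in>eigenspace M P l. \<exists>c. aeq M f (\<lambda>x. \<Sum>b\<in>B. c b * b x)"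
    and f: "f \<in> L2 M" "\<forall>g\<in>B. lip M f g = 0" and k: "k \<in> eigenspace M P l"
  shows "lip M f k = 0"
proof -
  obtain c where c: "aeq M k (\<lambda>x. \<Sum>b\<in>B. c b * b x)" using B k by blast
  have "(\<lambda>x. \<Sum>b\<in>B. c b * b x) = (\<Sum>b\<in>B. c b *\<^sub>R b)" by (auto simp: sum_fun_apply)
  moreover have kL: "k \<in> L2 M" using k by (simp add: eigenspace_def)
  moreover have sL: "(\<Sum>b\<in>B. c b *\<^sub>R b) \<in> L2 M" using B by (intro S_sum) auto
  ultimately have "lip M k f = lip M (\<Sum>b\<in>B. c b *\<^sub>R b) f" using c f by (intro lip_aeq_cong) auto
  also have "\<dots> = (\<Sum>b\<in>B. c b * lip M b f)" using B f by (subst ip_sum_left) (auto simp: ip_linear subset_iff)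
  also have "\<dots> = 0" using f B ip_commute[OF _ f(1)] by (intro sum.neutral) auto
  finally show ?thesis using ip_commute[OF kL f(1)] by simp
qed

lemma energy_eq: "f \<in> L2 M \<Longrightarrow> energy f = lip M (- shift P 1 f) f"
  by (simp add: energy_def shift_def ip_linear)

lemma energy_nonneg: assumes "f \<in> L2 M" shows "0 \<le> energy f"
proof -
  have "lip M (P f) f \<le> nrm (P f) * nrm f" using Cauchy_Schwarz[of "P f" f] assms by simp
  also have "\<dots> \<le> nrm f * nrm f" using P_contraction[OF assms] assms by (intro mult_right_mono) auto
  finally show ?thesis using nrm_sq[OF assms] by (simp add: energy_def power2_eq_square)
qed

lemma energy_le: assumes "f \<in> L2 M" shows "energy f \<le> 2 * (nrm f)\<^sup>2"
proof -
  have "- lip M (P f) f \<le> nrm (P f) * nrm f" using Cauchy_Schwarz[of "P f" f] assms by simp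
  also have "\<dots> \<le> nrm f * nrm f" using P_contraction[OF assms] assms by (intro mult_right_mono) auto
  finally show ?thesis using nrm_sq[OF assms] by (simp add: energy_def power2_eq_square)
qed

text \<open>The form of 1 - P is nonnegative and its norm is at most 2, so
  \<open>nrm_sq_le_form\<close> applies. This converts bounds from below on P - 1 into coercivity of
  the energy.\<close>

lemma nrm_shift_sq_le_energy: assumes f: "f \<in> L2 M" shows "(nrm (shift P 1 f))\<^sup>2 \<le> 2 * energy f"
proof -
  have G: "bsym 2 (\<lambda>f. - shift P 1 f)" using bsym_shift[OF P_bsym, of 1] by (auto simp: bsym_def nrm_minus ip_linear)
  have "(nrm (- shift P 1 f))\<^sup>2 \<le> 2 * lip M (- shift P 1 f) f"
  proof (rule nrm_sq_le_form[OF G f])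
    fix t
    have "f - t *\<^sub>R - shift P 1 f \<in> L2 M" using f by (simp add: shift_def)
    from energy_nonneg[OF this] energy_eq[OF this]
    show "0 \<le> lip M (- shift P 1 (f - t *\<^sub>R - shift P 1 f)) (f - t *\<^sub>R - shift P 1 f)" by simp
  qed
  then show ?thesis using f energy_eq[OF f] nrm_minus[of "shift P 1 f"] by (simp add: shift_def)
qed

definition coercive_off :: "('a \<Rightarrow> real) set \<Rightarrow> real \<Rightarrow> bool" where
  "coercive_off F \<delta> \<longleftrightarrow> finite F \<and> F \<subseteq> L2 M \<and> 0 < \<delta> \<and>
     (\<forall>f\<in>L2 M. (\<forall>g\<in>F. lip M f g = 0) \<longrightarrow> \<delta> * lip M f f \<le> energy f)"

lemma isolated_imp_coercive_off:
  assumes B: "finite B" "B \<subseteq> L2 M" "\<forall>f\<in>eigenspace M P 1. \<exists>c. aeq M f (\<lambda>x. \<Sum>b\<in>B. c b * b x)"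
    and e: "e > 0" "\<forall>m\<in>op_spectrum M P. m \<noteq> 1 \<longrightarrow> e \<le> \<bar>m - 1\<bar>"
  shows "coercive_off B (e\<^sup>2 / 2)"
  unfolding coercive_off_def
proof (intro conjI ballI impI)
  fix f assume f: "f \<in> L2 M" "\<forall>g\<in>B. lip M f g = 0"
  have "e * nrm f \<le> nrm (shift P 1 f)"
    by (rule bounded_below_off_eigenspace[OF e f(1)]) (rule eigenspace_orthogonal[OF B f])
  then have "(e * nrm f)\<^sup>2 \<le> (nrm (shift P 1 f))\<^sup>2" using e f by (intro power_mono) auto
  also have "\<dots> \<le> 2 * energy f" by (rule nrm_shift_sq_le_energy[OF f(1)])
  finally show "e\<^sup>2 / 2 * lip M f f \<le> energy f" using f by (simp add: power_mult_distrib nrm_sq)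
qed (use assms in auto)

lemma ess_spectrum_le_1: "l \<in> ess_spectrum M P \<Longrightarrow> l \<le> 1"
  using spectrum_le_1 by (auto simp: ess_spectrum_def)

lemma one_discrete_if_lambda_ess_less_1:
  assumes "lambda_ess M P < 1" shows "1 \<in> discrete_spectrum M P"
proof (rule ccontr)
  assume "1 \<notin> discrete_spectrum M P"
  then have "1 \<in> ess_spectrum M P" using one_in_spectrum by (simp add: ess_spectrum_def)
  then have "1 \<le> lambda_ess M P" unfolding lambda_ess_def
    by (rule cSup_upper) (auto intro: bdd_aboveI ess_spectrum_le_1)
  then show False using assms by simp
qed

lemma coercive_off_if_lambda_ess_less_1:
  assumes "lambda_ess M P < 1" shows "\<exists>F \<delta>. coercive_off F \<delta>"
proof -
  have "1 \<in> discrete_spectrum M P" by (rule one_discrete_if_lambda_ess_less_1[OF assms])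
  then show ?thesis unfolding discrete_spectrum_def finite_dim_mod_def using isolated_imp_coercive_off by blast
qed

text \<open>Needed because \<open>lambda_ess\<close> is a \<open>Sup\<close>, about which nothing is
  known on the empty set. At a discrete point P - l would be bounded below off a finite set, which
  the singular value excludes.\<close>

lemma ess_spectrum_nonempty:
  assumes inf: "\<And>F. finite F \<Longrightarrow> F \<subseteq> L2 M \<Longrightarrow> \<exists>f\<in>L2 M. nrm f > 0 \<and> (\<forall>g\<in>F. lip M f g = 0)"
  shows "ess_spectrum M P \<noteq> {}"
proof -
  obtain l where l: "\<And>F c. finite F \<Longrightarrow> F \<subseteq> L2 M \<Longrightarrow> c > 0 \<Longrightarrow>
    \<exists>f\<in>L2 M. nrm f > 0 \<and> (\<forall>g\<in>F. lip M f g = 0) \<and> nrm (shift P l f) < c * nrm f"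
    using exists_singular_value[OF P_bsym inf] by blast
  have "\<not> bounded_below (shift P l)"
  proof
    assume "bounded_below (shift P l)"
    then obtain c where c: "c > 0" "\<forall>f\<in>L2 M. c * nrm f \<le> nrm (shift P l f)" unfolding bounded_below_def by blast
    then show False using l[of "{}" c] by (force simp: not_le[symmetric])
  qed
  moreover have "l \<notin> discrete_spectrum M P"
  proof
    assume "l \<in> discrete_spectrum M P"
    then obtain e B where e: "e > 0" "\<forall>m\<in>op_spectrum M P. m \<noteq> l \<longrightarrow> e \<le> \<bar>m - l\<bar>"
      and B: "finite B" "B \<subseteq> L2 M" "\<forall>f\<in>eigenspace M P l. \<exists>c. aeq M f (\<lambda>x. \<Sum>b\<in>B. c b * b x)"
      unfolding discrete_spectrum_def finite_dim_mod_def by blast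
    obtain f where f: "f \<in> L2 M" "\<forall>g\<in>B. lip M f g = 0" "nrm (shift P l f) < e * nrm f" using l[OF B(1,2) e(1)] by blast
    have "e * nrm f \<le> nrm (shift P l f)"
      by (rule bounded_below_off_eigenspace[OF e f(1)]) (rule eigenspace_orthogonal[OF B f(1,2)])
    then show False using f(3) by simp
  qed
  ultimately show ?thesis using mem_op_spectrum_iff by (auto simp: ess_spectrum_def)
qed

text \<open>By symmetry the eigenspace is the orthogonal complement of the range of P - l; this
  description is linear in \<open>f\<close>, whereas \<open>shift P l\<close> is linear only up to
  null vectors.\<close>

lemma eigenspace_subspace: "subspace (eigenspace M P l)"
proof -
  note D = bsymD[OF bsym_shift[OF P_bsym, of l]]
  have null: "nrm (shift P l f) = 0 \<longleftrightarrow> (\<forall>h\<in>L2 M. lip M f (shift P l h) = 0)" if f: "f \<in> L2 M" for f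
  proof
    assume "nrm (shift P l f) = 0"
    then show "\<forall>h\<in>L2 M. lip M f (shift P l h) = 0" using ip_null[OF D(2)[OF f]] D(3)[OF f] by simp
  next
    assume "\<forall>h\<in>L2 M. lip M f (shift P l h) = 0"
    then have "lip M (shift P l f) (shift P l f) = 0" using D f by simp
    then show "nrm (shift P l f) = 0" by (simp add: nrm_def)
  qed
  have *: "eigenspace M P l = {f\<in>L2 M. \<forall>h\<in>L2 M. lip M f (shift P l h) = 0}"
    using null by (auto simp: mem_eigenspace_iff)
  show ?thesis unfolding * subspace_def using D by (auto simp: ip_linear)
qed

text \<open>Above \<open>1 - \<delta>\<close> there are at most \<open>card F\<close> spectral
  points, so each is isolated. An isolated spectral point has an eigenvector, since otherwise P - l
  is bounded below everywhere; and an eigenvector orthogonal to \<open>F\<close> is null by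
  coercivity, so the eigenspace has finite dimension.\<close>

lemma ess_spectrum_le_if_coercive_off:
  assumes "coercive_off F \<delta>" "l \<in> ess_spectrum M P" shows "l \<le> 1 - \<delta>"
proof (rule ccontr)
  assume l: "\<not> l \<le> 1 - \<delta>"
  have F: "finite F" "F \<subseteq> L2 M" "\<delta> > 0"
    and top: "\<And>f. f \<in> L2 M \<Longrightarrow> (\<forall>g\<in>F. lip M f g = 0) \<Longrightarrow> lip M (P f) f \<le> (1 - \<delta>) * lip M f f"
    using assms(1) by (auto simp: coercive_off_def energy_def algebra_simps)
  have spec: "l \<in> op_spectrum M P" and nd: "l \<notin> discrete_spectrum M P" using assms(2) by (auto simp: ess_spectrum_def)
  define X where "X = op_spectrum M P \<inter> {1 - \<delta><..}"
  have "finite X"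
  proof (rule ccontr)
    assume "infinite X"
    then obtain L where L: "finite L" "card L = Suc (card F)" "L \<subseteq> X" using infinite_arbitrarily_large by blast
    have "card L \<le> card F"
      by (rule card_spectrum_above_le[OF P_bsym F(1,2) top L(1)]) (use L(3) mem_op_spectrum_iff in \<open>auto simp: X_def\<close>)
    then show False using L(2) by simp
  qed
  \<comment> \<open>The distance to \<open>1 - \<delta>\<close> is included because nothing is known
    about the spectrum below that threshold.\<close>
  define e where "e = Min (insert (l - (1 - \<delta>)) ((\<lambda>m. \<bar>m - l\<bar>) ` (X - {l})))"
  have fin: "finite (insert (l - (1 - \<delta>)) ((\<lambda>m. \<bar>m - l\<bar>) ` (X - {l})))" using \<open>finite X\<close> by simp
  have e0: "e > 0" unfolding e_def using l fin by (subst Min_gr_iff) auto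
  have el: "e \<le> l - (1 - \<delta>)" unfolding e_def using fin by (rule Min_le) simp
  have eX: "e \<le> \<bar>m - l\<bar>" if "m \<in> X" "m \<noteq> l" for m unfolding e_def using fin by (rule Min_le) (use that in auto)
  have iso: "\<forall>m\<in>op_spectrum M P. m \<noteq> l \<longrightarrow> e \<le> \<bar>m - l\<bar>"
  proof (intro ballI impI)
    fix m assume m: "m \<in> op_spectrum M P" "m \<noteq> l"
    show "e \<le> \<bar>m - l\<bar>" using eX[of m] el m by (cases "m > 1 - \<delta>") (auto simp: X_def)
  qed
  have "\<exists>f\<in>eigenspace M P l. \<not> aeq M f (\<lambda>x. 0)"
  proof (rule ccontr)
    assume "\<not> ?thesis"
    then have null: "nrm k = 0" "k \<in> L2 M" if "k \<in> eigenspace M P l" for k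
      using that aeq_0_iff_nrm by (auto simp: mem_eigenspace_iff)
    have "e * nrm f \<le> nrm (shift P l f)" if f: "f \<in> L2 M" for f
      by (rule bounded_below_off_eigenspace[OF e0 iso f]) (use null ip_null ip_commute f in metis)
    then have "bounded_below (shift P l)" unfolding bounded_below_def using e0 by blast
    then show False using spec mem_op_spectrum_iff by blast
  qed
  moreover have "finite_dim_mod M (eigenspace M P l)"
  proof -
    have "\<exists>B. finite B \<and> B \<subseteq> eigenspace M P l \<and> (\<forall>f\<in>eigenspace M P l. \<exists>c. nrm (f - (\<Sum>b\<in>B. c b *\<^sub>R b)) = 0)"
    proof (rule finite_dim_if_orthogonal_null[OF F(1,2) eigenspace_subspace])
      fix f assume f: "f \<in> eigenspace M P l" "\<forall>g\<in>F. lip M f g = 0"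
      then have fL: "f \<in> L2 M" and n: "nrm (shift P l f) = 0" by (auto simp: mem_eigenspace_iff)
      have "lip M (shift P l f) f = 0" using fL n by (intro ip_null) (auto simp: shift_def)
      then have "lip M (P f) f = l * lip M f f" using fL by (simp add: shift_def ip_linear)
      then have "(l - (1 - \<delta>)) * lip M f f \<le> 0" using top[OF fL f(2)] by (simp add: algebra_simps)
      then have "lip M f f \<le> 0" using l by (simp add: mult_le_0_iff)
      then show "nrm f = 0" using ip_nonneg[OF fL] by (simp add: nrm_def)
    qed (auto simp: mem_eigenspace_iff)
    then obtain B where B: "finite B" "B \<subseteq> eigenspace M P l" "\<And>f. f \<in> eigenspace M P l \<Longrightarrow> \<exists>c. nrm (f - (\<Sum>b\<in>B. c b *\<^sub>R b)) = 0" by blast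
    have BL: "B \<subseteq> L2 M" using B by (auto simp: mem_eigenspace_iff)
    have "\<exists>c. aeq M f (\<lambda>x. \<Sum>b\<in>B. c b * b x)" if f: "f \<in> eigenspace M P l" for f
    proof -
      obtain c where c: "nrm (f - (\<Sum>b\<in>B. c b *\<^sub>R b)) = 0" using B(3)[OF f] by blast
      have "(\<lambda>x. \<Sum>b\<in>B. c b * b x) = (\<Sum>b\<in>B. c b *\<^sub>R b)" by (auto simp: sum_fun_apply)
      moreover have "(\<Sum>b\<in>B. c b *\<^sub>R b) \<in> L2 M" using BL by (intro S_sum) auto
      ultimately show ?thesis using c f aeq_iff_nrm by (intro exI[of _ c]) (auto simp: mem_eigenspace_iff)
    qed
    then show ?thesis unfolding finite_dim_mod_def using B(1) BL by blast
  qed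
  ultimately have "l \<in> discrete_spectrum M P" unfolding discrete_spectrum_def using spec e0 iso by blast
  then show False using nd by simp
qed

section \<open>Isoperimetric constants\<close>

lemma inf_dim_orthogonal:
  assumes "inf_dim_L2 M" and F: "finite F" "F \<subseteq> L2 M"
  shows "\<exists>f\<in>L2 M. nrm f > 0 \<and> (\<forall>g\<in>F. lip M f g = 0)"
proof -
  define n where "n = Suc (card F)"
  obtain fs :: "nat \<Rightarrow> 'a \<Rightarrow> real" where fs: "\<And>i. i < n \<Longrightarrow> fs i \<in> L2 M"
    "\<And>c. aeq M (\<lambda>x. \<Sum>i<n. c i * fs i x) (\<lambda>x. 0) \<Longrightarrow> \<forall>i<n. c i = 0"
    using assms(1) unfolding inf_dim_L2_def by blast
  obtain c where c: "\<exists>j\<in>{..<n}. c j \<noteq> 0" "\<forall>g\<in>F. (\<Sum>j\<in>{..<n}. lip M (fs j) g * c j) = 0"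
    using homogeneous_system_nontrivial[OF F(1), of "{..<n}" "\<lambda>g j. lip M (fs j) g"] by (auto simp: n_def)
  define f where "f = (\<Sum>i<n. c i *\<^sub>R fs i)"
  have f: "f \<in> L2 M" unfolding f_def using fs by (intro S_sum) auto
  have feq: "(\<lambda>x. \<Sum>i<n. c i * fs i x) = f" by (auto simp: f_def sum_fun_apply)
  have "nrm f \<noteq> 0" using fs(2)[of c] c(1) aeq_0_iff_nrm[OF f] by (auto simp: feq)
  then have "nrm f > 0" using nrm_nonneg[OF f] by (simp add: less_le)
  moreover have "lip M f g = 0" if "g \<in> F" for g
    using c(2) that fs F unfolding f_def by (subst ip_sum_left) (auto simp: ip_linear subset_iff mult.commute)
  ultimately show ?thesis using f by blast
qed

definition ratio :: "'a set \<Rightarrow> real" where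
  "ratio A = (\<integral>x. indicator A x * P (indicator (space M - A)) x \<partial>M) / measure M A"

text \<open>By P 1 = 1, pairing \<open>indicator A\<close> with P of the complement gives <1_A, 1> -
  <1_A, P 1_A>, which is the energy of the indicator.\<close>

lemma ratio_eq_energy: assumes A: "A \<in> sets M" shows "ratio A = energy (indicator A) / measure M A"
proof -
  have A': "space M - A \<in> sets M" using A by simp
  have "(\<integral>x. indicator A x * P (indicator (space M - A)) x \<partial>M) = lip M (P (indicator A)) (indicator (space M - A))"
    using A A' by (simp add: P_sym) (simp add: lip_def)
  also have "\<dots> = lip M (P (indicator A)) ((\<lambda>x. 1) - indicator A)"
    by (intro lip_cong_space) (auto simp: indicator_def)
  also have "\<dots> = lip M (indicator A) (P (\<lambda>x. 1)) - lip M (P (indicator A)) (indicator A)"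
    using A by (simp add: ip_linear P_sym)
  also have "lip M (indicator A) (P (\<lambda>x. 1)) = lip M (indicator A) (indicator A)"
    using A by (simp add: lip_P_const_1 lip_indicator)
  finally show ?thesis by (simp add: ratio_def energy_def)
qed

lemma ratio_nonneg: "A \<in> sets M \<Longrightarrow> 0 \<le> ratio A"
  by (simp add: ratio_eq_energy energy_nonneg)

lemma ratio_le_2: assumes "A \<in> sets M" "measure M A > 0" shows "ratio A \<le> 2"
  using energy_le[of "indicator A"] assms lip_indicator[OF assms(1), of A]
  by (simp add: ratio_eq_energy nrm_sq field_simps)

lemma kappa_eq: "kappa M P n = Inf ((\<lambda>A. Max ((\<lambda>k. ratio (A k)) ` {1..n})) ` D M n)"
  by (simp add: kappa_def ratio_def)

lemma kappa_le:
  assumes "A \<in> D M n" "n \<ge> 1" "\<And>k. k \<in> {1..n} \<Longrightarrow> ratio (A k) \<le> r"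
  shows "kappa M P n \<le> r"
proof -
  have "kappa M P n \<le> Max ((\<lambda>k. ratio (A k)) ` {1..n})" unfolding kappa_eq
  proof (rule cInf_lower)
    show "bdd_below ((\<lambda>A. Max ((\<lambda>k. ratio (A k)) ` {1..n})) ` D M n)"
    proof (rule bdd_belowI2[of _ 0])
      fix A assume "A \<in> D M n"
      then have "0 \<le> ratio (A 1)" using assms(2) by (intro ratio_nonneg) (auto simp: D_def)
      also have "\<dots> \<le> Max ((\<lambda>k. ratio (A k)) ` {1..n})" using assms(2) by (intro Max_ge) auto
      finally show "0 \<le> Max ((\<lambda>k. ratio (A k)) ` {1..n})" .
    qed
  qed (use assms in auto)
  also have "\<dots> \<le> r" using assms(2,3) by (subst Max_le_iff) auto
  finally show ?thesis .
qed

lemma le_kappa: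
  assumes "D M n \<noteq> {}" "n \<ge> 1" "\<And>A. A \<in> D M n \<Longrightarrow> \<exists>k\<in>{1..n}. r \<le> ratio (A k)"
  shows "r \<le> kappa M P n"
  unfolding kappa_eq
proof (rule cInf_greatest)
  fix x assume "x \<in> (\<lambda>A. Max ((\<lambda>k. ratio (A k)) ` {1..n})) ` D M n"
  then obtain A where A: "A \<in> D M n" "x = Max ((\<lambda>k. ratio (A k)) ` {1..n})" by auto
  obtain k where k: "k \<in> {1..n}" "r \<le> ratio (A k)" using assms(3)[OF A(1)] by blast
  note k(2) also have "ratio (A k) \<le> x" unfolding A using k by (intro Max_ge) auto
  finally show "r \<le> x" .
qed (use assms in simp)

lemma kappa_le_2: assumes "D M n \<noteq> {}" "n \<ge> 1" shows "kappa M P n \<le> 2"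
proof -
  obtain A where A: "A \<in> D M n" using assms by blast
  show ?thesis by (rule kappa_le[OF A assms(2)]) (use A in \<open>auto simp: D_def intro: ratio_le_2\<close>)
qed

lemma kappa_Suc: assumes "D M (Suc n) \<noteq> {}" "n \<ge> 1" shows "kappa M P n \<le> kappa M P (Suc n)"
proof (rule le_kappa[OF assms(1)])
  fix A assume A: "A \<in> D M (Suc n)"
  then have A': "A \<in> D M n" by (auto simp: D_def disjoint_family_on_def)
  show "\<exists>k\<in>{1..Suc n}. kappa M P n \<le> ratio (A k)"
  proof (rule ccontr)
    assume neg: "\<not> ?thesis"
    have "Max ((\<lambda>k. ratio (A k)) ` {1..n}) \<in> (\<lambda>k. ratio (A k)) ` {1..n}" using assms(2) by (intro Max_in) auto
    then obtain k where k: "k \<in> {1..n}" "Max ((\<lambda>k. ratio (A k)) ` {1..n}) = ratio (A k)" by auto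
    have "kappa M P n \<le> ratio (A k)"
    proof (rule kappa_le[OF A' assms(2)])
      fix j assume "j \<in> {1..n}"
      then show "ratio (A j) \<le> ratio (A k)" unfolding k(2)[symmetric] by (intro Max_ge) auto
    qed
    then show False using neg k(1) by auto
  qed
qed simp

lemma energy_scale: "f \<in> L2 M \<Longrightarrow> energy (a *\<^sub>R f) = a\<^sup>2 * energy f"
proof -
  assume f: "f \<in> L2 M"
  have "lip M (P (a *\<^sub>R f)) (a *\<^sub>R f) = a * (a * lip M (P f) f)" using f by (simp add: P_sym ip_linear)
  then show ?thesis using f unfolding energy_def by (simp only:) (simp add: ip_linear power2_eq_square algebra_simps)
qed

text \<open>Nonnegativity of the energy of g - h bounds twice the mixed term by the sum of the two
  energies.\<close>

lemma energy_sum_le: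
  assumes I: "finite I" and f: "\<And>i. i \<in> I \<Longrightarrow> f i \<in> L2 M"
  shows "energy (\<Sum>i\<in>I. f i) \<le> card I * (\<Sum>i\<in>I. energy (f i))"
proof -
  let ?e = "\<lambda>g h. lip M g h - lip M (P g) h"
  have two: "2 * ?e g h \<le> energy g + energy h" if "g \<in> L2 M" "h \<in> L2 M" for g h
  proof -
    have "lip M (P (g - h)) (g - h) = lip M (P g) g - 2 * lip M (P g) h + lip M (P h) h"
      using that ip_commute[of "P h" g] by (simp add: P_sym ip_linear)
    then show ?thesis using energy_nonneg[of "g - h"] that ip_commute[of g h] by (simp add: energy_def ip_linear)
  qed
  have sumL: "(\<Sum>i\<in>I. f i) \<in> L2 M" using f by (rule S_sum)
  have "energy (\<Sum>i\<in>I. f i) = (\<Sum>i\<in>I. \<Sum>j\<in>I. ?e (f i) (f j))"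
  proof -
    have 1: "lip M (P (\<Sum>i\<in>I. f i)) h = (\<Sum>i\<in>I. lip M (P (f i)) h)" if "h \<in> L2 M" for h
    proof -
      have "lip M (P (\<Sum>i\<in>I. f i)) h = (\<Sum>i\<in>I. lip M (f i) (P h))" using that f sumL by (simp add: P_sym ip_sum_left)
      then show ?thesis using that f by (simp add: P_sym)
    qed
    show ?thesis using f sumL by (simp add: energy_def 1 ip_sum_left ip_sum_right sum_subtractf
        sum.swap[of "\<lambda>i j. lip M (f j) (f i)"] sum.swap[of "\<lambda>i j. lip M (P (f j)) (f i)"])
  qed
  also have "\<dots> \<le> (\<Sum>i\<in>I. \<Sum>j\<in>I. (energy (f i) + energy (f j)) / 2)"
    using two f by (intro sum_mono) (simp add: algebra_simps)
  also have "\<dots> = card I * (\<Sum>i\<in>I. energy (f i))"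
    by (simp add: sum.distrib sum_divide_distrib[symmetric] sum_distrib_left[symmetric])
  finally show ?thesis .
qed

text \<open>The bound is \<open>\<delta> / n\<close> with \<open>n = Suc (card F)\<close>: the
  combination \<open>f\<close> of normalised indicators has squared norm \<Sum> c_k^2 and energy at
  most n \<Sum> c_k^2 \<open>ratio (A k)\<close>, so not all ratios can be below
  \<open>\<delta> / n\<close>.\<close>

lemma kappa_pos_if_coercive_off:
  assumes co: "coercive_off F \<delta>" and D: "D M (Suc (card F)) \<noteq> {}"
  shows "0 < kappa M P (Suc (card F))"
proof -
  define n where "n = Suc (card F)"
  have F: "finite F" "F \<subseteq> L2 M" "\<delta> > 0"
    and low: "\<And>f. f \<in> L2 M \<Longrightarrow> (\<forall>g\<in>F. lip M f g = 0) \<Longrightarrow> \<delta> * lip M f f \<le> energy f"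
    using co by (auto simp: coercive_off_def)
  have "\<delta> / n \<le> kappa M P n"
  proof (rule le_kappa)
    fix A assume A: "A \<in> D M n"
    then have As: "\<And>k. k \<in> {1..n} \<Longrightarrow> A k \<in> sets M" "\<And>k. k \<in> {1..n} \<Longrightarrow> measure M (A k) > 0"
      and disj: "\<And>j k. j \<in> {1..n} \<Longrightarrow> k \<in> {1..n} \<Longrightarrow> j \<noteq> k \<Longrightarrow> A j \<inter> A k = {}"
      by (auto simp: D_def disjoint_family_on_def)
    define h where "h = (\<lambda>k. (1 / sqrt (measure M (A k))) *\<^sub>R (indicator (A k) :: 'a \<Rightarrow> real))"
    have hL: "h k \<in> L2 M" if "k \<in> {1..n}" for k using As(1)[OF that] by (simp add: h_def)
    have hip: "lip M (h j) (h k) = of_bool (j = k)" if jk: "j \<in> {1..n}" "k \<in> {1..n}" for j k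
    proof (cases "j = k")
      case True
      then show ?thesis using As(1,2)[OF jk(1)] sets.sets_into_space[OF As(1)[OF jk(1)]]
        by (simp add: h_def ip_linear lip_indicator Int_absorb2)
    next
      case False
      then show ?thesis using As jk disj[OF jk False] by (simp add: h_def ip_linear lip_indicator)
    qed
    have hE: "energy (h k) = ratio (A k)" if k: "k \<in> {1..n}" for k
      using As[OF k] by (simp add: h_def energy_scale ratio_eq_energy power_divide)
    obtain c where c: "\<exists>j\<in>{1..n}. c j \<noteq> 0" "\<forall>g\<in>F. (\<Sum>j\<in>{1..n}. lip M (h j) g * c j) = 0"
      using homogeneous_system_nontrivial[OF F(1), of "{1..n}" "\<lambda>g j. lip M (h j) g"] by (auto simp: n_def)
    define f where "f = (\<Sum>k\<in>{1..n}. c k *\<^sub>R h k)"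
    have f: "f \<in> L2 M" unfolding f_def using hL by (intro S_sum) auto
    have "lip M f g = 0" if "g \<in> F" for g
      using c(2) that hL F unfolding f_def by (subst ip_sum_left) (auto simp: ip_linear subset_iff mult.commute)
    then have 1: "\<delta> * lip M f f \<le> energy f" using low[OF f] by blast
    have fk: "lip M f (h k) = c k" if "k \<in> {1..n}" for k
    proof -
      have "lip M f (h k) = (\<Sum>j\<in>{1..n}. c j * lip M (h j) (h k))"
        unfolding f_def using hL that by (subst ip_sum_left) (auto simp: ip_linear)
      also have "\<dots> = (\<Sum>j\<in>{1..n}. if j = k then c j else 0)" using hip that by (intro sum.cong) auto
      finally show ?thesis using that by simp
    qed
    have ff: "lip M f f = (\<Sum>k\<in>{1..n}. (c k)\<^sup>2)"
    proof -
      have "lip M f f = (\<Sum>k\<in>{1..n}. c k * lip M f (h k))"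
        using f hL by (subst (2) f_def, subst ip_sum_right) (auto simp: ip_linear)
      then show ?thesis using fk by (simp add: power2_eq_square)
    qed
    have "energy f \<le> n * (\<Sum>k\<in>{1..n}. energy (c k *\<^sub>R h k))"
      using energy_sum_le[of "{1..n}" "\<lambda>k. c k *\<^sub>R h k"] hL by (simp add: f_def)
    also have "\<dots> = n * (\<Sum>k\<in>{1..n}. (c k)\<^sup>2 * ratio (A k))" using hL hE by (simp add: energy_scale)
    finally have 2: "energy f \<le> n * (\<Sum>k\<in>{1..n}. (c k)\<^sup>2 * ratio (A k))" .
    show "\<exists>k\<in>{1..n}. \<delta> / n \<le> ratio (A k)"
    proof (rule ccontr)
      assume "\<not> ?thesis"
      then have lt: "ratio (A k) < \<delta> / n" if "k \<in> {1..n}" for k using that by (auto simp: not_le)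
      obtain j where j: "j \<in> {1..n}" "c j \<noteq> 0" using c(1) by blast
      have "(\<Sum>k\<in>{1..n}. (c k)\<^sup>2 * ratio (A k)) < (\<Sum>k\<in>{1..n}. (c k)\<^sup>2 * (\<delta> / n))"
      proof (rule sum_strict_mono_ex1)
        show "\<forall>k\<in>{1..n}. (c k)\<^sup>2 * ratio (A k) \<le> (c k)\<^sup>2 * (\<delta> / n)" by (intro ballI mult_left_mono[OF less_imp_le[OF lt]]) auto
        show "\<exists>k\<in>{1..n}. (c k)\<^sup>2 * ratio (A k) < (c k)\<^sup>2 * (\<delta> / n)" using j lt by (intro bexI[of _ j] mult_strict_left_mono) auto
      qed simp
      also have "\<dots> = \<delta> / n * lip M f f" by (simp add: ff sum_distrib_left mult.commute)
      finally have "n * (\<Sum>k\<in>{1..n}. (c k)\<^sup>2 * ratio (A k)) < \<delta> * lip M f f"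
        by (simp add: n_def field_simps)
      then show False using 1 2 by simp
    qed
  qed (use D in \<open>auto simp: n_def\<close>)
  moreover have "\<delta> / n > 0" using F by (simp add: n_def)
  ultimately show ?thesis by (simp add: n_def)
qed

section \<open>From orthonormal functions of small energy to disjoint sets of small ratio\<close>

lemma energy_simple:
  assumes F: "simple_function M F"
  shows "energy (\<lambda>x. \<phi> (F x)) = (\<Sum>v\<in>F ` space M. \<Sum>w\<in>F ` space M. J F v w * (\<phi> v - \<phi> w)\<^sup>2) / 2"
proof -
  let ?V = "F ` space M"
  have 1: "lip M (\<lambda>x. \<phi> (F x)) (\<lambda>x. \<phi> (F x)) = (\<Sum>v\<in>?V. \<Sum>w\<in>?V. J F v w * (\<phi> v)\<^sup>2)"
    using lip_simple[OF F, of \<phi> \<phi>] by (simp add: sum_distrib_left power2_eq_square mult_ac)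
  have 2: "(\<Sum>v\<in>?V. \<Sum>w\<in>?V. J F v w * (\<phi> v)\<^sup>2) = (\<Sum>v\<in>?V. \<Sum>w\<in>?V. J F v w * (\<phi> w)\<^sup>2)"
    by (subst sum.swap) (simp add: J_commute[OF F] cong: sum.cong)
  have 3: "lip M (P (\<lambda>x. \<phi> (F x))) (\<lambda>x. \<phi> (F x)) = (\<Sum>v\<in>?V. \<Sum>w\<in>?V. J F v w * (\<phi> v * \<phi> w))"
    using lip_P_simple[OF F, of \<phi> \<phi>] F by (simp add: P_sym mult_ac)
  have "(\<Sum>v\<in>?V. \<Sum>w\<in>?V. J F v w * (\<phi> v - \<phi> w)\<^sup>2) =
    (\<Sum>v\<in>?V. \<Sum>w\<in>?V. J F v w * (\<phi> v)\<^sup>2) + (\<Sum>v\<in>?V. \<Sum>w\<in>?V. J F v w * (\<phi> w)\<^sup>2) - 2 * (\<Sum>v\<in>?V. \<Sum>w\<in>?V. J F v w * (\<phi> v * \<phi> w))"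
    by (simp add: power2_diff sum.distrib sum_subtractf sum_distrib_left algebra_simps)
  then show ?thesis using 1 2 3 by (simp add: energy_def)
qed

text \<open>The constant is 4 + 2: the cross term 2 <f - P f, d> costs at most
  \<open>4 * \<eta>\<close>, and the energy of the difference \<open>d\<close> at most
  \<open>2 * \<eta>\<close>, as \<open>\<eta> \<le> 1\<close>.\<close>

lemma energy_perturb:
  assumes f: "f \<in> L2 M" and s: "s \<in> L2 M" and e: "nrm (s - f) \<le> \<eta>" "\<eta> \<le> 1" "nrm f = 1"
  shows "energy s \<le> energy f + 6 * \<eta>"
proof -
  define d where "d = s - f"
  have d: "d \<in> L2 M" "nrm d \<le> \<eta>" "s = f + d" using f s e by (auto simp: d_def)
  have \<eta>0: "0 \<le> \<eta>" using nrm_nonneg[OF d(1)] d(2) by linarith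
  have "lip M (P s) s = lip M (P f) f + 2 * lip M (P f) d + lip M (P d) d"
    using f d(1) ip_commute[of "P d" f] unfolding d(3) by (simp add: P_sym ip_linear)
  then have eq: "energy s = energy f + 2 * lip M (f - P f) d + energy d"
    using f d(1) ip_commute[of f d] unfolding d(3) by (simp add: energy_def ip_linear)
  have "lip M (f - P f) d \<le> nrm (f - P f) * nrm d" using Cauchy_Schwarz[of "f - P f" d] f d by simp
  also have "\<dots> \<le> 2 * \<eta>"
    using nrm_triangle_diff[of f "P f"] P_contraction[OF f] f d e \<eta>0 by (intro mult_mono) auto
  finally have 1: "lip M (f - P f) d \<le> 2 * \<eta>" .
  have "energy d \<le> 2 * (nrm d)\<^sup>2" by (rule energy_le[OF d(1)])
  also have "\<dots> \<le> 2 * (\<eta> * 1)" 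
    using mult_mono[of "nrm d" \<eta> "nrm d" 1] d(2) e(2) \<eta>0 nrm_nonneg[OF d(1)] by (simp add: power2_eq_square)
  finally show ?thesis using eq 1 by simp
qed

text \<open>The factor is 131072 = 2 * 4 * 16384. Half of the energy budget of each function is left
  to the approximation, and the 2 n functions, each with its energy counted twice over ordered
  pairs, give 4 n.\<close>

definition cluster_bound :: "nat \<Rightarrow> real" where
  "cluster_bound n = 131072 * real n * cell_bound (2 * n)"

lemma cluster_bound_pos: "n \<ge> 1 \<Longrightarrow> cluster_bound n > 0"
  by (simp add: cluster_bound_def cell_bound_def add_pos_nonneg)

text \<open>The approximating simple functions are the coordinates of a map \<open>F\<close> into
  R^N. Orthonormality becomes near isotropy of the image mass, the sum of the energies becomes the
  energy of the graph, and disjoint sets of vertices are pulled back along \<open>F\<close>.\<close>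

lemma clusters_from_orthonormal:
  assumes n: "n \<ge> 1" and \<epsilon>: "\<epsilon> > 0"
    and f: "\<And>i. i < 2 * n \<Longrightarrow> f i \<in> L2 M" "\<And>i. i < 2 * n \<Longrightarrow> nrm (f i) = 1"
      "\<And>i j. i < 2 * n \<Longrightarrow> j < 2 * n \<Longrightarrow> i \<noteq> j \<Longrightarrow> lip M (f i) (f j) = 0"
    and E: "\<And>i. i < 2 * n \<Longrightarrow> energy (f i) \<le> \<epsilon>\<^sup>2 / cluster_bound n"
  shows "\<exists>A\<in>D M n. \<forall>k\<in>{1..n}. ratio (A k) \<le> 2 * \<epsilon>"
proof -
  define N where "N = 2 * n"
  define \<delta> where "\<delta> = \<epsilon>\<^sup>2 / (65536 * n * cell_bound N)"
  have cb: "cell_bound N > 0" by (simp add: cell_bound_def add_pos_nonneg)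
  have \<delta>: "\<delta> > 0" using \<epsilon> n cb by (simp add: \<delta>_def)
  have E': "energy (f i) \<le> \<delta> / 2" if "i < N" for i using E[of i] that by (simp add: N_def \<delta>_def cluster_bound_def field_simps)
  \<comment> \<open>The first entry gives norms at most 21/20 in every unit direction, and (21/20)^2
    \<le> 9/8; the second makes the energy loss \<open>6 * \<eta>\<close> at most
    \<open>\<delta> / 2\<close>.\<close>
  define \<eta> where "\<eta> = min (1 / (20 * N)) (\<delta> / 12)"
  have N1: "real N \<ge> 2" using n by (simp add: N_def)
  have \<eta>: "\<eta> > 0" "N * \<eta> \<le> 1 / 20" "\<eta> \<le> \<delta> / 12"
  proof -
    show "\<eta> > 0" using N1 \<delta> by (simp add: \<eta>_def)
    have "N * \<eta> \<le> N * (1 / (20 * N))" by (intro mult_left_mono) (auto simp: \<eta>_def)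
    then show "N * \<eta> \<le> 1 / 20" using N1 by simp
  qed (simp add: \<eta>_def)
  have "2 * \<eta> \<le> N * \<eta>" using N1 \<eta>(1) by (intro mult_right_mono) auto
  then have \<eta>1: "\<eta> \<le> 1 / 40" using \<eta>(2) by linarith
  have "\<exists>s. simple_function M s \<and> s \<in> L2 M \<and> nrm (s - f i) \<le> \<eta>" if "i < N" for i
    using simple_approx[OF f(1) \<eta>(1)] that unfolding N_def by metis
  then obtain s where s: "\<And>i. i < N \<Longrightarrow> simple_function M (s i)" "\<And>i. i < N \<Longrightarrow> s i \<in> L2 M"
    "\<And>i. i < N \<Longrightarrow> nrm (s i - f i) \<le> \<eta>" by metis
  have fN: "f i \<in> L2 M" "nrm (f i) = 1" if "i < N" for i using f that by (auto simp: N_def)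
  have fo: "lip M (f i) (f j) = of_bool (i = j)" if "i < N" "j < N" for i j
    using f(3)[of i j] nrm_sq[OF fN(1)[OF that(1)]] fN(2)[OF that(1)] that by (cases "i = j") (auto simp: N_def)
  have sE: "energy (s i) \<le> \<delta>" if "i < N" for i
    using energy_perturb[OF fN(1)[OF that] s(2)[OF that] s(3)[OF that] _ fN(2)[OF that]] \<eta>1 \<eta>(3) E'[OF that] by simp
  \<comment> \<open>Restricting to the indices below \<open>N\<close> makes the values extensional,
    so that \<open>F\<close> has a finite image.\<close>
  define F where "F = (\<lambda>x. \<lambda>i\<in>{..<N}. s i x)"
  define V where "V = F ` space M"
  have F: "simple_function M F" unfolding simple_function_def
  proof (intro conjI ballI)
    have "F ` space M \<subseteq> PiE {..<N} (\<lambda>i. s i ` space M)" unfolding F_def by (rule image_subsetI) (simp add: restrict_PiE_iff)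
    moreover have "finite (PiE {..<N} (\<lambda>i. s i ` space M))" using s(1) by (intro finite_PiE) (auto dest: simple_functionD(1))
    ultimately show "finite (F ` space M)" by (rule finite_subset)
    fix v assume "v \<in> F ` space M"
    then obtain y where v: "v = F y" by auto
    have "F x = v \<longleftrightarrow> (\<forall>i\<in>{..<N}. s i x = v i)" for x
      unfolding v F_def by (auto simp: fun_eq_iff restrict_def)
    then have "F -` {v} \<inter> space M = {x\<in>space M. \<forall>i\<in>{..<N}. s i x = v i}" by auto
    also have "\<dots> \<in> sets M"
    proof (rule sets.sets_Collect_finite_All)
      fix i assume "i \<in> {..<N}"
      then have "s i -` {v i} \<inter> space M \<in> sets M" using s(1) by (auto dest: simple_functionD(2))
      moreover have "s i -` {v i} \<inter> space M = {x\<in>space M. s i x = v i}" by auto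
      ultimately show "{x\<in>space M. s i x = v i} \<in> sets M" by simp
    qed simp
    finally show "F -` {v} \<inter> space M \<in> sets M" .
  qed
  have V: "finite V" unfolding V_def using simple_functionD(1)[OF F] .
  define m where "m = (\<lambda>v. \<Sum>w\<in>V. J F v w)"
  have Fi: "(\<lambda>x. F x i) = s i" if "i < N" for i using that by (auto simp: F_def)
  have mass: "lip M (\<lambda>x. \<phi> (F x)) (\<lambda>x. \<phi> (F x)) = (\<Sum>v\<in>V. m v * (\<phi> v)\<^sup>2)" for \<phi>
    using lip_simple[OF F, of \<phi> \<phi>] by (simp add: V_def m_def power2_eq_square mult_ac)
  have en: "(\<Sum>v\<in>V. \<Sum>w\<in>V. J F v w * (\<phi> v - \<phi> w)\<^sup>2) = 2 * energy (\<lambda>x. \<phi> (F x))" for \<phi>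
    using energy_simple[OF F, of \<phi>] by (simp add: V_def)
  have iso: "(\<Sum>x\<in>V. m x * (dot N x a)\<^sup>2) \<le> 9 / 8" if a: "dot N a a = 1" for a
  proof -
    have a1: "\<bar>a i\<bar> \<le> 1" if "i < N" for i
    proof -
      have "a i * a i \<le> dot N a a" unfolding dot_def using that by (intro member_le_sum) auto
      then show ?thesis using a by (simp add: abs_square_le_1[symmetric] power2_eq_square)
    qed
    define g where "g = (\<Sum>i<N. a i *\<^sub>R s i)"
    define g' where "g' = (\<Sum>i<N. a i *\<^sub>R f i)"
    have gL: "g \<in> L2 M" "g' \<in> L2 M" unfolding g_def g'_def using s fN by (auto intro!: S_sum)
    have "lip M g' g' = (\<Sum>i<N. a i * (\<Sum>j<N. a j * lip M (f i) (f j)))"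
    proof -
      have "lip M g' g' = (\<Sum>i<N. a i * lip M (f i) g')"
        using fN gL by (subst (1) g'_def, subst ip_sum_left) (auto simp: ip_linear)
      also have "\<dots> = (\<Sum>i<N. a i * (\<Sum>j<N. a j * lip M (f i) (f j)))"
      proof (rule sum.cong[OF refl])
        fix i assume "i \<in> {..<N}"
        then have "lip M (f i) g' = (\<Sum>j<N. a j * lip M (f i) (f j))"
          unfolding g'_def using fN by (subst ip_sum_right) (auto simp: ip_linear)
        then show "a i * lip M (f i) g' = a i * (\<Sum>j<N. a j * lip M (f i) (f j))" by simp
      qed
      finally show ?thesis .
    qed
    also have "\<dots> = (\<Sum>i<N. a i * (\<Sum>j<N. if i = j then a j else 0))" using fo by (intro sum.cong arg_cong2[where f = "(*)"]) auto
    also have "\<dots> = 1" using a by (simp add: dot_def)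
    finally have g'1: "nrm g' = 1" by (simp add: nrm_def)
    have diff: "g - g' = (\<Sum>i<N. a i *\<^sub>R (s i - f i))" by (simp add: g_def g'_def sum_subtractf scaleR_diff_right)
    have "nrm (g - g') \<le> (\<Sum>i<N. nrm (a i *\<^sub>R (s i - f i)))"
      unfolding diff by (rule nrm_sum) (use s fN in auto)
    also have "\<dots> \<le> (\<Sum>i<N. 1 * \<eta>)"
    proof (rule sum_mono)
      fix i assume "i \<in> {..<N}"
      then have i: "i < N" "s i - f i \<in> L2 M" using s fN by auto
      have "\<bar>a i\<bar> * nrm (s i - f i) \<le> 1 * \<eta>" using a1[OF i(1)] s(3)[OF i(1)] i(2) by (intro mult_mono) auto
      then show "nrm (a i *\<^sub>R (s i - f i)) \<le> 1 * \<eta>" using nrm_scale[OF i(2)] by simp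
    qed
    also have "\<dots> \<le> 1 / 20" using \<eta>(2) by simp
    finally have "nrm g \<le> 21 / 20" using nrm_le_diff[OF gL] g'1 by simp
    then have "(nrm g)\<^sup>2 \<le> (21 / 20)\<^sup>2" using gL by (intro power_mono) auto
    moreover have "lip M (\<lambda>x. dot N (F x) a) (\<lambda>x. dot N (F x) a) = lip M g g"
      by (intro lip_cong_space) (auto simp: dot_def F_def g_def sum_fun_apply mult.commute)
    ultimately show ?thesis using mass[of "\<lambda>v. dot N v a"] nrm_sq[OF gL(1)] by (simp add: power_divide)
  qed
  have tot: "real N - 1 \<le> (\<Sum>x\<in>V. m x * dot N x x)"
  proof -
    have "(\<Sum>x\<in>V. m x * dot N x x) = (\<Sum>x\<in>V. \<Sum>i<N. m x * (x i)\<^sup>2)"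
      by (simp add: dot_def sum_distrib_left power2_eq_square)
    also have "\<dots> = (\<Sum>i<N. \<Sum>x\<in>V. m x * (x i)\<^sup>2)" by (rule sum.swap)
    also have "\<dots> = (\<Sum>i<N. lip M (s i) (s i))"
    proof (rule sum.cong[OF refl])
      fix i assume "i \<in> {..<N}"
      then show "(\<Sum>x\<in>V. m x * (x i)\<^sup>2) = lip M (s i) (s i)" using mass[of "\<lambda>v. v i"] Fi[of i] by simp
    qed
    also have "\<dots> \<ge> (\<Sum>i<N. 1 - 2 * \<eta>)"
    proof (rule sum_mono)
      fix i assume "i \<in> {..<N}" then have i: "i < N" by simp
      have "1 \<le> nrm (s i) + \<eta>" using nrm_le_diff[of "f i" "s i"] fN[OF i] s[OF i] nrm_diff_commute[of "f i" "s i"] by simp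
      then have "(1 - \<eta>)\<^sup>2 \<le> (nrm (s i))\<^sup>2" using \<eta>1 by (intro power_mono) auto
      moreover have "1 - 2 * \<eta> \<le> (1 - \<eta>)\<^sup>2" by (simp add: power2_diff)
      ultimately show "1 - 2 * \<eta> \<le> lip M (s i) (s i)" using nrm_sq[OF s(2)[OF i]] by simp
    qed
    finally show ?thesis using \<eta>(2) by (simp add: algebra_simps)
  qed
  have energy_bound: "(\<Sum>x\<in>V. \<Sum>y\<in>V. J F x y * dot N (\<lambda>i. x i - y i) (\<lambda>i. x i - y i)) \<le> \<epsilon>\<^sup>2 / (16384 * cell_bound N)"
  proof -
    have "(\<Sum>x\<in>V. \<Sum>y\<in>V. J F x y * dot N (\<lambda>i. x i - y i) (\<lambda>i. x i - y i)) =
       (\<Sum>x\<in>V. \<Sum>y\<in>V. \<Sum>i<N. J F x y * (x i - y i)\<^sup>2)"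
      by (simp add: dot_def sum_distrib_left power2_eq_square)
    also have "\<dots> = (\<Sum>x\<in>V. \<Sum>i<N. \<Sum>y\<in>V. J F x y * (x i - y i)\<^sup>2)" by (intro sum.cong refl sum.swap)
    also have "\<dots> = (\<Sum>i<N. \<Sum>x\<in>V. \<Sum>y\<in>V. J F x y * (x i - y i)\<^sup>2)" by (rule sum.swap)
    also have "\<dots> \<le> (\<Sum>i<N. 2 * \<delta>)"
    proof (rule sum_mono)
      fix i assume "i \<in> {..<N}"
      then show "(\<Sum>x\<in>V. \<Sum>y\<in>V. J F x y * (x i - y i)\<^sup>2) \<le> 2 * \<delta>"
        using en[of "\<lambda>v. v i"] Fi[of i] sE[of i] by simp
    qed
    also have "\<dots> = \<epsilon>\<^sup>2 / (16384 * cell_bound N)" using n by (simp add: \<delta>_def N_def field_simps)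
    finally show ?thesis .
  qed
  have "\<exists>A. (\<forall>i<n. A i \<subseteq> V \<and> 0 < (\<Sum>x\<in>V. m x * of_bool (x \<in> A i)) \<and>
        (\<Sum>x\<in>V. \<Sum>y\<in>V. J F x y * \<bar>of_bool (x \<in> A i) - of_bool (y \<in> A i)\<bar>) \<le> 4 * \<epsilon> * (\<Sum>x\<in>V. m x * of_bool (x \<in> A i))) \<and>
      (\<forall>i<n. \<forall>j<n. i \<noteq> j \<longrightarrow> A i \<inter> A j = {})"
    by (rule exists_disjoint_sets_small_boundary[OF V J_nonneg[OF F] J_commute[OF F] _ N_def iso tot \<epsilon> energy_bound])
      (auto simp: m_def)
  then obtain A where A': "\<forall>i<n. A i \<subseteq> V \<and> 0 < (\<Sum>x\<in>V. m x * of_bool (x \<in> A i)) \<and>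
        (\<Sum>x\<in>V. \<Sum>y\<in>V. J F x y * \<bar>of_bool (x \<in> A i) - of_bool (y \<in> A i)\<bar>) \<le> 4 * \<epsilon> * (\<Sum>x\<in>V. m x * of_bool (x \<in> A i))"
      "\<forall>i<n. \<forall>j<n. i \<noteq> j \<longrightarrow> A i \<inter> A j = {}"
    by (elim exE conjE) (rule that)
  note A = A'(1)[rule_format, THEN conjunct2, THEN conjunct1] A'(1)[rule_format, THEN conjunct2, THEN conjunct2]
    A'(2)[rule_format]
  \<comment> \<open>\<open>D\<close> numbers its sets from 1, the vertex sets are numbered from
    0.\<close>
  define B where "B = (\<lambda>k. F -` (A (k - 1)) \<inter> space M)"
  have Bs: "B k \<in> sets M" for k unfolding B_def by (rule simple_functionD(2)[OF F])
  have ind: "lip M (indicator (B k)) (indicator (B k)) = lip M (\<lambda>x. of_bool (F x \<in> A (k - 1))) (\<lambda>x. of_bool (F x \<in> A (k - 1)))" for k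
    by (intro lip_cong_space) (auto simp: B_def)
  have meas: "measure M (B k) = (\<Sum>x\<in>V. m x * of_bool (x \<in> A (k - 1)))" for k
  proof -
    have "measure M (B k) = lip M (indicator (B k)) (indicator (B k))"
      using lip_indicator[OF Bs, of k "B k"] sets.sets_into_space[OF Bs[of k]] by (simp add: Int_absorb2)
    also have "\<dots> = (\<Sum>x\<in>V. m x * (of_bool (x \<in> A (k - 1)))\<^sup>2)"
      unfolding ind by (rule mass[of "\<lambda>v. of_bool (v \<in> A (k - 1))"])
    also have "\<dots> = (\<Sum>x\<in>V. m x * of_bool (x \<in> A (k - 1)))" by (intro sum.cong) auto
    finally show ?thesis .
  qed
  have Beq: "energy (indicator (B k)) = energy (\<lambda>x. of_bool (F x \<in> A (k - 1)))" for k
  proof -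
    have L: "(indicator (B k) :: 'a \<Rightarrow> real) \<in> L2 M" "(\<lambda>x. of_bool (F x \<in> A (k - 1)) :: real) \<in> L2 M"
      using Bs simple_comp_L2[OF F, of "\<lambda>v. of_bool (v \<in> A (k - 1))"] by auto
    have eq: "indicator (B k) x = (of_bool (F x \<in> A (k - 1)) :: real)" if "x \<in> space M" for x
      using that by (auto simp: B_def)
    have "lip M (P (indicator (B k))) (indicator (B k)) = lip M (P (\<lambda>x. of_bool (F x \<in> A (k - 1)))) (\<lambda>x. of_bool (F x \<in> A (k - 1)))"
    proof -
      have "lip M (P (indicator (B k))) (indicator (B k)) = lip M (P (indicator (B k))) (\<lambda>x. of_bool (F x \<in> A (k - 1)))"
        using eq by (intro lip_cong_space) auto
      also have "\<dots> = lip M (indicator (B k)) (P (\<lambda>x. of_bool (F x \<in> A (k - 1))))" using L by (rule P_sym)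
      also have "\<dots> = lip M (\<lambda>x. of_bool (F x \<in> A (k - 1))) (P (\<lambda>x. of_bool (F x \<in> A (k - 1))))"
        using eq by (intro lip_cong_space) auto
      finally show ?thesis using L by (simp add: P_sym)
    qed
    then show ?thesis using ind[of k] by (simp add: energy_def)
  qed
  have "ratio (B k) \<le> 2 * \<epsilon>" if k: "k \<in> {1..n}" for k
  proof -
    have k': "k - 1 < n" using k by auto
    have "2 * energy (indicator (B k)) = (\<Sum>x\<in>V. \<Sum>y\<in>V. J F x y * (of_bool (x \<in> A (k - 1)) - of_bool (y \<in> A (k - 1)))\<^sup>2)"
      unfolding Beq using en[of "\<lambda>v. of_bool (v \<in> A (k - 1))"] by simp
    \<comment> \<open>For an indicator, squares and absolute values of differences agree, so the
      boundary is twice the energy and the bound \<open>4 * \<epsilon>\<close> becomes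
      \<open>2 * \<epsilon>\<close>.\<close>
    also have "\<dots> = (\<Sum>x\<in>V. \<Sum>y\<in>V. J F x y * \<bar>of_bool (x \<in> A (k - 1)) - of_bool (y \<in> A (k - 1))\<bar>)"
      by (intro sum.cong) (auto simp: of_bool_def)
    also have "\<dots> \<le> 4 * \<epsilon> * measure M (B k)" using A(2)[OF k'] by (simp add: meas)
    finally show ?thesis using A(1)[OF k'] by (simp add: ratio_eq_energy[OF Bs] meas divide_le_eq)
  qed
  moreover have "B \<in> D M n"
    unfolding D_def
  proof (intro CollectI conjI ballI)
    fix k assume k: "k \<in> {1..n}"
    then have "k - 1 < n" by auto
    then show "measure M (B k) > 0" using A(1) by (simp add: meas)
  next
    show "disjoint_family_on B {1..n}"
      unfolding disjoint_family_on_def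
    proof (intro ballI impI)
      fix i j assume "i \<in> {1..n}" "j \<in> {1..n}" "i \<noteq> j"
      then have "A (i - 1) \<inter> A (j - 1) = {}" by (intro A(3)) auto
      then show "B i \<inter> B j = {}" by (auto simp: B_def)
    qed
  qed (rule Bs)
  ultimately show ?thesis by blast
qed

lemma exists_orthonormal_family:
  fixes k :: nat
  assumes "\<And>F. finite F \<Longrightarrow> F \<subseteq> L2 M \<Longrightarrow> \<exists>f\<in>L2 M. nrm f = 1 \<and> (\<forall>g\<in>F. lip M f g = 0) \<and> energy f \<le> \<delta>"
  shows "\<exists>f. (\<forall>i<k. f i \<in> L2 M \<and> nrm (f i) = 1 \<and> energy (f i) \<le> \<delta>) \<and> (\<forall>i<k. \<forall>j<k. i \<noteq> j \<longrightarrow> lip M (f i) (f j) = 0)"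
proof (induction k)
  case (Suc k)
  then obtain f where f: "\<And>i. i < k \<Longrightarrow> f i \<in> L2 M \<and> nrm (f i) = 1 \<and> energy (f i) \<le> \<delta>"
    "\<And>i j. i < k \<Longrightarrow> j < k \<Longrightarrow> i \<noteq> j \<Longrightarrow> lip M (f i) (f j) = 0" by blast
  obtain g where g: "g \<in> L2 M" "nrm g = 1" "\<forall>h\<in>f ` {..<k}. lip M g h = 0" "energy g \<le> \<delta>"
    using assms[of "f ` {..<k}"] f by auto
  have gf: "lip M g (f i) = 0" "lip M (f i) g = 0" if "i < k" for i
    using g(1,3) that f(1)[OF that] ip_commute[of g "f i"] by auto
  show ?case
    by (rule exI[of _ "f(k := g)"]) (use f g gf in \<open>auto simp: less_Suc_eq\<close>)
qed simp

lemma normalise_orthogonal: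
  assumes "f \<in> L2 M" "nrm f > 0" "\<forall>g\<in>F. lip M f g = 0" "F \<subseteq> L2 M" "energy f \<le> \<delta> * lip M f f"
  shows "\<exists>f\<in>L2 M. nrm f = 1 \<and> (\<forall>g\<in>F. lip M f g = 0) \<and> energy f \<le> \<delta>"
proof (rule bexI[of _ "(1 / nrm f) *\<^sub>R f"], intro conjI)
  have "energy ((1 / nrm f) *\<^sub>R f) = energy f / (nrm f)\<^sup>2" using assms by (simp add: energy_scale power_divide)
  also have "\<dots> \<le> \<delta>" using assms(1,2,5) nrm_sq[OF assms(1)] zero_less_power[OF assms(2), of 2] by (simp add: divide_le_eq)
  finally show "energy ((1 / nrm f) *\<^sub>R f) \<le> \<delta>" .
  show "\<forall>g\<in>F. lip M ((1 / nrm f) *\<^sub>R f) g = 0" using assms by (auto simp: ip_linear subset_iff)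
qed (use assms in \<open>auto simp: nrm_scale\<close>)

lemma exists_clusters:
  assumes n: "n \<ge> 1" and \<epsilon>: "\<epsilon> > 0"
    and ex: "\<And>F. finite F \<Longrightarrow> F \<subseteq> L2 M \<Longrightarrow>
      \<exists>f\<in>L2 M. nrm f = 1 \<and> (\<forall>g\<in>F. lip M f g = 0) \<and> energy f \<le> \<epsilon>\<^sup>2 / cluster_bound n"
  shows "\<exists>A\<in>D M n. \<forall>k\<in>{1..n}. ratio (A k) \<le> 2 * \<epsilon>"
proof -
  obtain f where "\<forall>i<2 * n. f i \<in> L2 M \<and> nrm (f i) = 1 \<and> energy (f i) \<le> \<epsilon>\<^sup>2 / cluster_bound n"
    "\<forall>i<2 * n. \<forall>j<2 * n. i \<noteq> j \<longrightarrow> lip M (f i) (f j) = 0"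
    using exists_orthonormal_family[OF ex, of "2 * n"] by blast
  then show ?thesis by (intro clusters_from_orthonormal[OF n \<epsilon>, of f]) auto
qed

text \<open>The cluster construction also supplies n disjoint sets of positive measure: with
  \<epsilon> = 1 + 2 c the energy requirement is weaker than the general bound
  \<open>energy_le\<close>, so infinite dimension alone provides the functions. The resulting bound
  on the ratios is discarded.\<close>

lemma D_nonempty: assumes inf: "inf_dim_L2 M" and n: "n \<ge> 1" shows "D M n \<noteq> {}"
proof -
  define c where "c = cluster_bound n"
  have c: "c > 0" using n cluster_bound_pos by (simp add: c_def)
  have "2 * c \<le> (1 + 2 * c)\<^sup>2" using c by (simp add: power2_eq_square algebra_simps)
  then have le: "2 \<le> (1 + 2 * c)\<^sup>2 / c" using c by (simp add: field_simps)
  have "\<exists>A\<in>D M n. \<forall>k\<in>{1..n}. ratio (A k) \<le> 2 * (1 + 2 * c)"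
  proof (rule exists_clusters[OF n])
    fix F :: "('a \<Rightarrow> real) set" assume F: "finite F" "F \<subseteq> L2 M"
    obtain f where f: "f \<in> L2 M" "nrm f > 0" "\<forall>g\<in>F. lip M f g = 0" using inf_dim_orthogonal[OF inf F] by blast
    have "energy f \<le> 2 * lip M f f" using energy_le[OF f(1)] nrm_sq[OF f(1)] by simp
    also have "\<dots> \<le> (1 + 2 * c)\<^sup>2 / c * lip M f f" using le ip_nonneg[OF f(1)] by (rule mult_right_mono)
    finally show "\<exists>f\<in>L2 M. nrm f = 1 \<and> (\<forall>g\<in>F. lip M f g = 0) \<and> energy f \<le> (1 + 2 * c)\<^sup>2 / cluster_bound n"
      unfolding c_def[symmetric] by (rule normalise_orthogonal[OF f F(2)])
  qed (use c in simp)
  then show ?thesis by blast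
qed

lemma kappa_le_0_if_not_coercive:
  assumes neg: "\<not> (\<exists>F \<delta>. coercive_off F \<delta>)" and n: "n \<ge> 1"
  shows "kappa M P n \<le> 0"
proof (rule field_le_epsilon)
  fix e :: real assume e: "e > 0"
  \<comment> \<open>The value \<open>e / 2\<close> compensates the factor 2 in the ratio bound of
    \<open>exists_clusters\<close>.\<close>
  define \<delta> where "\<delta> = (e / 2)\<^sup>2 / cluster_bound n"
  have \<delta>: "\<delta> > 0" using e cluster_bound_pos[OF n] by (simp add: \<delta>_def)
  have "\<exists>A\<in>D M n. \<forall>k\<in>{1..n}. ratio (A k) \<le> 2 * (e / 2)"
  proof (rule exists_clusters[OF n])
    fix F :: "('a \<Rightarrow> real) set" assume F: "finite F" "F \<subseteq> L2 M"
    obtain f where f: "f \<in> L2 M" "\<forall>g\<in>F. lip M f g = 0" "energy f < \<delta> * lip M f f"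
      using neg F \<delta> unfolding coercive_off_def by (meson not_le)
    have "0 < \<delta> * lip M f f" using f(3) energy_nonneg[OF f(1)] by linarith
    then have "lip M f f > 0" using \<delta> by (simp add: zero_less_mult_iff)
    then have "nrm f > 0" by (simp add: nrm_def)
    then show "\<exists>f\<in>L2 M. nrm f = 1 \<and> (\<forall>g\<in>F. lip M f g = 0) \<and> energy f \<le> (e / 2)\<^sup>2 / cluster_bound n"
      unfolding \<delta>_def[symmetric] by (rule normalise_orthogonal[OF f(1) _ f(2) F(2) less_imp_le[OF f(3)]])
  qed (use e in simp)
  then obtain A where "A \<in> D M n" "\<forall>k\<in>{1..n}. ratio (A k) \<le> e" by auto
  then have "kappa M P n \<le> e" by (intro kappa_le[OF _ n, of A]) auto
  then show "kappa M P n \<le> 0 + e" by simp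
qed

section \<open>The equivalences with coercivity and with the spectral gap\<close>

lemma lambda_ess_less_1_iff:
  assumes inf: "inf_dim_L2 M" shows "lambda_ess M P < 1 \<longleftrightarrow> (\<exists>F \<delta>. coercive_off F \<delta>)"
proof
  assume "\<exists>F \<delta>. coercive_off F \<delta>"
  then obtain F \<delta> where co: "coercive_off F \<delta>" by blast
  have "lambda_ess M P \<le> 1 - \<delta>" unfolding lambda_ess_def
    by (intro cSup_least ess_spectrum_nonempty inf_dim_orthogonal[OF inf] ess_spectrum_le_if_coercive_off[OF co])
  then show "lambda_ess M P < 1" using co by (simp add: coercive_off_def)
qed (rule coercive_off_if_lambda_ess_less_1)

lemma bdd_above_kappa: "inf_dim_L2 M \<Longrightarrow> bdd_above (kappa M P ` {1..})"
  using kappa_le_2[OF D_nonempty] by (intro bdd_aboveI2[of _ _ 2]) auto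

lemma Sup_kappa_pos_iff:
  assumes inf: "inf_dim_L2 M" shows "Sup (kappa M P ` {1..}) > 0 \<longleftrightarrow> (\<exists>F \<delta>. coercive_off F \<delta>)"
proof
  assume pos: "Sup (kappa M P ` {1..}) > 0"
  show "\<exists>F \<delta>. coercive_off F \<delta>"
  proof (rule ccontr)
    assume "\<not> ?thesis"
    then have "Sup (kappa M P ` {1..}) \<le> 0" using kappa_le_0_if_not_coercive by (intro cSup_least) auto
    then show False using pos by simp
  qed
next
  assume "\<exists>F \<delta>. coercive_off F \<delta>"
  then obtain F \<delta> where co: "coercive_off F \<delta>" by blast
  then have "0 < kappa M P (Suc (card F))" by (rule kappa_pos_if_coercive_off) (simp add: D_nonempty[OF inf])
  also have "\<dots> \<le> Sup (kappa M P ` {1..})" by (rule cSup_upper[OF _ bdd_above_kappa[OF inf]]) simp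
  finally show "Sup (kappa M P ` {1..}) > 0" .
qed

lemma lim_kappa: assumes inf: "inf_dim_L2 M" shows "lim (kappa M P) = Sup (kappa M P ` {1..})"
proof -
  have eq: "range (\<lambda>n. kappa M P (Suc n)) = kappa M P ` {1..}"
  proof -
    have "{1..} = range Suc" by (auto simp: image_iff Suc_le_eq gr0_conv_Suc)
    then show ?thesis by (simp add: image_image)
  qed
  \<comment> \<open>The sequence is shifted because index 0 involves \<open>Max\<close> of the empty
    set; monotonicity starts at 1.\<close>
  have "incseq (\<lambda>n. kappa M P (Suc n))" by (rule incseq_SucI) (simp add: kappa_Suc D_nonempty[OF inf])
  then have "(\<lambda>n. kappa M P (Suc n)) \<longlonglongrightarrow> Sup (kappa M P ` {1..})"
    using LIMSEQ_incseq_SUP[of "\<lambda>n. kappa M P (Suc n)"] bdd_above_kappa[OF inf] by (simp only: eq)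
  then have "kappa M P \<longlonglongrightarrow> Sup (kappa M P ` {1..})" by (rule LIMSEQ_imp_Suc)
  then show ?thesis by (rule limI)
qed

lemma spectral_gap_if_coercive_off:
  assumes "inf_dim_L2 M" "coercive_off F \<delta>" shows "spectral_gap M P"
proof -
  have "1 \<in> discrete_spectrum M P"
    using assms lambda_ess_less_1_iff by (intro one_discrete_if_lambda_ess_less_1) blast
  then show ?thesis by (auto simp: discrete_spectrum_def spectral_gap_def)
qed

lemma ergodic_coercive_off_if_spectral_gap:
  assumes erg: "ergodic_op M P" and gap: "spectral_gap M P"
  shows "\<exists>\<delta>. coercive_off {\<lambda>x. 1} \<delta>"
proof -
  obtain e where e: "e > 0" "\<forall>m\<in>op_spectrum M P. m \<noteq> 1 \<longrightarrow> e \<le> \<bar>m - 1\<bar>" using gap by (auto simp: spectral_gap_def)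
  have "\<exists>c. aeq M f (\<lambda>x. \<Sum>b\<in>{\<lambda>x. 1}. c b * b x)" if f: "f \<in> eigenspace M P 1" for f
  proof -
    obtain c where "aeq M f (\<lambda>x. c)" using erg f by (auto simp: ergodic_op_def)
    then show ?thesis by (intro exI[of _ "\<lambda>_. c"]) simp
  qed
  then show ?thesis using isolated_imp_coercive_off[OF _ _ _ e, of "{\<lambda>x. 1}"] by auto
qed

end

theorem theorem2p1:
  fixes M :: "'a measure" and P :: "('a \<Rightarrow> real) \<Rightarrow> 'a \<Rightarrow> real"
  assumes "prob_space M"
    and "inf_dim_L2 M"
    and "markov_operator M P"
    and "symmetric_op M P"
  shows "(lambda_ess M P < 1 \<longleftrightarrow> Sup (kappa M P ` {1..}) > 0)
    \<and> (\<forall>n\<ge>1. kappa M P n \<le> kappa M P (Suc n))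
    \<and> (ergodic_op M P \<longrightarrow>
         ((spectral_gap M P \<longleftrightarrow> kappa M P 2 > 0) \<and>
          (spectral_gap M P \<longleftrightarrow> lim (kappa M P) > 0)))"
proof -
  interpret prob_space M by fact
  interpret symmetric_markov M P by unfold_locales fact+
  note inf = assms(2)
  have mono: "kappa M P n \<le> kappa M P (Suc n)" if "n \<ge> 1" for n
    using that by (intro kappa_Suc D_nonempty[OF inf]) auto
  have kappa2: "kappa M P 2 \<le> Sup (kappa M P ` {1..})"
    by (rule cSup_upper[OF _ bdd_above_kappa[OF inf]]) simp
  have gap_imp: "kappa M P 2 > 0" if erg: "ergodic_op M P" and gap: "spectral_gap M P"
  proof -
    obtain \<delta> where co: "coercive_off {\<lambda>x. 1} \<delta>" using ergodic_coercive_off_if_spectral_gap[OF erg gap] by blast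
    show ?thesis using kappa_pos_if_coercive_off[OF co] D_nonempty[OF inf, of 2] by (simp add: numeral_2_eq_2)
  qed
  have gap_if: "spectral_gap M P" if "Sup (kappa M P ` {1..}) > 0"
    using that Sup_kappa_pos_iff[OF inf] spectral_gap_if_coercive_off[OF inf] by blast
  show ?thesis
    \<comment> \<open>In the ergodic case the implications form a cycle: a gap gives a positive
      \<open>kappa M P 2\<close>, hence a positive supremum, hence a gap; the limit equals the
      supremum.\<close>
    using lambda_ess_less_1_iff[OF inf] Sup_kappa_pos_iff[OF inf] mono gap_imp gap_if kappa2 lim_kappa[OF inf]
    by (auto intro: less_le_trans)
qed

end
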